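(* Consider the randomized block proximal-gradient method $x^{k+1}=T_{i_k}(x^k;\alpha_k)$, $k\ge0$, for minimizing $H=F+R$ on $\mathbb R^d=\mathbb R^{d_1}\times\cdots\times\mathbb R^{d_m}$. Suppose that $H$ is coercive, definable and has a locally Lipschitz continuous gradient; that the blockwise regularity assumption holds; that $$0<\alpha_k\le\bar\alpha<\min\Big\{2,\min_{i\in[m]}\frac{\widehat L_i}{\varrho_i}\Big\}\quad\forall k\ge0,\qquad\sum_{k=0}^\infty\alpha_k=+\infty;$$ and that, for some $\rho>0$, $\mathbb P(i_k=i\mid\mathcal F_k)\ge\rho$ for all $i\in[m]$, $k\ge0$. For each critical point $\bar x$ of $H$ let $\varphi_{\bar x}:[0,\eta_{\bar x})\to\mathbb R_+$ be a local KL desingularization function of $H$ at $\bar x$, fix $t_{0,\bar x}\in(0,\eta_{\bar x})$, and define $\phi_{\bar x}(0):=0$ and, for $t\in(0,\eta_{\bar x})$, $$\phi_{\bar x}(t):=\frac1{(\varphi_{\bar x}'(t))^2},\qquad\psi_{\bar x}(t):=\int_t^{t_{0,\bar x}}(\varphi_{\bar x}'(s))^2\,ds .$$ Then $1/\sqrt{\phi_{\bar x}}$ is integrable near zero for every critical point $\bar x$. Moreover, if $\bar x$ is not a local maximizer, then $1/\phi_{\bar x}$ is not integrable near zero. Consequently, with $$c_1=\Big(1-\frac{\bar\alpha}2\Big)\min_{i\in[m]}\widehat L_i,\quad c_2=\rho\min_{i\in[m]}\frac1{(\widehat L_i+\bar\alpha L_i^R)^2},\quad c_3=\max_{i\in[m]}\frac1{(\widehat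 L_i-\bar\alpha\varrho_i)^2},$$ and $A_k:=\sum_{i=0}^{k-1}\alpha_i$, there exists a random variable $x^*$ such that, almost surely, $x^*$ is a critical point of $H$ with $H(x^* )\le H(x^0)$ and $x^k\to x^*$. Moreover $\mathbb P(E_0)=1$ for the event $$E_0=\Big\{\omega:\ \|\nabla H(x^k)\|^2\to0,\ \liminf_{k\to\infty}\frac{\sum_{i=1}^k\alpha_iz_i}{\sum_{i=1}^k\alpha_i}\ge c_2\Big\},$$ and the following hold on $E_0$: (i) if $1/\phi_{x^*(\omega)}$ is integrable near $0$, then $\{x^k(\omega)\}$ terminates in finitely many iterations (is eventually constant); (ii) if $1/\phi_{x^*(\omega)}$ is not integrable near $0$, then there is a positive integer $K_4(\omega)$ such that for all $k\ge K_4(\omega)$, with $H^\infty(\omega):=\lim_{j\to\infty}H(x^j(\omega))$, $$H(x^k(\omega))-H^\infty(\omega)\le\psi_{x^*(\omega)}^{-1}\Big(\frac{c_1c_2}2A_k\Big),\qquad\|x^k(\omega)-x^*(\omega)\|\le\frac{\sqrt2}{c_1\sqrt{c_2}}\,\varphi_{x^*(\omega)}\Big(\psi_{x^*(\omega)}^{-1}\Big(\frac{c_1c_2}2A_k\Big)\Big).$$ In particular, the iterates converge almost surely to a random critical point $x^*$ of $H$. On every such convergent path, either $x^*$ is a local maximizer and the sequence terminates at $x^*$ after finitely many iterations, or $x^*$ is not a local maximizer and the rate estimates in (ii) hold.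
   Context: Setting. $(\Omega,\mathcal F,\{\mathcal F_k\}_{k\ge0},\mathbb P)$ is a filtered probability space, $x^0$ and $\{\alpha_k\}$ are deterministic, $i_k\in[m]=\{1,\dots,m\}$ is the random block sampled at iteration $k$, and the iterates $\{x^k\}$ are adapted to $\{\mathcal F_k\}$. $F,R\in C^1(\mathbb R^d)$, $x=(x_1,\dots,x_m)$, $I_i:\mathbb R^{d_i}\to\mathbb R^d$ is the canonical embedding into the $i$th block, and $\nabla_iG:=I_i^\top\nabla G$. Blockwise regularity assumption. For each $i\in[m]$ there are constants $L_i^F,L_i^R>0$, $\varrho_i\ge0$ such that: (a) $F(x+I_iu_i)\le F(x)+\langle\nabla_iF(x),u_i\rangle+\frac{L_i^F}2\|u_i\|^2$ for all $x\in\mathbb R^d$, $u_i\in\mathbb R^{d_i}$; (b) for every fixed $(x_j)_{j\ne i}$, the function $u_i\mapsto R(x_1,\dots,x_{i-1},u_i,x_{i+1},\dots,x_m)+\frac{\varrho_i}2\|u_i\|^2$ is convex; (c) $\|\nabla_iR(x+I_iu_i)-\nabla_iR(x)\|\le L_i^R\|u_i\|$ whenever $x,x+I_iu_i\in S:=\{x:H(x)\le H(x^0)\}$. Put $\widehat L_i:=L_i^F+\varrho_i$, with $\widehat L_i/\varrho_i:=+\infty$ if $\varrho_i=0$. The map $T_i(x;\alpha)$ replaces the $i$th block $x_i$ of $x$ by $$T_i^b(x;\alpha)=\arg\min_{u_i\in\mathbb R^{d_i}}\Big\{R(x+I_i(u_i-x_i))+\langle\nabla_iF(x),u_i-x_i\rangle+\frac{\widehat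 L_i}{2\alpha}\|u_i-x_i\|^2\Big\}$$ (a unique minimizer for $\alpha\in(0,\bar\alpha]$), leaving the other blocks unchanged. Random variables $z_k$: $z_k:=\frac{\|x^{k+1}-x^k\|^2}{\alpha_k^2\|\nabla H(x^k)\|^2}$ if $\nabla H(x^k)\ne0$, and $z_k:=c_2$ otherwise. "Definable" means definable in a fixed o-minimal structure over the real field. Local KL desingularization function of $H$ at $\bar x$: for some $\delta_{\bar x},\eta_{\bar x}\in(0,+\infty]$, a continuous concave function $\varphi_{\bar x}:[0,\eta_{\bar x})\to\mathbb R_+$ with $\varphi_{\bar x}(0)=0$, continuously differentiable on $(0,\eta_{\bar x})$ with $\varphi_{\bar x}'>0$ there, such that $\varphi_{\bar x}'(H(x)-H(\bar x))\,\|\nabla H(x)\|\ge1$ whenever $\|x-\bar x\|<\delta_{\bar x}$ and $0<H(x)-H(\bar x)<\eta_{\bar x}$. (It is a known theorem that one exists at every point for every definable $C^1$ function.) A nonnegative function is integrable near $0$ if it is integrable on $(0,\tau']$ for some $\tau'>0$. $\psi_{\bar x}$ is strictly decreasing; when $1/\phi_{\bar x}$ is not integrable near $0$, $\psi_{\bar x}(t)\to+\infty$ as $t\downarrow0$ and $\psi_{\bar x}^{-1}$ is defined on $(\lim_{t\uparrow\eta_{\bar x}}\psi_{\bar x}(t),+\infty)$. *)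

theory Defs
  imports "HOL-Probability.Probability"
begin

section \<open>Gradients\<close>

definition grad :: "('a::real_inner \<Rightarrow> real) \<Rightarrow> 'a \<Rightarrow> 'a" where
  "grad f x = (THE D. GDERIV f x :> D)"

definition C1 :: "('a::real_inner \<Rightarrow> real) \<Rightarrow> bool" where
  "C1 f \<longleftrightarrow> (\<forall>x. f differentiable (at x)) \<and> continuous_on UNIV (grad f)"

definition critical_point :: "('a::real_inner \<Rightarrow> real) \<Rightarrow> 'a \<Rightarrow> bool" where
  "critical_point f x \<longleftrightarrow> grad f x = 0"

definition local_maximizer :: "('a::topological_space \<Rightarrow> real) \<Rightarrow> 'a \<Rightarrow> bool" where
  "local_maximizer f x \<longleftrightarrow> (\<forall>\<^sub>F y in nhds x. f y \<le> f x)"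

definition coercive :: "('a::real_normed_vector \<Rightarrow> real) \<Rightarrow> bool" where
  "coercive f \<longleftrightarrow> filterlim f at_top at_infinity"

definition locally_lipschitz :: "('a::metric_space \<Rightarrow> 'b::metric_space) \<Rightarrow> bool" where
  "locally_lipschitz f \<longleftrightarrow> (\<forall>x. \<exists>r>0. \<exists>L. lipschitz_on L (ball x r) f)"


section \<open>O-minimal structures over the real field\<close>

text \<open>Points of n-dimensional real space are lists of length n; \<open>S n\<close> is the collection of
  definable subsets of n-dimensional space. Every connected subset of the line, hence every singleton,
  belongs to \<open>S 1\<close>, so parameters are allowed.\<close>

definition tuples :: "nat \<Rightarrow> real list set" where
  "tuples n = {xs. length xs = n}"

definition o_minimal_structure :: "(nat \<Rightarrow> real list set set) \<Rightarrow> bool" where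
  "o_minimal_structure S \<longleftrightarrow>
     (\<forall>n. algebra (tuples n) (S n)) \<and>
     (\<forall>n. \<forall>A\<in>S n. {a # xs | a xs. xs \<in> A} \<in> S (Suc n) \<and> {xs @ [a] | a xs. xs \<in> A} \<in> S (Suc n)) \<and>
     (\<forall>n. \<forall>i<n. \<forall>j<n. {xs \<in> tuples n. xs ! i = xs ! j} \<in> S n) \<and>
     (\<forall>n. \<forall>A\<in>S (Suc n). butlast ` A \<in> S n) \<and>
     {[a, b] | a b. a < b} \<in> S 2 \<and>
     {[a, b, a + b] | a b. True} \<in> S 3 \<and>
     {[a, b, a * b] | a b. True} \<in> S 3 \<and>
     (\<forall>A. A \<in> S 1 \<longleftrightarrow>
        (\<exists>\<J>. finite \<J> \<and> (\<forall>J\<in>\<J>. is_interval J) \<and> A = (\<lambda>a. [a]) ` \<Union>\<J>))"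

text \<open>Definability of the graph. The enumeration \<open>js\<close> of the coordinates is immaterial, because the
  axioms above make \<open>S\<close> stable under permutations of coordinates.\<close>

definition definable :: "(nat \<Rightarrow> real list set set) \<Rightarrow> (real ^ 'n::finite \<Rightarrow> real) \<Rightarrow> bool" where
  "definable S f \<longleftrightarrow>
     (\<exists>js. distinct js \<and> set js = UNIV \<and>
        {map (\<lambda>j. x $ j) js @ [f x] | x. True} \<in> S (Suc CARD('n)))"


section \<open>Blocks of coordinates\<close>

text \<open>A map \<open>blk\<close> assigns to each of the d coordinates the number of the block it belongs to, so
  that \<open>d\<^sub>i = card {j. blk j = i}\<close>. The factor of dimension \<open>d\<^sub>i\<close> is represented by its image
  \<open>block_space blk i\<close> under the (isometric) canonical embedding \<open>I\<^sub>i\<close>; accordingly \<open>I\<^sub>i u\<^sub>i\<close> is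
  just \<open>u \<in> block_space blk i\<close>, and \<open>block_part blk i\<close> is \<open>I\<^sub>i I\<^sub>i\<^sup>T\<close>.\<close>

definition block_space :: "('n::finite \<Rightarrow> nat) \<Rightarrow> nat \<Rightarrow> (real ^ 'n) set" where
  "block_space blk i = {u. \<forall>j. blk j \<noteq> i \<longrightarrow> u $ j = 0}"

definition block_part :: "('n::finite \<Rightarrow> nat) \<Rightarrow> nat \<Rightarrow> real ^ 'n \<Rightarrow> real ^ 'n" where
  "block_part blk i x = (\<chi> j. if blk j = i then x $ j else 0)"

definition block_replace :: "('n::finite \<Rightarrow> nat) \<Rightarrow> nat \<Rightarrow> real ^ 'n \<Rightarrow> real ^ 'n \<Rightarrow> real ^ 'n" where
  "block_replace blk i x u = (\<chi> j. if blk j = i then u $ j else x $ j)"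

definition block_grad ::
  "('n::finite \<Rightarrow> nat) \<Rightarrow> nat \<Rightarrow> (real ^ 'n \<Rightarrow> real) \<Rightarrow> real ^ 'n \<Rightarrow> real ^ 'n" where
  "block_grad blk i G x = block_part blk i (grad G x)"

definition blockwise_regular ::
  "nat \<Rightarrow> ('n::finite \<Rightarrow> nat) \<Rightarrow> (real ^ 'n \<Rightarrow> real) \<Rightarrow> (real ^ 'n \<Rightarrow> real) \<Rightarrow> real ^ 'n \<Rightarrow>
   (nat \<Rightarrow> real) \<Rightarrow> (nat \<Rightarrow> real) \<Rightarrow> (nat \<Rightarrow> real) \<Rightarrow> bool" where
  "blockwise_regular m blk F R x0 LF LR \<mu> \<longleftrightarrow>
     (\<forall>i\<in>{1..m}.
        LF i > 0 \<and> LR i > 0 \<and> \<mu> i \<ge> 0 \<and>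
        (\<forall>x. \<forall>u\<in>block_space blk i.
           F (x + u) \<le> F x + block_grad blk i F x \<bullet> u + LF i / 2 * (norm u)\<^sup>2) \<and>
        (\<forall>x. convex_on (block_space blk i)
           (\<lambda>u. R (block_replace blk i x u) + \<mu> i / 2 * (norm u)\<^sup>2)) \<and>
        (\<forall>x. \<forall>u\<in>block_space blk i.
           F x + R x \<le> F x0 + R x0 \<and> F (x + u) + R (x + u) \<le> F x0 + R x0 \<longrightarrow>
           norm (block_grad blk i R (x + u) - block_grad blk i R x) \<le> LR i * norm u))"

definition prox_block ::
  "('n::finite \<Rightarrow> nat) \<Rightarrow> (real ^ 'n \<Rightarrow> real) \<Rightarrow> (real ^ 'n \<Rightarrow> real) \<Rightarrow> (nat \<Rightarrow> real) \<Rightarrow>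
   nat \<Rightarrow> real ^ 'n \<Rightarrow> real \<Rightarrow> real ^ 'n" where
  "prox_block blk F R Lhat i x \<alpha> =
     (ARG_MIN (\<lambda>u. R (x + (u - block_part blk i x)) + block_grad blk i F x \<bullet> (u - block_part blk i x)
                  + Lhat i / (2 * \<alpha>) * (norm (u - block_part blk i x))\<^sup>2) u. u \<in> block_space blk i)"

definition prox_step ::
  "('n::finite \<Rightarrow> nat) \<Rightarrow> (real ^ 'n \<Rightarrow> real) \<Rightarrow> (real ^ 'n \<Rightarrow> real) \<Rightarrow> (nat \<Rightarrow> real) \<Rightarrow>
   nat \<Rightarrow> real ^ 'n \<Rightarrow> real \<Rightarrow> real ^ 'n" where
  "prox_step blk F R Lhat i x \<alpha> = block_replace blk i x (prox_block blk F R Lhat i x \<alpha>)"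


section \<open>Kurdyka-Lojasiewicz desingularization\<close>

definition KL_desingularization ::
  "('a::real_inner \<Rightarrow> real) \<Rightarrow> 'a \<Rightarrow> ereal \<Rightarrow> (real \<Rightarrow> real) \<Rightarrow> bool" where
  "KL_desingularization H xb \<eta> \<phi> \<longleftrightarrow>
     0 < \<eta> \<and>
     (\<forall>t. 0 \<le> t \<and> ereal t < \<eta> \<longrightarrow> 0 \<le> \<phi> t) \<and>
     continuous_on {t. 0 \<le> t \<and> ereal t < \<eta>} \<phi> \<and>
     concave_on {t. 0 \<le> t \<and> ereal t < \<eta>} \<phi> \<and>
     \<phi> 0 = 0 \<and>
     (\<forall>t. 0 < t \<and> ereal t < \<eta> \<longrightarrow> \<phi> differentiable (at t) \<and> 0 < deriv \<phi> t) \<and>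
     continuous_on {t. 0 < t \<and> ereal t < \<eta>} (deriv \<phi>) \<and>
     (\<exists>\<delta>::ereal. 0 < \<delta> \<and>
        (\<forall>x. ereal (norm (x - xb)) < \<delta> \<and> 0 < H x - H xb \<and> ereal (H x - H xb) < \<eta> \<longrightarrow>
             1 \<le> deriv \<phi> (H x - H xb) * norm (grad H x)))"

definition KL_phi :: "(real \<Rightarrow> real) \<Rightarrow> real \<Rightarrow> real" where
  "KL_phi \<phi> t = (if t = 0 then 0 else 1 / (deriv \<phi> t)\<^sup>2)"

text \<open>The interval integral is signed: it is negative for \<open>t > t0\<close>.\<close>

definition KL_psi :: "(real \<Rightarrow> real) \<Rightarrow> real \<Rightarrow> real \<Rightarrow> real" where
  "KL_psi \<phi> t0 t = (LBINT s=ereal t..ereal t0. (deriv \<phi> s)\<^sup>2)"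

definition KL_psi_inv :: "(real \<Rightarrow> real) \<Rightarrow> ereal \<Rightarrow> real \<Rightarrow> real \<Rightarrow> real" where
  "KL_psi_inv \<phi> \<eta> t0 = the_inv_into {t. 0 < t \<and> ereal t < \<eta>} (KL_psi \<phi> t0)"

definition integrable_near_0 :: "(real \<Rightarrow> real) \<Rightarrow> bool" where
  "integrable_near_0 g \<longleftrightarrow> (\<exists>\<tau>>0. set_integrable lborel {0<..\<tau>} g)"


section \<open>Behaviour of a single trajectory\<close>

definition eventually_constant :: "(nat \<Rightarrow> 'a) \<Rightarrow> bool" where
  "eventually_constant x \<longleftrightarrow> (\<exists>K. \<forall>k\<ge>K. x k = x K)"

text \<open>The membership conjunct says that the argument of \<open>KL_psi_inv\<close> lies in its domain.\<close>

definition KL_rates ::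
  "('a::real_normed_vector \<Rightarrow> real) \<Rightarrow> (real \<Rightarrow> real) \<Rightarrow> ereal \<Rightarrow> real \<Rightarrow> real \<Rightarrow> real \<Rightarrow>
   (nat \<Rightarrow> real) \<Rightarrow> (nat \<Rightarrow> 'a) \<Rightarrow> 'a \<Rightarrow> bool" where
  "KL_rates H \<phi> \<eta> t0 c1 c2 A x xs \<longleftrightarrow>
     (\<exists>K4\<ge>1. \<forall>k\<ge>K4.
        c1 * c2 / 2 * A k \<in> KL_psi \<phi> t0 ` {t. 0 < t \<and> ereal t < \<eta>} \<and>
        H (x k) - lim (\<lambda>j. H (x j)) \<le> KL_psi_inv \<phi> \<eta> t0 (c1 * c2 / 2 * A k) \<and>
        norm (x k - xs) \<le> sqrt 2 / (c1 * sqrt c2) * \<phi> (KL_psi_inv \<phi> \<eta> t0 (c1 * c2 / 2 * A k)))"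

end

theory Submission
  imports Defs
begin

text \<open>Put \<open>r\<^sub>k = H x\<^sub>k - lim H x\<^sub>j\<close>. A proximal step gives
  \<open>r\<^sub>k - r\<^sub>k\<^sub>+\<^sub>1 \<ge> c1 \<alpha>\<^sub>k z\<^sub>k \<parallel>\<nabla>H x\<^sub>k\<parallel>\<^sup>2\<close>, so the KL inequality yields
  \<open>\<psi> r\<^sub>k\<^sub>+\<^sub>1 - \<psi> r\<^sub>k \<ge> c1 \<alpha>\<^sub>k z\<^sub>k\<close>. On \<open>E0\<close> the averages of \<open>z\<close> have lower limit at least \<open>c2\<close>, which
  leaves enough room for \<open>r\<^sub>k \<le> s\<^sub>k\<^sub>+\<^sub>1\<close> with \<open>\<psi> s\<^sub>k = c1 c2 A\<^sub>k / 2\<close>. Individual \<open>z\<^sub>k\<close> may be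
  arbitrarily small, so the length of the trajectory is bounded by weighting the inequality between
  the arithmetic and geometric mean with \<open>1 / \<phi>' s\<^sub>k\<^sub>+\<^sub>1\<close> and summing by parts. Convergence of the whole
  sequence follows from one desingularizing function that serves the compact set of candidate limits.

  If \<open>xb\<close> is not a local maximizer, then \<open>\<phi> \<phi>'\<close> is bounded below near \<open>0\<close>, hence \<open>\<phi>'\<^sup>2\<close> dominates a
  multiple of the derivative of \<open>ln \<phi>\<close>, which is not integrable. Finally, \<open>E0\<close> has probability one by
  a second moment bound for the martingale part of the weighted sums, applied along a subsequence.\<close>

text \<open>From \<open>E0\<close> to the limit everything is deterministic; probability enters only
  in showing that \<open>E0\<close> has probability one. The KL function at the limit cannot be used
  before the limit is known to exist. The abstract descent argument is therefore run twice: with one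
  function for all candidate limits it gives finite length, hence convergence; with
  \<open>\<phi>\<close> at the limit it gives the rates. The weights in the length estimate are
  taken along \<open>s\<close> and not along \<open>r\<close>, because \<open>\<psi> (r k)\<close>
  may stall while the \<open>z k\<close> are tiny, whereas \<open>\<psi> (s k)\<close> grows by
  exactly \<open>c1 * c2 / 2 * \<alpha> k\<close>. For the gradient half of \<open>E0\<close>,
  conditioning turns the pathwise bound on the sum of \<alpha> z |grad H|^2 into summability of
  \<alpha> |grad H|^2. This alone gives only lower limit 0; the Lipschitz bound on the gradient
  limits the change of |grad H|^2 in one step to a multiple of \<alpha> |grad H|^2, which makes the
  sequence converge.\<close>

subsection \<open>Gradients\<close>

lemma grad_eqI:
  assumes "GDERIV f x :> D"
  shows "grad f x = D"
  unfolding grad_def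
proof (rule the_equality)
  fix E assume "GDERIV f x :> E"
  then have "(\<lambda>h. h \<bullet> E) = (\<lambda>h. h \<bullet> D)"
    using assms has_derivative_unique unfolding gderiv_def by blast
  then show "E = D"
    by (simp add: fun_eq_iff vector_eq_rdot[of E D, symmetric] inner_commute)
qed (fact assms)

lemma GDERIV_grad:
  fixes f :: "'a::euclidean_space \<Rightarrow> real"
  assumes "f differentiable (at x)"
  shows "GDERIV f x :> grad f x"
proof -
  obtain f' where f': "(f has_derivative f') (at x)"
    using assms by (auto simp: differentiable_def)
  interpret linear f' using f' by (rule has_derivative_linear)
  have "f' h = h \<bullet> (\<Sum>b\<in>Basis. f' b *\<^sub>R b)" for h
  proof -
    have "f' h = f' (\<Sum>b\<in>Basis. (h \<bullet> b) *\<^sub>R b)" by (simp add: euclidean_representation)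
    also have "\<dots> = (\<Sum>b\<in>Basis. (h \<bullet> b) * f' b)" by (simp add: sum scaleR)
    also have "\<dots> = h \<bullet> (\<Sum>b\<in>Basis. f' b *\<^sub>R b)"
      by (simp add: inner_sum_right mult.commute)
    finally show ?thesis .
  qed
  then have "f' = (\<lambda>h. h \<bullet> (\<Sum>b\<in>Basis. f' b *\<^sub>R b))" by (rule ext)
  with f' have "GDERIV f x :> (\<Sum>b\<in>Basis. f' b *\<^sub>R b)"
    unfolding gderiv_def by (rule has_derivative_eq_rhs)
  then show ?thesis by (simp add: grad_eqI)
qed

lemma GDERIV_has_derivative: "GDERIV f x :> D \<Longrightarrow> (f has_derivative (\<lambda>h. D \<bullet> h)) (at x)"
  by (simp add: gderiv_def inner_commute)

lemma GDERIV_line: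
  fixes f :: "'a::euclidean_space \<Rightarrow> real"
  assumes "f differentiable (at (x + t *\<^sub>R v))"
  shows "((\<lambda>t. f (x + t *\<^sub>R v)) has_real_derivative grad f (x + t *\<^sub>R v) \<bullet> v) (at t)"
proof -
  have "((\<lambda>t. x + t *\<^sub>R v) has_derivative (\<lambda>s. s *\<^sub>R v)) (at t)"
    by (auto intro!: derivative_eq_intros)
  then have "((\<lambda>t. f (x + t *\<^sub>R v)) has_derivative (\<lambda>s. grad f (x + t *\<^sub>R v) \<bullet> (s *\<^sub>R v))) (at t)"
    using has_derivative_compose[of _ _ t UNIV f] GDERIV_has_derivative[OF GDERIV_grad[OF assms]]
    by blast
  moreover have "(\<lambda>s. grad f (x + t *\<^sub>R v) \<bullet> (s *\<^sub>R v)) = (*) (grad f (x + t *\<^sub>R v) \<bullet> v)"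
    by (auto simp: fun_eq_iff)
  ultimately show ?thesis
    by (simp add: has_field_derivative_def)
qed

lemma C1_add:
  fixes f g :: "'a::euclidean_space \<Rightarrow> real"
  assumes "C1 f" "C1 g"
  shows "C1 (\<lambda>x. f x + g x)" "grad (\<lambda>x. f x + g x) x = grad f x + grad g x"
proof -
  have *: "grad (\<lambda>x. f x + g x) x = grad f x + grad g x" for x
    using assms by (intro grad_eqI GDERIV_add GDERIV_grad) (auto simp: C1_def)
  show "grad (\<lambda>x. f x + g x) x = grad f x + grad g x" by fact
  show "C1 (\<lambda>x. f x + g x)"
    unfolding C1_def ext[of "grad (\<lambda>x. f x + g x)", OF *]
    using assms by (auto simp: C1_def intro!: continuous_intros)
qed

lemma C1_continuous_on:
  assumes "C1 f" shows "continuous_on A f"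
  using assms
  by (meson C1_def continuous_at_imp_continuous_on differentiable_imp_continuous_within)

lemma locally_lipschitz_lipschitz_on_compact:
  fixes f :: "'a::metric_space \<Rightarrow> 'b::metric_space"
  assumes "locally_lipschitz f" "compact X"
  obtains L where "L-lipschitz_on X f"
proof -
  \<comment> \<open>Read as a time-dependent map with 0 as its only time, \<open>f\<close> falls
    under the compactness theorem for \<open>local_lipschitz\<close>.\<close>
  have "local_lipschitz {0::real} X (\<lambda>_. f)"
  proof (rule local_lipschitzI)
    fix t :: real and x assume "x \<in> X"
    obtain r L where r: "r > 0" "L-lipschitz_on (ball x r) f"
      using assms(1) unfolding locally_lipschitz_def by metis
    have "cball x (r/2) \<inter> X \<subseteq> ball x r" using r(1) by auto
    then have "L-lipschitz_on (cball x (r/2) \<inter> X) f"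
      using lipschitz_on_subset r(2) by blast
    then show "\<exists>u>0. \<exists>L. \<forall>t\<in>cball t u \<inter> {0}. L-lipschitz_on (cball x u \<inter> X) f"
      using r(1) by (intro exI[of _ "r/2"]) auto
  qed
  then show ?thesis
    by (rule local_lipschitz_compact_implies_lipschitz[OF _ assms(2)]) (auto intro: that)
qed

subsection \<open>Desingularizing functions\<close>

text \<open>The part of \<open>KL_desingularization\<close> that does not mention \<open>H\<close>,
  isolated so that functions built by hand, such as the sums in \<open>uniform_KL\<close>, qualify
  as well.\<close>

locale desingularizing =
  fixes \<eta> :: ereal and \<phi> :: "real \<Rightarrow> real"
  assumes eta_pos: "0 < \<eta>"
    and nonneg: "\<And>t. 0 \<le> t \<Longrightarrow> ereal t < \<eta> \<Longrightarrow> 0 \<le> \<phi> t"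
    and cont: "continuous_on {t. 0 \<le> t \<and> ereal t < \<eta>} \<phi>"
    and concave: "concave_on {t. 0 \<le> t \<and> ereal t < \<eta>} \<phi>"
    and zero: "\<phi> 0 = 0"
    and diff: "\<And>t. 0 < t \<Longrightarrow> ereal t < \<eta> \<Longrightarrow> \<phi> differentiable (at t)"
    and deriv_pos: "\<And>t. 0 < t \<Longrightarrow> ereal t < \<eta> \<Longrightarrow> 0 < deriv \<phi> t"
    and cont_deriv: "continuous_on {t. 0 < t \<and> ereal t < \<eta>} (deriv \<phi>)"
begin

lemma less_eta: "s \<le> t \<Longrightarrow> ereal t < \<eta> \<Longrightarrow> ereal s < \<eta>"
  by (meson ereal_less_eq(3) le_less_trans)

lemma below_eta: obtains t where "0 < t" "ereal t < \<eta>"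
  using eta_pos ereal_dense2[of 0 \<eta>] by (auto simp: zero_ereal_def)

lemma has_deriv: "0 < t \<Longrightarrow> ereal t < \<eta> \<Longrightarrow> (\<phi> has_real_derivative deriv \<phi> t) (at t)"
  by (simp add: DERIV_deriv_iff_real_differentiable diff)

lemma isCont_deriv:
  assumes "0 < t" "ereal t < \<eta>" shows "isCont (deriv \<phi>) t"
proof -
  have "open {t::real. 0 < t \<and> ereal t < \<eta>}"
    by (intro open_Collect_conj open_Collect_less continuous_intros)
  with cont_deriv assms show ?thesis by (simp add: continuous_on_eq_continuous_at)
qed

lemma mem_interior_domain:
  assumes "0 < x" "ereal x < \<eta>"
  shows "x \<in> interior {t. 0 \<le> t \<and> ereal t < \<eta>}"
proof (rule interiorI)
  show "open {t::real. 0 < t \<and> ereal t < \<eta>}"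
    by (intro open_Collect_conj open_Collect_less continuous_intros)
qed (use assms in auto)

lemma tangent:
  assumes x: "0 < x" "ereal x < \<eta>" and y: "0 \<le> y" "ereal y < \<eta>"
  shows "\<phi> y \<le> \<phi> x + deriv \<phi> x * (y - x)"
proof -
  let ?D = "{t. 0 \<le> t \<and> ereal t < \<eta>}"
  have "connected ?D"
    by (metis concave concave_on_imp_convex convex_connected)
  then have "- \<phi> y - - \<phi> x \<ge> - deriv \<phi> x * (y - x)"
    using x y concave mem_interior_domain[OF x] has_deriv[OF x]
    by (intro convex_on_imp_above_tangent[of ?D "\<lambda>t. - \<phi> t"])
       (auto simp: concave_on_def intro!: derivative_eq_intros
             intro: has_field_derivative_at_within)
  then show ?thesis by simp
qed

lemma deriv_antimono:
  assumes "0 < a" "a \<le> b" "ereal b < \<eta>"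
  shows "deriv \<phi> b \<le> deriv \<phi> a"
proof (cases "a = b")
  case False
  have "\<phi> b \<le> \<phi> a + deriv \<phi> a * (b - a)" "\<phi> a \<le> \<phi> b + deriv \<phi> b * (a - b)"
    using assms less_eta[of a b] by (auto intro!: tangent)
  then have "(deriv \<phi> b - deriv \<phi> a) * (b - a) \<le> 0" by (simp add: algebra_simps)
  then show ?thesis using False assms by (simp add: mult_le_0_iff)
qed simp

lemma increment_ge:
  assumes "0 \<le> a" "a \<le> b" "0 < b" "ereal b < \<eta>"
  shows "deriv \<phi> b * (b - a) \<le> \<phi> b - \<phi> a"
  using tangent[of b a] assms less_eta[of a b] by (simp add: algebra_simps)

lemma mono:
  assumes "0 \<le> a" "a \<le> b" "ereal b < \<eta>"
  shows "\<phi> a \<le> \<phi> b"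
proof (cases "b = 0")
  case False
  then have "0 \<le> deriv \<phi> b * (b - a)" using assms deriv_pos[of b] by simp
  with increment_ge[of a b] assms False show ?thesis by linarith
qed (use assms in auto)

lemma pos:
  assumes "0 < t" "ereal t < \<eta>" shows "0 < \<phi> t"
proof -
  have "0 < deriv \<phi> t * t" using assms deriv_pos by simp
  also have "\<dots> \<le> \<phi> t" using increment_ge[of 0 t] assms zero by simp
  finally show ?thesis .
qed

lemma tendsto_0: "(\<phi> \<longlongrightarrow> 0) (at_right 0)"
proof -
  obtain t where t: "0 < t" "ereal t < \<eta>" using below_eta .
  have "continuous_on {0..t} \<phi>"
    using cont by (rule continuous_on_subset) (use t less_eta in auto)
  then have "(\<phi> \<longlongrightarrow> \<phi> 0) (at 0 within {0..t})"
    using t by (simp add: continuous_on_def)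
  then show ?thesis using t zero
    by (simp add: at_within_Icc_at_right)
qed

lemma small:
  assumes "0 < e"
  obtains r where "0 < r" "ereal r < \<eta>" "\<phi> r < e"
proof -
  obtain t where t: "0 < t" "ereal t < \<eta>" using below_eta .
  have "\<forall>\<^sub>F r in at_right 0. \<phi> r < e" using tendsto_0 assms by (rule order_tendstoD(2))
  moreover have "\<forall>\<^sub>F r in at_right 0. r < t" using t by (simp add: eventually_at_right_field) blast
  moreover have "\<forall>\<^sub>F r in at_right (0::real). 0 < r" by (simp add: eventually_at_right_less)
  ultimately have "\<forall>\<^sub>F r in at_right 0. \<phi> r < e \<and> r < t \<and> 0 < r" by eventually_elim auto
  then obtain r where "\<phi> r < e" "r < t" "0 < r"
    using eventually_happens[of _ "at_right (0::real)"] by auto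
  then show thesis using that t less_eta[of r t] by auto
qed

text \<open>The integrand is \<open>deriv \<phi>\<close>: it is positive, and its antiderivative
  \<open>\<phi>\<close> has finite limits at both ends of the interval, so the improper fundamental
  theorem applies.\<close>

lemma integrable_inverse_sqrt_KL_phi: "integrable_near_0 (\<lambda>t. 1 / sqrt (KL_phi \<phi> t))"
proof -
  obtain t where t: "0 < t" "ereal t < \<eta>" using below_eta .
  have "set_integrable lborel (einterval 0 t) (deriv \<phi>)"
  proof (rule interval_integral_FTC_nonneg(1)[where F=\<phi>])
    show "(0::ereal) < ereal t" using t by simp
    show "DERIV \<phi> x :> deriv \<phi> x" if "0 < ereal x" "ereal x < ereal t" for x
      using that t has_deriv less_eta[of x t] by auto
    show "isCont (deriv \<phi>) x" if "0 < ereal x" "ereal x < ereal t" for x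
      using that t isCont_deriv less_eta[of x t] by auto
    show "AE x in lborel. 0 < ereal x \<longrightarrow> ereal x < ereal t \<longrightarrow> 0 \<le> deriv \<phi> x"
      using t deriv_pos less_eta[of _ t] by (auto intro!: AE_I2 less_imp_le)
    show "((\<phi> \<circ> real_of_ereal) \<longlongrightarrow> 0) (at_right 0)"
      using tendsto_0 by (simp add: ereal_tendsto_simps1(2) zero_ereal_def)
    show "((\<phi> \<circ> real_of_ereal) \<longlongrightarrow> \<phi> t) (at_left (ereal t))"
      using has_deriv[OF t, THEN DERIV_isCont]
      by (auto simp: ereal_tendsto_simps1(1) isCont_def intro: filterlim_at_split[THEN iffD1, THEN conjunct1])
  qed
  then have "set_integrable lborel {0<..t/2} (deriv \<phi>)"
    by (rule set_integrable_subset) (use t in \<open>auto simp: einterval_def\<close>)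
  moreover have "1 / sqrt (KL_phi \<phi> s) = deriv \<phi> s" if "s \<in> {0<..t/2}" for s
    using that t deriv_pos[of s] less_eta[of s t]
    by (simp add: KL_phi_def real_sqrt_divide)
  ultimately have "set_integrable lborel {0<..t/2} (\<lambda>s. 1 / sqrt (KL_phi \<phi> s))"
    by (subst set_integrable_cong) auto
  then show ?thesis using t unfolding integrable_near_0_def by (intro exI[of _ "t/2"]) auto
qed

section \<open>The function \<open>KL_psi\<close> and its inverse\<close>

context
  fixes t0 :: real
  assumes t0: "0 < t0" "ereal t0 < \<eta>"
begin

lemma has_deriv_KL_psi:
  assumes t: "0 < t" "ereal t < \<eta>"
  shows "(KL_psi \<phi> t0 has_real_derivative - (deriv \<phi> t)\<^sup>2) (at t)"
proof -
  \<comment> \<open>The integral in \<open>KL_psi\<close> is signed, so one antiderivative on the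
    whole interval up to \<open>\<eta>\<close> covers arguments on both sides of
    \<open>t0\<close>.\<close>
  obtain F where F: "\<And>x. 0 < x \<Longrightarrow> ereal x < \<eta> \<Longrightarrow> (F has_vector_derivative (deriv \<phi> x)\<^sup>2) (at x)"
    using einterval_antiderivative[of 0 \<eta> "\<lambda>x. (deriv \<phi> x)\<^sup>2"] eta_pos isCont_deriv by auto
  have eq: "KL_psi \<phi> t0 s = F t0 - F s" if s: "0 < s" "ereal s < \<eta>" for s
    unfolding KL_psi_def
  proof (rule interval_integral_FTC_finite)
    have *: "0 < x \<and> ereal x < \<eta>" if "min s t0 \<le> x" "x \<le> max s t0" for x
      using that s t0 less_eta by (auto simp: min_def max_def split: if_splits)
    show "continuous_on {min s t0..max s t0} (\<lambda>s. (deriv \<phi> s)\<^sup>2)"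
      by (intro continuous_intros continuous_on_subset[OF cont_deriv]) (use * in auto)
    show "(F has_vector_derivative (deriv \<phi> x)\<^sup>2) (at x within {min s t0..max s t0})"
      if "min s t0 \<le> x" "x \<le> max s t0" for x
      using *[OF that] F has_vector_derivative_at_within by blast
  qed
  have "((\<lambda>s. F t0 - F s) has_real_derivative - (deriv \<phi> t)\<^sup>2) (at t)"
    using F[OF t] by (auto intro!: derivative_eq_intros simp: has_real_derivative_iff_has_vector_derivative)
  moreover have "open {t::real. 0 < t \<and> ereal t < \<eta>}"
    by (intro open_Collect_conj open_Collect_less continuous_intros)
  ultimately show ?thesis
    by (rule has_field_derivative_transform_within_open) (use t eq in auto)
qed

lemma KL_psi_t0: "KL_psi \<phi> t0 t0 = 0"
  by (simp add: KL_psi_def)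

text \<open>The slope of \<open>KL_psi\<close> is minus the square of \<open>deriv \<phi>\<close>,
  which is smallest at the right end \<open>b\<close>. In the descent argument \<open>b\<close> is
  the current gap \<open>r k\<close>, exactly where the KL inequality is available.\<close>

lemma KL_psi_diff_ge:
  assumes "0 < a" "a \<le> b" "ereal b < \<eta>"
  shows "(deriv \<phi> b)\<^sup>2 * (b - a) \<le> KL_psi \<phi> t0 a - KL_psi \<phi> t0 b"
proof (cases "a = b")
  case False
  have "KL_psi \<phi> t0 b + (deriv \<phi> b)\<^sup>2 * b \<le> KL_psi \<phi> t0 a + (deriv \<phi> b)\<^sup>2 * a"
  proof (rule DERIV_nonpos_imp_nonincreasing[OF assms(2)])
    fix x assume x: "a \<le> x" "x \<le> b"
    have "((\<lambda>t. KL_psi \<phi> t0 t + (deriv \<phi> b)\<^sup>2 * t) has_real_derivative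
            - (deriv \<phi> x)\<^sup>2 + (deriv \<phi> b)\<^sup>2) (at x)"
      using x assms less_eta[of x b] by (auto intro!: derivative_eq_intros has_deriv_KL_psi)
    moreover have "(deriv \<phi> b)\<^sup>2 \<le> (deriv \<phi> x)\<^sup>2"
      using x assms deriv_antimono[of x b] deriv_pos[of b] by (intro power_mono) auto
    ultimately show "\<exists>y. ((\<lambda>t. KL_psi \<phi> t0 t + (deriv \<phi> b)\<^sup>2 * t) has_real_derivative y) (at x) \<and> y \<le> 0"
      by (intro exI conjI) auto
  qed
  then show ?thesis by (simp add: algebra_simps)
qed simp

text \<open>Only one of the two factors \<open>deriv \<phi>\<close> is replaced by its largest
  value, at \<open>a\<close>; the other integrates to a difference of \<open>\<phi>\<close>, which
  telescopes in \<open>step_sum_le\<close>.\<close>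

lemma KL_psi_diff_le:
  assumes "0 < a" "a \<le> b" "ereal b < \<eta>"
  shows "KL_psi \<phi> t0 a - KL_psi \<phi> t0 b \<le> deriv \<phi> a * (\<phi> b - \<phi> a)"
proof -
  have "KL_psi \<phi> t0 a + deriv \<phi> a * \<phi> a \<le> KL_psi \<phi> t0 b + deriv \<phi> a * \<phi> b"
  proof (rule DERIV_nonneg_imp_nondecreasing[OF assms(2)])
    fix x assume x: "a \<le> x" "x \<le> b"
    have "((\<lambda>t. KL_psi \<phi> t0 t + deriv \<phi> a * \<phi> t) has_real_derivative
            - (deriv \<phi> x)\<^sup>2 + deriv \<phi> a * deriv \<phi> x) (at x)"
      using x assms less_eta[of x b] by (auto intro!: derivative_eq_intros has_deriv_KL_psi has_deriv)
    moreover have "(deriv \<phi> x)\<^sup>2 \<le> deriv \<phi> a * deriv \<phi> x"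
      using x assms deriv_antimono[of a x] deriv_pos[of x] less_eta[of x b]
      by (simp add: power2_eq_square)
    ultimately show "\<exists>y. ((\<lambda>t. KL_psi \<phi> t0 t + deriv \<phi> a * \<phi> t) has_real_derivative y) (at x) \<and> 0 \<le> y"
      by (intro exI conjI) auto
  qed
  then show ?thesis by (simp add: algebra_simps)
qed

lemma KL_psi_strict_antimono:
  assumes "0 < a" "a < b" "ereal b < \<eta>"
  shows "KL_psi \<phi> t0 b < KL_psi \<phi> t0 a"
proof -
  have "0 < (deriv \<phi> b)\<^sup>2 * (b - a)" using assms deriv_pos[of b] by simp
  with KL_psi_diff_ge[of a b] assms show ?thesis by linarith
qed

lemma KL_psi_le_iff:
  assumes "0 < a" "ereal a < \<eta>" "0 < b" "ereal b < \<eta>"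
  shows "KL_psi \<phi> t0 a \<le> KL_psi \<phi> t0 b \<longleftrightarrow> b \<le> a"
  using KL_psi_strict_antimono[of a b] KL_psi_strict_antimono[of b a] assms
  by (cases a b rule: linorder_cases) auto

lemma KL_psi_inv_eq:
  assumes "0 < s" "ereal s < \<eta>"
  shows "KL_psi_inv \<phi> \<eta> t0 (KL_psi \<phi> t0 s) = s"
  unfolding KL_psi_inv_def
proof (rule the_inv_into_f_f)
  show "inj_on (KL_psi \<phi> t0) {t. 0 < t \<and> ereal t < \<eta>}"
  proof (rule inj_onI)
    fix a b
    assume "a \<in> {t. 0 < t \<and> ereal t < \<eta>}" "b \<in> {t. 0 < t \<and> ereal t < \<eta>}"
      "KL_psi \<phi> t0 a = KL_psi \<phi> t0 b"
    then show "a = b" using KL_psi_le_iff[of a b] KL_psi_le_iff[of b a] by auto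
  qed
qed (use assms in auto)

text \<open>Up to a constant, \<open>KL_psi\<close> is the integral of a nonnegative function over
  the part of the domain to the right of \<open>t\<close>, hence monotone in \<open>t\<close>;
  boundedness as \<open>t\<close> tends to 0 then amounts to convergence of the integral.\<close>

lemma integrable_inverse_KL_phi_iff:
  "integrable_near_0 (\<lambda>t. 1 / KL_phi \<phi> t) \<longleftrightarrow>
     (\<exists>C. \<forall>t. 0 < t \<longrightarrow> ereal t < \<eta> \<longrightarrow> KL_psi \<phi> t0 t \<le> C)" (is "?L \<longleftrightarrow> ?R")
proof
  have eq: "1 / KL_phi \<phi> s = (deriv \<phi> s)\<^sup>2" if "0 < s" for s
    using that by (simp add: KL_phi_def)
  assume ?L
  then obtain \<tau> where \<tau>: "\<tau> > 0" and "set_integrable lborel {0<..\<tau>} (\<lambda>t. 1 / KL_phi \<phi> t)"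
    unfolding integrable_near_0_def by auto
  moreover have "set_integrable lborel {0<..\<tau>} (\<lambda>t. 1 / KL_phi \<phi> t) =
      set_integrable lborel {0<..\<tau>} (\<lambda>t. (deriv \<phi> t)\<^sup>2)"
    by (intro set_integrable_cong refl) (auto simp: eq)
  ultimately have int: "set_integrable lborel {0<..\<tau>} (\<lambda>t. (deriv \<phi> t)\<^sup>2)" by simp
  \<comment> \<open>The given \<open>\<tau>\<close> may lie beyond \<open>\<eta>\<close>, so the
    comparison point is cut down to \<open>t0\<close>.\<close>
  define \<sigma> where "\<sigma> = min \<tau> t0"
  have \<sigma>: "0 < \<sigma>" "ereal \<sigma> < \<eta>" "\<sigma> \<le> \<tau>"
    using \<tau> t0 less_eta[of \<sigma> t0] by (auto simp: \<sigma>_def)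
  let ?I = "LINT t:{0<..\<tau>}|lborel. (deriv \<phi> t)\<^sup>2"
  have "KL_psi \<phi> t0 t \<le> KL_psi \<phi> t0 \<sigma> + ?I" if t: "0 < t" "ereal t < \<eta>" for t
  proof (cases "t \<le> \<sigma>")
    case True
    have dom: "0 < x \<and> ereal x < \<eta>" if "t \<le> x" "x \<le> \<sigma>" for x
      using that t \<sigma> less_eta[of x \<sigma>] by auto
    have "(LBINT s=t..\<sigma>. (deriv \<phi> s)\<^sup>2) = - KL_psi \<phi> t0 \<sigma> - - KL_psi \<phi> t0 t"
      using True
    proof (intro interval_integral_FTC_finite)
      show "continuous_on {min t \<sigma>..max t \<sigma>} (\<lambda>s. (deriv \<phi> s)\<^sup>2)"
        by (intro continuous_intros continuous_on_subset[OF cont_deriv]) (use dom True in auto)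
      show "((\<lambda>x. - KL_psi \<phi> t0 x) has_vector_derivative (deriv \<phi> x)\<^sup>2) (at x within {min t \<sigma>..max t \<sigma>})"
        if "min t \<sigma> \<le> x" "x \<le> max t \<sigma>" for x
        using that True dom[of x] DERIV_minus[OF has_deriv_KL_psi[of x]]
        by (auto simp: has_real_derivative_iff_has_vector_derivative has_vector_derivative_at_within)
    qed
    moreover have "(LBINT s=t..\<sigma>. (deriv \<phi> s)\<^sup>2) = (LINT s:{t..\<sigma>}|lborel. (deriv \<phi> s)\<^sup>2)"
      using True by (simp add: interval_integral_Icc)
    moreover have "\<dots> \<le> ?I"
    proof -
      have "{t..\<sigma>} \<subseteq> {0<..\<tau>}" using t \<sigma> by auto
      moreover from this have "set_integrable lborel {t..\<sigma>} (\<lambda>s. (deriv \<phi> s)\<^sup>2)"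
        by (intro set_integrable_subset[OF int]) auto
      ultimately show ?thesis
        using int unfolding set_lebesgue_integral_def set_integrable_def
        by (intro integral_mono) (auto split: split_indicator)
    qed
    ultimately show ?thesis by linarith
  next
    case False
    have "0 \<le> ?I" by (simp add: set_lebesgue_integral_def)
    then show ?thesis using False KL_psi_le_iff[of t \<sigma>] t \<sigma> by auto
  qed
  then show ?R by blast
next
  assume ?R
  then obtain C where C: "\<And>t. 0 < t \<Longrightarrow> ereal t < \<eta> \<Longrightarrow> KL_psi \<phi> t0 t \<le> C" by blast
  let ?G = "\<lambda>t. - KL_psi \<phi> t0 t"
  \<comment> \<open>The antiderivative \<open>?G\<close> is increasing and bounded below, so its
    infimum is its limit at 0 from the right.\<close>
  define l where "l = Inf (?G ` {0<..t0})"
  have dom: "0 < x \<and> ereal x < \<eta>" if "0 < x" "x \<le> t0" for x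
    using that t0 less_eta[of x t0] by auto
  have bdd: "bdd_below (?G ` {0<..t0})"
    using C dom by (intro bdd_belowI2[of _ "-C"]) force
  have lim: "(?G \<longlongrightarrow> l) (at_right 0)"
  proof (rule order_tendstoI)
    fix a assume "a < l"
    have "\<forall>\<^sub>F x in at_right 0. 0 < x \<and> x < t0"
      using t0 by (auto simp: eventually_at_right_field)
    then show "\<forall>\<^sub>F x in at_right 0. a < ?G x"
    proof eventually_elim
      case (elim x)
      then have "l \<le> ?G x" unfolding l_def by (intro cINF_lower[OF bdd]) auto
      with \<open>a < l\<close> show ?case by simp
    qed
  next
    fix a assume "l < a"
    then obtain y where y: "0 < y" "y \<le> t0" "?G y < a"
      using cInf_lessD[of "?G ` {0<..t0}" a] t0 unfolding l_def by force
    have "\<forall>\<^sub>F x in at_right 0. 0 < x \<and> x < y"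
      using y by (auto simp: eventually_at_right_field)
    then show "\<forall>\<^sub>F x in at_right 0. ?G x < a"
    proof eventually_elim
      case (elim x)
      then have "KL_psi \<phi> t0 y < KL_psi \<phi> t0 x" 
        using y dom[of y] by (intro KL_psi_strict_antimono) auto
      then show ?case using y by simp
    qed
  qed
  have "set_integrable lborel (einterval 0 t0) (\<lambda>t. (deriv \<phi> t)\<^sup>2)"
  proof (rule interval_integral_FTC_nonneg(1)[where F="?G"])
    show "(0::ereal) < ereal t0" using t0 by simp
    show "DERIV ?G x :> (deriv \<phi> x)\<^sup>2" if "0 < ereal x" "ereal x < ereal t0" for x
      using that dom[of x] DERIV_minus[OF has_deriv_KL_psi[of x]] by auto
    show "isCont (\<lambda>t. (deriv \<phi> t)\<^sup>2) x" if "0 < ereal x" "ereal x < ereal t0" for x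
      using that dom[of x] by (auto intro!: continuous_intros isCont_deriv)
    show "((?G \<circ> real_of_ereal) \<longlongrightarrow> l) (at_right 0)"
      using lim by (simp add: ereal_tendsto_simps1(2) zero_ereal_def)
    show "((?G \<circ> real_of_ereal) \<longlongrightarrow> ?G t0) (at_left (ereal t0))"
      using DERIV_minus[OF has_deriv_KL_psi[OF t0], THEN DERIV_isCont]
      by (auto simp: ereal_tendsto_simps1(1) isCont_def intro: filterlim_at_split[THEN iffD1, THEN conjunct1])
  qed auto
  then have "set_integrable lborel {0<..t0/2} (\<lambda>t. (deriv \<phi> t)\<^sup>2)"
    by (rule set_integrable_subset) (use t0 in \<open>auto simp: einterval_def\<close>)
  moreover have "1 / KL_phi \<phi> s = (deriv \<phi> s)\<^sup>2" if "s \<in> {0<..t0/2}" for s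
    using that by (simp add: KL_phi_def)
  ultimately have "set_integrable lborel {0<..t0/2} (\<lambda>s. 1 / KL_phi \<phi> s)"
    by (subst set_integrable_cong) auto
  then show ?L using t0 unfolding integrable_near_0_def by (intro exI[of _ "t0/2"]) auto
qed

text \<open>Intermediate values between \<open>t0\<close>, where \<open>KL_psi\<close> is 0, and a
  point where unboundedness puts it above \<open>y\<close>. Nonnegative \<open>y\<close> suffices,
  since the rates evaluate the inverse at multiples of total weights.\<close>

lemma KL_psi_surj:
  assumes "\<not> integrable_near_0 (\<lambda>t. 1 / KL_phi \<phi> t)" "0 \<le> y"
  obtains s where "0 < s" "s \<le> t0" "KL_psi \<phi> t0 s = y"
proof -
  obtain a where a: "0 < a" "ereal a < \<eta>" "y < KL_psi \<phi> t0 a"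
    using assms(1) unfolding integrable_inverse_KL_phi_iff by (auto simp: not_le)
  have "KL_psi \<phi> t0 t0 \<le> KL_psi \<phi> t0 a"
    using a assms(2) by (simp add: KL_psi_t0)
  then have "a \<le> t0" using KL_psi_le_iff t0 a by blast
  have "continuous_on {a..t0} (KL_psi \<phi> t0)"
    using a t0 less_eta[of _ t0]
    by (intro continuous_at_imp_continuous_on ballI DERIV_isCont[OF has_deriv_KL_psi]) auto
  then obtain s where "a \<le> s" "s \<le> t0" "KL_psi \<phi> t0 s = y"
    using IVT2'[of "KL_psi \<phi> t0" t0 y a] a assms(2) \<open>a \<le> t0\<close> KL_psi_t0 by auto
  then show thesis using that[of s] a by simp
qed

text \<open>The logarithmic derivative of \<open>\<phi>\<close> is not integrable near \<open>0\<close> since \<open>\<phi> \<longlonglongrightarrow> 0\<close> there.\<close>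

lemma not_integrable_if_log_deriv_le:
  assumes "0 < C" "0 < \<tau>" "ereal \<tau> < \<eta>"
    and le: "\<And>t. 0 < t \<Longrightarrow> t \<le> \<tau> \<Longrightarrow> 1 \<le> C * (deriv \<phi> t * \<phi> t)"
  shows "\<not> integrable_near_0 (\<lambda>t. 1 / KL_phi \<phi> t)"
proof
  assume "integrable_near_0 (\<lambda>t. 1 / KL_phi \<phi> t)"
  then obtain B where B: "\<And>t. 0 < t \<Longrightarrow> ereal t < \<eta> \<Longrightarrow> KL_psi \<phi> t0 t \<le> B"
    unfolding integrable_inverse_KL_phi_iff by blast
  \<comment> \<open>The hypothesis makes \<open>?G\<close> nonincreasing in \<open>t\<close>. A
    bound on \<open>KL_psi\<close> would then keep \<open>ln (\<phi> t)\<close> bounded below as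
    \<open>t\<close> tends to 0.\<close>
  let ?G = "\<lambda>t. C * KL_psi \<phi> t0 t + ln (\<phi> t)"
  have ge: "?G \<tau> \<le> ?G e" if e: "0 < e" "e \<le> \<tau>" for e
  proof (rule DERIV_nonpos_imp_nonincreasing[OF e(2)])
    fix x assume x: "e \<le> x" "x \<le> \<tau>"
    then have dom: "0 < x" "ereal x < \<eta>" using e assms(3) less_eta[of x \<tau>] by auto
    have "(?G has_real_derivative C * - (deriv \<phi> x)\<^sup>2 + deriv \<phi> x / \<phi> x) (at x)"
      using dom pos[of x] by (auto intro!: derivative_eq_intros has_deriv_KL_psi has_deriv)
    moreover have "deriv \<phi> x / \<phi> x \<le> C * (deriv \<phi> x)\<^sup>2"
      using mult_left_mono[OF le[of x], of "deriv \<phi> x"] dom x pos[of x] deriv_pos[of x]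
      by (simp add: divide_simps power2_eq_square mult_ac)
    ultimately show "\<exists>y. (?G has_real_derivative y) (at x) \<and> y \<le> 0" by (intro exI conjI) auto
  qed
  have ln_ge: "?G \<tau> - C * B \<le> ln (\<phi> e)" if "0 < e" "e \<le> \<tau>" for e
  proof -
    have "C * KL_psi \<phi> t0 e \<le> C * B"
      using that B[of e] assms less_eta[of e \<tau>] by (intro mult_left_mono) auto
    then show ?thesis using ge[OF that] by simp
  qed
  obtain r where r: "0 < r" "ereal r < \<eta>" "\<phi> r < exp (?G \<tau> - C * B)"
    using small[of "exp (?G \<tau> - C * B)"] by auto
  define e where "e = min r \<tau>"
  have e: "0 < e" "e \<le> \<tau>" "e \<le> r" using r assms by (auto simp: e_def)
  have "\<phi> e \<le> \<phi> r" using e r by (intro mono) auto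
  moreover have "exp (?G \<tau> - C * B) \<le> \<phi> e"
    using ln_ge[OF e(1,2)] pos[of e] e assms less_eta[of e \<tau>] by (simp add: ln_ge_iff)
  ultimately show False using r by simp
qed

end

end

lemma KL_desingularizationD:
  assumes "KL_desingularization H xb \<eta> \<phi>"
  shows "desingularizing \<eta> \<phi>"
    and "\<exists>\<delta>>0. \<forall>x. norm (x - xb) < \<delta> \<longrightarrow> 0 < H x - H xb \<longrightarrow> ereal (H x - H xb) < \<eta> \<longrightarrow>
          1 \<le> deriv \<phi> (H x - H xb) * norm (grad H x)"
proof -
  show "desingularizing \<eta> \<phi>"
    using assms unfolding KL_desingularization_def by unfold_locales auto
  obtain \<delta> :: ereal where \<delta>: "0 < \<delta>"
    "\<And>x. ereal (norm (x - xb)) < \<delta> \<Longrightarrow> 0 < H x - H xb \<Longrightarrow> ereal (H x - H xb) < \<eta> \<Longrightarrow>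
             1 \<le> deriv \<phi> (H x - H xb) * norm (grad H x)"
    using assms unfolding KL_desingularization_def by auto
  obtain d where d: "0 < d" "ereal d < \<delta>"
    using \<delta>(1) ereal_dense2[of 0 \<delta>] by (auto simp: zero_ereal_def)
  have "ereal (norm (x - xb)) < \<delta>" if "norm (x - xb) < d" for x
    using that d by (meson ereal_less(2) less_ereal.simps(1) less_trans)
  then show "\<exists>\<delta>>0. \<forall>x. norm (x - xb) < \<delta> \<longrightarrow> 0 < H x - H xb \<longrightarrow> ereal (H x - H xb) < \<eta> \<longrightarrow>
          1 \<le> deriv \<phi> (H x - H xb) * norm (grad H x)"
    using d(1) \<delta>(2) by blast
qed

subsection \<open>Descent sequences\<close>

text \<open>\<open>r k\<close> is the gap \<open>H (x k) - lim H (x j)\<close>, \<open>d k\<close> the step length and \<open>g k\<close> the gradient norm.\<close>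

locale descent_sequence =
  fixes r z \<alpha> d g :: "nat \<Rightarrow> real" and c1 c2 \<alpha>bar :: real
  assumes c_pos: "0 < c1" "0 < c2"
    and alpha: "\<And>k. 0 < \<alpha> k" "\<And>k. \<alpha> k \<le> \<alpha>bar"
    and alpha_div: "filterlim (\<lambda>n. \<Sum>k<n. \<alpha> k) at_top sequentially"
    and z_nonneg: "\<And>k. 0 \<le> z k"
    and avg: "liminf (\<lambda>k. ereal ((\<Sum>i=1..k. \<alpha> i * z i) / (\<Sum>i=1..k. \<alpha> i))) \<ge> ereal c2"
    and r_nonneg: "\<And>k. 0 \<le> r k"
    and d_nonneg: "\<And>k. 0 \<le> d k"
    and grad_descent: "\<And>k. c1 * (\<alpha> k * z k * (g k)\<^sup>2) \<le> r k - r (Suc k)"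
    and step_descent: "\<And>k. c1 * (d k)\<^sup>2 \<le> \<alpha> k * (r k - r (Suc k))"
begin

lemma r_Suc_le: "r (Suc k) \<le> r k"
proof -
  have "0 \<le> c1 * (d k)\<^sup>2" using c_pos by simp
  also have "\<dots> \<le> \<alpha> k * (r k - r (Suc k))" by (rule step_descent)
  finally show ?thesis using alpha(1)[of k] by (simp add: zero_le_mult_iff)
qed

lemma r_antimono: "k \<le> n \<Longrightarrow> r n \<le> r k"
  by (rule lift_Suc_antimono_le[of r]) (rule r_Suc_le)

lemma stops:
  assumes "r k = 0" "k \<le> n"
  shows "r n = 0" "d n = 0"
proof -
  show "r n = 0" using r_antimono[OF assms(2)] r_nonneg[of n] assms(1) by simp
  then have "c1 * (d n)\<^sup>2 \<le> 0"
    using step_descent[of n] r_Suc_le[of n] r_nonneg[of "Suc n"] by simp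
  then show "d n = 0" using c_pos by (simp add: mult_le_0_iff)
qed

text \<open>Eventually the averages exceed \<open>3/4 * c2\<close>, but only half of
  \<open>c2\<close> is claimed. The surplus \<open>c1 * c2 / 4\<close> times the divergent total
  weight pays for the constant \<open>C\<close>, the terms before \<open>K\<close>, the term with
  index 0 that the averages omit, and the extra weight \<open>\<alpha> k\<close> on the
  left.\<close>

lemma weighted_sum_ge:
  "\<forall>\<^sub>F k in sequentially. c1 * c2 / 2 * (\<Sum>i<Suc k. \<alpha> i) \<le> C + c1 * (\<Sum>i=K..<k. \<alpha> i * z i)"
proof -
  define A where "A k = (\<Sum>i<k. \<alpha> i)" for k
  define B where "B k = (\<Sum>i<k. \<alpha> i * z i)" for k
  have "\<forall>\<^sub>F k in sequentially. ereal (3/4 * c2) < ereal ((\<Sum>i=1..k. \<alpha> i * z i) / (\<Sum>i=1..k. \<alpha> i))"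
    using avg c_pos by (intro less_LiminfD less_le_trans[OF _ avg]) simp
  moreover have "\<forall>\<^sub>F k in sequentially. 1 \<le> (k::nat)" by (rule eventually_ge_at_top)
  ultimately have "\<forall>\<^sub>F k in sequentially. 3/4 * c2 * (A (Suc k) - \<alpha>bar) \<le> B (Suc k)"
  proof eventually_elim
    case (elim k)
    have eq: "sum f {..<Suc k} = f 0 + sum f {1..k}" for f :: "nat \<Rightarrow> real"
      by (simp add: lessThan_Suc_atMost atMost_atLeast0 sum.atLeast_Suc_atMost)
    have "0 < (\<Sum>i=1..k. \<alpha> i)" using elim(2) alpha(1) by (intro sum_pos) auto
    then have "3/4 * c2 * (\<Sum>i=1..k. \<alpha> i) \<le> (\<Sum>i=1..k. \<alpha> i * z i)"
      using elim(1) by (simp add: field_simps)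
    moreover have "A (Suc k) - \<alpha>bar \<le> (\<Sum>i=1..k. \<alpha> i)"
      using alpha(2)[of 0] unfolding A_def eq by simp
    moreover have "(\<Sum>i=1..k. \<alpha> i * z i) \<le> B (Suc k)"
      using alpha(1)[of 0] z_nonneg[of 0] unfolding B_def eq by simp
    ultimately show ?case
      using c_pos(2) mult_left_mono[of "A (Suc k) - \<alpha>bar" "\<Sum>i=1..k. \<alpha> i" "3/4 * c2"] by linarith
  qed
  then have ev: "\<forall>\<^sub>F k in sequentially. 3/4 * c2 * (A k - \<alpha>bar) \<le> B k"
    by (simp only: eventually_sequentially_Suc[of "\<lambda>k. 3/4 * c2 * (A k - \<alpha>bar) \<le> B k"])
  \<comment> \<open>The factor 5/4 is 3/4 for the omitted index 0 plus 1/2 for the shift from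
    \<open>k\<close> to \<open>Suc k\<close>, each costing at most
    \<open>\<alpha>bar\<close>.\<close>
  have "\<forall>\<^sub>F k in sequentially. (5/4 * c1 * c2 * \<alpha>bar + c1 * B K - C) / (c1 * c2 / 4) \<le> A k"
    using alpha_div unfolding A_def filterlim_at_top by blast
  moreover have "\<forall>\<^sub>F k in sequentially. K \<le> k" by (rule eventually_ge_at_top)
  ultimately show ?thesis using ev
  proof eventually_elim
    case (elim k)
    have "(\<Sum>i=K..<k. \<alpha> i * z i) = B k - B K"
      using sum.atLeastLessThan_concat[of 0 K k "\<lambda>i. \<alpha> i * z i"] elim(2)
      by (simp add: B_def lessThan_atLeast0)
    then have "c1 * (\<Sum>i=K..<k. \<alpha> i * z i) = c1 * B k - c1 * B K"
      by (simp add: right_diff_distrib)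
    moreover have "(\<Sum>i<Suc k. \<alpha> i) \<le> A k + \<alpha>bar" using alpha(2)[of k] by (simp add: A_def)
    then have "c1 * c2 / 2 * (\<Sum>i<Suc k. \<alpha> i) \<le> c1 * c2 / 2 * (A k + \<alpha>bar)"
      using c_pos by (intro mult_left_mono) auto
    moreover have "5/4 * c1 * c2 * \<alpha>bar + c1 * B K - C \<le> A k * (c1 * c2 / 4)"
      using elim(1) c_pos by (simp add: divide_le_eq)
    moreover have "c1 * (3/4 * c2 * (A k - \<alpha>bar)) \<le> c1 * B k"
      using elim(3) c_pos by (intro mult_left_mono) auto
    ultimately show ?case by (simp add: algebra_simps)
  qed
qed

end

text \<open>The KL inequality is asked for only along a tail and only while the gap is positive.
  This lets the same argument serve the common function of all candidate limits and, later, the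
  given function at the limit.\<close>

locale KL_descent = descent_sequence + desingularizing +
  fixes K :: nat and t0 :: real
  assumes t0: "0 < t0" "ereal t0 < \<eta>"
    and KL: "\<And>k. K \<le> k \<Longrightarrow> 0 < r k \<Longrightarrow> ereal (r k) < \<eta> \<and> 1 \<le> deriv \<phi> (r k) * g k"
begin

text \<open>By KL, \<open>deriv \<phi> (r k) * g k\<close> is at least 1, which trades the squared
  gradient norm in the descent for the squared derivative; \<open>KL_psi_diff_ge\<close> reads the
  result as growth of \<open>KL_psi\<close>.\<close>

lemma KL_psi_ge:
  assumes pos: "\<And>k. 0 < r k" and "K \<le> k"
  shows "KL_psi \<phi> t0 (r K) + c1 * (\<Sum>i=K..<k. \<alpha> i * z i) \<le> KL_psi \<phi> t0 (r k)"
  using \<open>K \<le> k\<close>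
proof (induction k rule: dec_induct)
  case (step k)
  have k: "ereal (r k) < \<eta>" "1 \<le> deriv \<phi> (r k) * g k" using KL[of k] pos[of k] step by auto
  have "1 \<le> (deriv \<phi> (r k) * g k)\<^sup>2" using k(2) by simp
  then have "c1 * (\<alpha> k * z k) * 1 \<le> c1 * (\<alpha> k * z k) * (deriv \<phi> (r k) * g k)\<^sup>2"
    using c_pos alpha(1)[of k] z_nonneg[of k] by (intro mult_left_mono) auto
  also have "\<dots> = (deriv \<phi> (r k))\<^sup>2 * (c1 * (\<alpha> k * z k * (g k)\<^sup>2))"
    by (simp add: power_mult_distrib)
  also have "\<dots> \<le> (deriv \<phi> (r k))\<^sup>2 * (r k - r (Suc k))"
    by (intro mult_left_mono grad_descent) auto
  also have "\<dots> \<le> KL_psi \<phi> t0 (r (Suc k)) - KL_psi \<phi> t0 (r k)"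
    using KL_psi_diff_ge[OF t0 pos[of "Suc k"] r_Suc_le k(1)] .
  finally show ?case using step by (simp add: algebra_simps)
qed simp

text \<open>The weight on the left runs up to \<open>Suc k\<close>: the summation by parts in
  \<open>step_sum_le\<close> compares \<open>r k\<close> with \<open>s (Suc k)\<close>, not with
  \<open>s k\<close>.\<close>

lemma eventually_KL_psi_ge:
  assumes pos: "\<And>k. 0 < r k"
  shows "\<forall>\<^sub>F k in sequentially. c1 * c2 / 2 * (\<Sum>i<Suc k. \<alpha> i) \<le> KL_psi \<phi> t0 (r k)"
  using weighted_sum_ge[of "KL_psi \<phi> t0 (r K)" K] eventually_ge_at_top[of K]
  by eventually_elim (use KL_psi_ge[OF pos] in fastforce)

text \<open>As long as the gap is positive, \<open>KL_psi\<close> at the gap grows beyond all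
  bounds, while integrability bounds \<open>KL_psi\<close> on its whole domain.\<close>

lemma finite_termination:
  assumes "integrable_near_0 (\<lambda>t. 1 / KL_phi \<phi> t)"
  shows "\<exists>k. r k = 0"
proof (rule ccontr)
  assume "\<nexists>k. r k = 0"
  then have pos: "0 < r k" for k using r_nonneg[of k] by (simp add: less_le)
  obtain C where C: "\<And>t. 0 < t \<Longrightarrow> ereal t < \<eta> \<Longrightarrow> KL_psi \<phi> t0 t \<le> C"
    using assms integrable_inverse_KL_phi_iff[OF t0] by auto
  have "filterlim (\<lambda>k. \<Sum>i<Suc k. \<alpha> i) at_top sequentially"
    using alpha_div by (rule filterlim_compose) (rule filterlim_Suc)
  then have "\<forall>\<^sub>F k in sequentially. C / (c1 * c2 / 2) < (\<Sum>i<Suc k. \<alpha> i)"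
    unfolding filterlim_at_top_dense by blast
  then have "\<forall>\<^sub>F k in sequentially. False"
    using eventually_KL_psi_ge[OF pos] eventually_ge_at_top[of K]
  proof eventually_elim
    case (elim k)
    have "C < c1 * c2 / 2 * (\<Sum>i<Suc k. \<alpha> i)"
      using elim(1) c_pos by (simp only: divide_less_eq) (simp add: mult.commute)
    with elim(2) C[of "r k"] KL[of k] pos[of k] elim(3) show False by auto
  qed
  then show False by simp
qed

text \<open>By \<open>step_descent\<close>, \<open>d i\<close> is at most the geometric mean of
  \<open>\<kappa> * (\<alpha> i / D i)\<close> and
  \<open>(r i - r (Suc i)) * D i / (c1 * \<kappa>)\<close>. The first terms have a telescoping bound
  because \<open>KL_psi\<close> moves along \<open>s\<close> by a fixed multiple of
  \<open>\<alpha> i\<close>; the second are summed by parts.\<close>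

lemma step_sum_le:
  fixes s :: "nat \<Rightarrow> real" and k n :: nat
  assumes s: "\<And>i. 0 < s i" "\<And>i. ereal (s i) < \<eta>" "\<And>i. s (Suc i) \<le> s i"
    and psi: "\<And>i. KL_psi \<phi> t0 (s i) = c1 * c2 / 2 * (\<Sum>j<i. \<alpha> j)"
    and le: "\<And>i. k \<le> i \<Longrightarrow> r i \<le> s (Suc i)"
    and n: "k \<le> n"
  shows "(\<Sum>i=k..<n. d i) \<le> sqrt 2 / (c1 * sqrt c2) * \<phi> (s k)"
proof -
  define D where "D i = deriv \<phi> (s (Suc i))" for i
  have D: "0 < D i" for i unfolding D_def by (rule deriv_pos[OF s(1,2)])
  have D_mono: "D i \<le> D (Suc i)" for i unfolding D_def by (rule deriv_antimono[OF s(1,3,2)])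
  \<comment> \<open>The square of \<open>\<kappa>\<close> is the factor \<open>c2 / 2\<close> from
    the growth of \<open>KL_psi\<close> along \<open>s\<close>. With this choice both sums have the
    same bound \<open>\<phi> (s k) / (c1 * \<kappa>)\<close>, which produces the constant of the
    theorem.\<close>
  define \<kappa> where "\<kappa> = sqrt c2 / sqrt 2"
  have \<kappa>: "0 < \<kappa>" "\<kappa>\<^sup>2 = c2 / 2" using c_pos by (auto simp: \<kappa>_def power_divide)
  have c: "1 / (c1 * \<kappa>) = sqrt 2 / (c1 * sqrt c2)" by (simp add: \<kappa>_def)
  text \<open>Discrete integration by parts: \<open>D\<close> increases, so \<open>r i \<le> s (Suc i)\<close> allows \<open>r i\<close> to be
    replaced by \<open>s (Suc i)\<close> in the sum.\<close>
  have "(\<Sum>i=k..<n. (r i - r (Suc i)) * D i) + r n * D n \<le> \<phi> (s (Suc k)) - \<phi> (s (Suc n)) + s (Suc n) * D n"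
    using n
  proof (induction n rule: dec_induct)
    case base
    show ?case using le[of k] D[of k] by simp
  next
    case (step n)
    have "r (Suc n) * (D (Suc n) - D n) \<le> s (Suc (Suc n)) * (D (Suc n) - D n)"
      using le[of "Suc n"] step D_mono[of n] by (intro mult_right_mono) auto
    moreover have "D n * (s (Suc n) - s (Suc (Suc n))) \<le> \<phi> (s (Suc n)) - \<phi> (s (Suc (Suc n)))"
      unfolding D_def using s(1,2) s(3)[of "Suc n"] by (intro increment_ge) (auto simp: less_imp_le)
    ultimately show ?case using step by (simp add: algebra_simps)
  qed
  \<comment> \<open>The tangent inequality with end point 0 absorbs the boundary term
    \<open>s (Suc n) * D n\<close>.\<close>
  moreover have "D n * (s (Suc n) - 0) \<le> \<phi> (s (Suc n)) - \<phi> 0"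
    unfolding D_def using s(1,2) by (intro increment_ge) (auto simp: less_imp_le)
  moreover have "0 \<le> r n * D n" using r_nonneg D[of n] by simp
  moreover have "\<phi> (s (Suc k)) \<le> \<phi> (s k)"
    using s by (intro mono) (auto simp: less_imp_le)
  ultimately have R: "(\<Sum>i=k..<n. (r i - r (Suc i)) * D i) \<le> \<phi> (s k)"
    by (simp add: zero mult.commute)
  have "c1 * c2 / 2 * \<alpha> i \<le> D i * (\<phi> (s i) - \<phi> (s (Suc i)))" for i
  proof -
    have "KL_psi \<phi> t0 (s (Suc i)) - KL_psi \<phi> t0 (s i) = c1 * c2 / 2 * \<alpha> i"
      unfolding psi by (simp add: algebra_simps)
    then show ?thesis using KL_psi_diff_le[OF t0 s(1) s(3) s(2), of i] unfolding D_def by simp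
  qed
  then have "\<alpha> i / D i \<le> (\<phi> (s i) - \<phi> (s (Suc i))) / (c1 * c2 / 2)" for i
    using D[of i] c_pos by (simp add: divide_simps) (simp add: mult_ac)
  then have "(\<Sum>i=k..<n. \<alpha> i / D i) \<le> (\<Sum>i=k..<n. (\<phi> (s i) - \<phi> (s (Suc i))) / (c1 * c2 / 2))"
    by (intro sum_mono)
  also have "\<dots> = (\<phi> (s k) - \<phi> (s n)) / (c1 * c2 / 2)"
    unfolding sum_divide_distrib[symmetric] using sum_Suc_diff'[OF n, of "\<lambda>i. - \<phi> (s i)"] by simp
  also have "\<dots> \<le> \<phi> (s k) / (c1 * c2 / 2)"
    using c_pos pos[OF s(1) s(2), of n] by (intro divide_right_mono) auto
  also have "\<dots> = \<phi> (s k) / (c1 * \<kappa>\<^sup>2)" by (simp add: \<kappa>)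
  finally have A: "(\<Sum>i=k..<n. \<alpha> i / D i) \<le> \<phi> (s k) / (c1 * \<kappa>\<^sup>2)" .
  have "d i \<le> (\<kappa> * (\<alpha> i / D i) + (r i - r (Suc i)) * D i / (c1 * \<kappa>)) / 2" for i
  proof -
    let ?x = "\<kappa> * (\<alpha> i / D i)" and ?y = "(r i - r (Suc i)) * D i / (c1 * \<kappa>)"
    have "c1 * (?x * ?y) = \<alpha> i * (r i - r (Suc i))"
      using \<kappa>(1) c_pos(1) D[of i] by (simp add: field_simps)
    then have "(d i)\<^sup>2 \<le> ?x * ?y"
      using step_descent[of i] c_pos(1) by (metis mult_le_cancel_left_pos)
    moreover have "4 * (?x * ?y) \<le> (?x + ?y)\<^sup>2"
      using zero_le_power2[of "?x - ?y"] unfolding power2_diff power2_sum by linarith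
    ultimately have "(2 * d i)\<^sup>2 \<le> (?x + ?y)\<^sup>2" by (simp add: power_mult_distrib)
    moreover have "0 \<le> ?x + ?y"
      using \<kappa>(1) alpha(1)[of i] D[of i] r_Suc_le[of i] c_pos by (intro add_nonneg_nonneg) auto
    ultimately have "2 * d i \<le> ?x + ?y" by (rule power2_le_imp_le)
    then show ?thesis by simp
  qed
  then have "(\<Sum>i=k..<n. d i) \<le> (\<Sum>i=k..<n. (\<kappa> * (\<alpha> i / D i) + (r i - r (Suc i)) * D i / (c1 * \<kappa>)) / 2)"
    by (intro sum_mono)
  also have "\<dots> = (\<kappa> * (\<Sum>i=k..<n. \<alpha> i / D i) + (\<Sum>i=k..<n. (r i - r (Suc i)) * D i) / (c1 * \<kappa>)) / 2"
    by (simp add: sum.distrib sum_distrib_left sum_divide_distrib add_divide_distrib)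
  also have "\<dots> \<le> (\<kappa> * (\<phi> (s k) / (c1 * \<kappa>\<^sup>2)) + \<phi> (s k) / (c1 * \<kappa>)) / 2"
    using A R \<kappa>(1) c_pos by (intro divide_right_mono add_mono mult_left_mono) auto
  also have "\<dots> = 1 / (c1 * \<kappa>) * \<phi> (s k)"
    using \<kappa>(1) c_pos by (simp add: power2_eq_square)
  finally show ?thesis unfolding c .
qed

lemma rates:
  assumes "\<not> integrable_near_0 (\<lambda>t. 1 / KL_phi \<phi> t)"
  obtains K' where "1 \<le> K'"
    "\<And>k. K' \<le> k \<Longrightarrow> c1 * c2 / 2 * (\<Sum>i<k. \<alpha> i) \<in> KL_psi \<phi> t0 ` {t. 0 < t \<and> ereal t < \<eta>}"
    "\<And>k. K' \<le> k \<Longrightarrow> r k \<le> KL_psi_inv \<phi> \<eta> t0 (c1 * c2 / 2 * (\<Sum>i<k. \<alpha> i))"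
    "\<And>k n. K' \<le> k \<Longrightarrow> k \<le> n \<Longrightarrow> (\<Sum>i=k..<n. d i) \<le>
       sqrt 2 / (c1 * sqrt c2) * \<phi> (KL_psi_inv \<phi> \<eta> t0 (c1 * c2 / 2 * (\<Sum>i<k. \<alpha> i)))"
proof -
  \<comment> \<open>The majorants \<open>s k\<close> are the values of the inverse of
    \<open>KL_psi\<close> that appear in the rates; they are deterministic, unlike the gaps
    \<open>r k\<close>.\<close>
  have "\<exists>s. 0 < s \<and> s \<le> t0 \<and> KL_psi \<phi> t0 s = c1 * c2 / 2 * (\<Sum>i<k. \<alpha> i)" for k
  proof -
    have "0 \<le> c1 * c2 / 2 * (\<Sum>i<k. \<alpha> i)"
      using c_pos alpha(1) by (intro mult_nonneg_nonneg sum_nonneg) (auto simp: less_imp_le)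
    then show ?thesis using KL_psi_surj[OF t0 assms] by metis
  qed
  then obtain s where s: "\<And>k. 0 < s k" "\<And>k. s k \<le> t0"
      and psi: "\<And>k. KL_psi \<phi> t0 (s k) = c1 * c2 / 2 * (\<Sum>i<k. \<alpha> i)"
    by metis
  have s_eta: "ereal (s k) < \<eta>" for k using s(2) t0(2) less_eta by blast
  have inv: "KL_psi_inv \<phi> \<eta> t0 (c1 * c2 / 2 * (\<Sum>i<k. \<alpha> i)) = s k" for k
    using KL_psi_inv_eq[OF t0 s(1) s_eta, of k] psi by simp
  have mem: "c1 * c2 / 2 * (\<Sum>i<k. \<alpha> i) \<in> KL_psi \<phi> t0 ` {t. 0 < t \<and> ereal t < \<eta>}" for k
    using s(1) s_eta psi[of k, symmetric] by (auto simp del: psi)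
  have s_Suc: "s (Suc k) \<le> s k" for k
  proof -
    have "KL_psi \<phi> t0 (s k) \<le> KL_psi \<phi> t0 (s (Suc k))"
      unfolding psi using c_pos alpha(1)[of k] by (intro mult_left_mono) auto
    then show ?thesis using KL_psi_le_iff[OF t0 s(1) s_eta s(1) s_eta] by blast
  qed
  show thesis
  proof (cases "\<exists>k. r k = 0")
    \<comment> \<open>\<open>KL_psi_ge\<close> needs positive gaps and is silent here; but once the
      gap is 0, all later gaps and steps vanish and the bounds are trivial.\<close>
    case True
    then obtain k0 where k0: "r k0 = 0" by blast
    show ?thesis
    proof (rule that[of "Suc k0"])
      fix k assume k: "Suc k0 \<le> k"
      show "r k \<le> KL_psi_inv \<phi> \<eta> t0 (c1 * c2 / 2 * (\<Sum>i<k. \<alpha> i))"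
        using stops(1)[OF k0, of k] k s(1)[of k] unfolding inv by simp
      show "(\<Sum>i=k..<n. d i) \<le>
         sqrt 2 / (c1 * sqrt c2) * \<phi> (KL_psi_inv \<phi> \<eta> t0 (c1 * c2 / 2 * (\<Sum>i<k. \<alpha> i)))" for n
      proof -
        have "(\<Sum>i=k..<n. d i) = 0" using stops(2)[OF k0] k by (intro sum.neutral) auto
        then show ?thesis unfolding inv using c_pos pos[OF s(1) s_eta, of k] by simp
      qed
    qed (simp, rule mem)
  next
    case False
    then have pos: "0 < r k" for k using r_nonneg[of k] by (simp add: less_le)
    obtain K0 where K0: "\<And>k. K0 \<le> k \<Longrightarrow> c1 * c2 / 2 * (\<Sum>i<Suc k. \<alpha> i) \<le> KL_psi \<phi> t0 (r k)"
      using eventually_KL_psi_ge[OF pos] unfolding eventually_sequentially by blast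
    have r_le: "r k \<le> s (Suc k)" if "max K K0 \<le> k" for k
      using K0[of k] that KL[of k] pos[of k] psi[of "Suc k"]
        KL_psi_le_iff[OF t0 s(1) s_eta, of "r k" "Suc k"] by simp
    show ?thesis
    proof (rule that[of "Suc (max K K0)"])
      fix k assume k: "Suc (max K K0) \<le> k"
      show "r k \<le> KL_psi_inv \<phi> \<eta> t0 (c1 * c2 / 2 * (\<Sum>i<k. \<alpha> i))"
        unfolding inv using r_le[of k] s_Suc[of k] k by linarith
      show "(\<Sum>i=k..<n. d i) \<le>
         sqrt 2 / (c1 * sqrt c2) * \<phi> (KL_psi_inv \<phi> \<eta> t0 (c1 * c2 / 2 * (\<Sum>i<k. \<alpha> i)))"
        if "k \<le> n" for n
        unfolding inv by (rule step_sum_le[OF s(1) s_eta s_Suc psi _ that]) (rule r_le, use k in linarith)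
    qed (simp, rule mem)
  qed
qed

text \<open>No limit of the trajectory occurs here, so finite length can be used to prove that a
  limit exists.\<close>

lemma summable_steps: "summable d"
proof (cases "integrable_near_0 (\<lambda>t. 1 / KL_phi \<phi> t)")
  case True
  then obtain k where "r k = 0" using finite_termination by blast
  then show ?thesis
    using stops(2) by (intro summable_finite[of "{..<k}"]) (auto simp: not_less)
next
  case False
  then obtain K' C where C: "\<And>n. K' \<le> n \<Longrightarrow> (\<Sum>i=K'..<n. d i) \<le> C"
    by (rule rates) blast
  have "(\<Sum>i<n. d (i + K')) \<le> C" for n
    using C[of "n + K'"] sum.shift_bounds_nat_ivl[of d 0 K' n] by (simp add: lessThan_atLeast0)
  from this[of "Suc _"] have "summable (\<lambda>i. d (i + K'))"
    using d_nonneg by (intro bounded_imp_summable[of _ C]) (simp_all only: lessThan_Suc_atMost)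
  then show ?thesis using summable_iff_shift by blast
qed

end

subsection \<open>Points that are not local maximizers\<close>

text \<open>Maximizing \<open>\<phi> (H y - H xb) - \<parallel>y - y0\<parallel> / 2\<close> near \<open>xb\<close> produces points of the level \<open>H xb + r\<close>
  at distance \<open>O(\<phi> r)\<close> from \<open>xb\<close>: an interior maximizer would violate the KL inequality.\<close>

lemma (in desingularizing) level_point_near:
  fixes H :: "'a::euclidean_space \<Rightarrow> real"
  assumes diffH: "\<And>x. H differentiable (at x)"
    and not_max: "\<not> local_maximizer H xb"
    and \<delta>: "0 < \<delta>"
    and KL: "\<And>x. norm (x - xb) < \<delta> \<Longrightarrow> 0 < H x - H xb \<Longrightarrow> ereal (H x - H xb) < \<eta> \<Longrightarrow>
          1 \<le> deriv \<phi> (H x - H xb) * norm (grad H x)"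
    and r: "0 < r" "ereal r < \<eta>" "4 * \<phi> r < \<delta>"
  obtains y where "H y = H xb + r" "norm (y - xb) \<le> 3 * \<phi> r"
proof -
  have contH: "continuous_on A H" for A
    using diffH by (meson continuous_at_imp_continuous_on differentiable_imp_continuous_within)
  have \<phi>r: "0 < \<phi> r" using pos r by simp
  \<comment> \<open>Failure of local maximality supplies points above the level of \<open>xb\<close>
    arbitrarily close to it; continuity keeps them below the target level.\<close>
  obtain y0 where y0: "norm (y0 - xb) < \<phi> r" "0 < H y0 - H xb" "H y0 - H xb < r"
  proof -
    have "isCont H xb" using diffH differentiable_imp_continuous_within by blast
    then have "\<forall>\<^sub>F y in nhds xb. H y < H xb + r"
      using r by (intro order_tendstoD) (auto simp: isCont_def tendsto_at_iff_tendsto_nhds)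
    moreover have "\<forall>\<^sub>F y in nhds xb. norm (y - xb) < \<phi> r"
      using \<phi>r by (auto simp: eventually_nhds_metric dist_norm intro!: exI[of _ "\<phi> r"])
    moreover have "\<exists>\<^sub>F y in nhds xb. \<not> H y \<le> H xb"
      using not_max by (simp add: local_maximizer_def frequently_def)
    ultimately have "\<exists>\<^sub>F y in nhds xb. (H y < H xb + r \<and> norm (y - xb) < \<phi> r) \<and> \<not> H y \<le> H xb"
      using frequently_eventually_conj[OF _ eventually_conj] by fast
    then show thesis using that by (auto dest!: frequently_ex)
  qed
  \<comment> \<open>This ball lies inside the KL neighbourhood. As
    \<open>4 * \<phi> r < \<delta>\<close>, its radius exceeds \<open>3 * \<phi> r\<close>, so
    points at the claimed distance are interior to it.\<close>
  define K where "K = cball xb (\<delta> - \<phi> r) \<inter> {y. H xb \<le> H y \<and> H y \<le> H xb + r}"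
  \<comment> \<open>The penalty slope 1/2 is below 1, the lower bound that KL puts on the gradient
    norm of \<open>\<phi> (H y - H xb)\<close>; this is why a maximizer can stop only at the top
    level.\<close>
  define \<Psi> where "\<Psi> y = \<phi> (H y - H xb) - norm (y - y0) / 2" for y
  have "compact K"
    unfolding K_def
    by (intro compact_Int_closed compact_cball closed_Collect_conj closed_Collect_le
          continuous_intros contH)
  moreover have "continuous_on K \<Psi>"
    unfolding \<Psi>_def
    by (intro continuous_intros continuous_on_compose2[OF cont] contH)
       (use r less_eta[of _ r] in \<open>auto simp: K_def algebra_simps\<close>)
  moreover have "y0 \<in> K"
    using y0 r \<phi>r by (auto simp: K_def dist_norm norm_minus_commute)
  ultimately obtain y where y: "y \<in> K" "\<And>x. x \<in> K \<Longrightarrow> \<Psi> x \<le> \<Psi> y"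
    using continuous_attains_sup[of K \<Psi>] by blast
  \<comment> \<open>\<open>\<Psi>\<close> is positive at \<open>y0\<close>. This forces the
    maximizer above the level of \<open>xb\<close> and within \<open>2 * \<phi> r\<close> of
    \<open>y0\<close>; the distance from \<open>y0\<close> to \<open>xb\<close> makes it
    \<open>3 * \<phi> r\<close>.\<close>
  have "\<Psi> y0 \<le> \<Psi> y" using y \<open>y0 \<in> K\<close> by blast
  moreover have "0 < \<phi> (H y0 - H xb)"
    using y0 r less_eta[of "H y0 - H xb" r] by (intro pos) auto
  ultimately have y_bd: "norm (y - y0) / 2 < \<phi> (H y - H xb)" by (simp add: \<Psi>_def)
  have y_le: "H xb \<le> H y" "H y - H xb \<le> r" using y(1) by (auto simp: K_def)
  have eta: "ereal (H y - H xb) < \<eta>" using y_le r less_eta by blast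
  have "0 < H y - H xb"
    using y_bd y_le zero by (cases "H y = H xb") (auto simp: field_simps)
  have "\<phi> (H y - H xb) \<le> \<phi> r" using y_le r by (intro mono) auto
  then have "norm (y - y0) < 2 * \<phi> r" using y_bd by simp
  then have y_near: "norm (y - xb) < 3 * \<phi> r"
    using norm_triangle_ineq[of "y - y0" "y0 - xb"] y0(1) by simp
  have "H y = H xb + r"
  proof (rule ccontr)
    assume "H y \<noteq> H xb + r"
    then have less: "H y < H xb + r" using y_le by simp
    define U where "U = {x. H xb < H x \<and> H x < H xb + r} \<inter> ball xb (\<delta> - \<phi> r)"
    have "open U" unfolding U_def
      by (intro open_Int open_Collect_conj open_Collect_less continuous_intros contH open_ball)
    moreover have "y \<in> U"
      using \<open>0 < H y - H xb\<close> less y_near r by (auto simp: U_def dist_norm norm_minus_commute)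
    moreover have UK: "U \<subseteq> K" using \<phi>r by (auto simp: U_def K_def)
    define f where "f x = \<phi> (H x - H xb)" for x
    have GD: "GDERIV f y :> deriv \<phi> (H y - H xb) *\<^sub>R grad H y"
      unfolding f_def using has_deriv[OF \<open>0 < H y - H xb\<close> eta]
      by (intro GDERIV_DERIV_compose[of "\<lambda>x. H x - H xb"])
         (use GDERIV_diff[OF GDERIV_grad[OF diffH] GDERIV_const] in auto)
    have grad_ge: "1 \<le> deriv \<phi> (H y - H xb) * norm (grad H y)"
      using KL[of y] y_near r \<phi>r \<open>0 < H y - H xb\<close> eta by simp
    text \<open>Moving from \<open>y\<close> along the gradient \<open>v\<close> increases \<open>f\<close> at rate \<open>\<parallel>v\<parallel>\<^sup>2\<close> but the penalty at
      most at rate \<open>\<parallel>v\<parallel> / 2\<close>.\<close>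
    define v where "v = deriv \<phi> (H y - H xb) *\<^sub>R grad H y"
    have nv: "1 \<le> norm v"
      using grad_ge deriv_pos[OF \<open>0 < H y - H xb\<close> eta] by (simp add: v_def)
    have "((\<lambda>t. y + t *\<^sub>R v) has_derivative (\<lambda>s. s *\<^sub>R v)) (at 0)"
      by (auto intro!: derivative_eq_intros)
    then have "((\<lambda>t. f (y + t *\<^sub>R v)) has_derivative (\<lambda>s. v \<bullet> (s *\<^sub>R v))) (at 0)"
      using has_derivative_compose[of "\<lambda>t. y + t *\<^sub>R v" "\<lambda>s. s *\<^sub>R v" 0 UNIV f "\<lambda>h. v \<bullet> h"]
        GDERIV_has_derivative[OF GD] unfolding v_def[symmetric] by simp
    moreover have "(\<lambda>s. v \<bullet> (s *\<^sub>R v)) = (*) ((norm v)\<^sup>2)"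
      by (auto simp: fun_eq_iff power2_norm_eq_inner)
    ultimately have "((\<lambda>t. f (y + t *\<^sub>R v)) has_real_derivative (norm v)\<^sup>2) (at 0)"
      by (simp add: has_field_derivative_def)
    then have "((\<lambda>t. f (y + t *\<^sub>R v) - t * (norm v / 2)) has_real_derivative (norm v)\<^sup>2 - norm v / 2) (at 0)"
      by (auto intro!: derivative_eq_intros)
    moreover have "0 < (norm v)\<^sup>2 - norm v / 2"
    proof -
      have "norm v * 1 \<le> norm v * norm v" using nv by (intro mult_left_mono) auto
      then show ?thesis using nv by (simp add: power2_eq_square)
    qed
    ultimately have "\<exists>d>0. \<forall>h>0. h < d \<longrightarrow> f (y + 0 *\<^sub>R v) - 0 * (norm v / 2) < f (y + (0 + h) *\<^sub>R v) - (0 + h) * (norm v / 2)"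
      by (rule DERIV_pos_inc_right)
    then obtain d where d: "0 < d"
      "\<And>h. 0 < h \<Longrightarrow> h < d \<Longrightarrow> f y < f (y + h *\<^sub>R v) - h * (norm v / 2)"
      by auto
    obtain e where e: "0 < e" "ball y e \<subseteq> U"
      using \<open>open U\<close> \<open>y \<in> U\<close> openE by blast
    define h where "h = min (d / 2) (e / (2 * norm v))"
    have h: "0 < h" "h < d" "h * norm v < e"
    proof -
      have v: "0 < norm v" using nv by linarith
      show "0 < h" "h < d" using d(1) e(1) v by (auto simp: h_def)
      have "h * norm v \<le> e / (2 * norm v) * norm v"
        using v by (intro mult_right_mono) (auto simp: h_def)
      then show "h * norm v < e" using v e(1) by simp
    qed
    have "y + h *\<^sub>R v \<in> K" using h e UK by (auto simp: dist_norm subset_iff)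
    then have "\<Psi> (y + h *\<^sub>R v) \<le> \<Psi> y" by (rule y(2))
    moreover have "norm (y + h *\<^sub>R v - y0) \<le> norm (y - y0) + h * norm v"
      using norm_triangle_ineq[of "y - y0" "h *\<^sub>R v"] h(1) by (simp add: algebra_simps)
    ultimately show False using d(2)[OF h(1,2)] by (simp add: \<Psi>_def f_def)
  qed
  then show thesis using that y_near by simp
qed

text \<open>The gradient vanishes at \<open>xb\<close> and is Lipschitz nearby, so at a point of
  level \<open>H xb + t\<close> within \<open>3 * \<phi> t\<close> of \<open>xb\<close> its norm is
  at most \<open>3 * L * \<phi> t\<close>. KL at that point bounds
  \<open>deriv \<phi> t * \<phi> t\<close> from below.\<close>

lemma not_integrable_if_not_local_maximizer:
  fixes H :: "'a::euclidean_space \<Rightarrow> real"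
  assumes diffH: "\<And>x. H differentiable (at x)"
    and lip: "locally_lipschitz (grad H)"
    and crit: "critical_point H xb"
    and not_max: "\<not> local_maximizer H xb"
    and KLd: "KL_desingularization H xb \<eta> \<phi>"
  shows "\<not> integrable_near_0 (\<lambda>t. 1 / KL_phi \<phi> t)"
proof -
  interpret desingularizing \<eta> \<phi> using KLd by (rule KL_desingularizationD)
  obtain \<delta> where \<delta>: "0 < \<delta>" and KL: "\<And>x. norm (x - xb) < \<delta> \<Longrightarrow> 0 < H x - H xb \<Longrightarrow> ereal (H x - H xb) < \<eta> \<Longrightarrow>
          1 \<le> deriv \<phi> (H x - H xb) * norm (grad H x)"
    using KL_desingularizationD(2)[OF KLd] by blast
  obtain \<rho> L0 where L0: "0 < \<rho>" "L0-lipschitz_on (ball xb \<rho>) (grad H)"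
    using lip unfolding locally_lipschitz_def by blast
  \<comment> \<open>The constant \<open>L0\<close> may be 0, and a positive factor is needed
    below.\<close>
  define L where "L = L0 + 1"
  have L: "0 < L" "L-lipschitz_on (ball xb \<rho>) (grad H)"
    using L0 lipschitz_on_nonneg[OF L0(2)] lipschitz_on_le[OF L0(2), of L]
    by (auto simp: L_def)
  obtain \<tau> where \<tau>: "0 < \<tau>" "ereal \<tau> < \<eta>" "\<phi> \<tau> < min \<delta> \<rho> / 4"
    using small[of "min \<delta> \<rho> / 4"] \<delta> L0(1) by auto
  show ?thesis
  \<comment> \<open>The claim does not involve \<open>KL_psi\<close>, so \<open>\<tau>\<close>
    itself can serve as its base point.\<close>
  proof (rule not_integrable_if_log_deriv_le[OF \<tau>(1,2), of "3 * L" \<tau>])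
    fix t assume t: "0 < t" "t \<le> \<tau>"
    have eta: "ereal t < \<eta>" using t \<tau> less_eta by blast
    have "\<phi> t \<le> \<phi> \<tau>" using t \<tau> by (intro mono) auto
    then have small: "4 * \<phi> t < \<delta>" "4 * \<phi> t < \<rho>" using \<tau>(3) by auto
    obtain y where y: "H y = H xb + t" "norm (y - xb) \<le> 3 * \<phi> t"
      using level_point_near[OF diffH not_max \<delta> KL t(1) eta small(1)] by blast
    have \<phi>t: "0 < \<phi> t" using pos t eta by blast
    have "y \<in> ball xb \<rho>" using y(2) small \<phi>t by (simp add: dist_norm norm_minus_commute)
    then have "norm (grad H y) \<le> L * norm (y - xb)"
      using lipschitz_onD[OF L(2), of y xb] crit L0(1) by (simp add: critical_point_def dist_norm)
    also have "\<dots> \<le> L * (3 * \<phi> t)" using y(2) L(1) by (intro mult_left_mono) auto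
    finally have "deriv \<phi> t * norm (grad H y) \<le> deriv \<phi> t * (L * (3 * \<phi> t))"
      using deriv_pos[OF t(1) eta] by (intro mult_left_mono) auto
    moreover have "1 \<le> deriv \<phi> t * norm (grad H y)"
      using KL[of y] y small \<phi>t t(1) eta by simp
    ultimately show "1 \<le> 3 * L * (deriv \<phi> t * \<phi> t)" by (simp add: mult_ac)
  qed (use L \<tau> in auto)
qed

subsection \<open>Convergence of a trajectory\<close>

lemma coercive_compact_sublevel:
  fixes H :: "'a::euclidean_space \<Rightarrow> real"
  assumes "coercive H" "C1 H"
  shows "compact {x. H x \<le> c}"
proof -
  have "\<forall>\<^sub>F x in at_infinity. c < H x"
    using assms(1) by (simp add: coercive_def filterlim_at_top_dense)
  then obtain b where "\<And>x. b \<le> norm x \<Longrightarrow> c < H x"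
    unfolding eventually_at_infinity by blast
  then have "{x. H x \<le> c} \<subseteq> cball 0 b" by (force simp: not_le[symmetric])
  then have "bounded {x. H x \<le> c}" using bounded_cball bounded_subset by blast
  moreover have "closed {x. H x \<le> c}"
    by (intro closed_Collect_le C1_continuous_on assms continuous_intros)
  ultimately show ?thesis by (simp add: compact_eq_bounded_closed)
qed

text \<open>Base case of the induction in \<open>uniform_KL\<close>, where the cover is
  empty.\<close>

lemma desingularizing_ident: "desingularizing \<infinity> (\<lambda>t. t)"
proof
  have "convex {t::real. 0 \<le> t}" using convex_real_interval(1)[of 0] by (simp add: atLeast_def)
  then show "concave_on {t. 0 \<le> t \<and> ereal t < \<infinity>} (\<lambda>t. t)"
    by (auto simp: concave_on_def convex_on_def)
qed (auto intro!: continuous_intros)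

text \<open>Both derivatives are positive, so the sum satisfies the KL inequality wherever one
  summand does. A pointwise maximum would do the same but need be neither concave nor
  differentiable.\<close>

lemma desingularizing_add:
  assumes "desingularizing \<eta>1 \<phi>1" "desingularizing \<eta>2 \<phi>2"
  shows "desingularizing (min \<eta>1 \<eta>2) (\<lambda>t. \<phi>1 t + \<phi>2 t)"
    and "\<And>t. 0 < t \<Longrightarrow> ereal t < min \<eta>1 \<eta>2 \<Longrightarrow> deriv (\<lambda>t. \<phi>1 t + \<phi>2 t) t = deriv \<phi>1 t + deriv \<phi>2 t"
proof -
  interpret a: desingularizing \<eta>1 \<phi>1 by fact
  interpret b: desingularizing \<eta>2 \<phi>2 by fact
  let ?D = "{t. 0 \<le> t \<and> ereal t < min \<eta>1 \<eta>2}"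
  let ?D' = "{t. 0 < t \<and> ereal t < min \<eta>1 \<eta>2}"
  show d: "deriv (\<lambda>t. \<phi>1 t + \<phi>2 t) t = deriv \<phi>1 t + deriv \<phi>2 t"
    if "0 < t" "ereal t < min \<eta>1 \<eta>2" for t
    using that by (intro DERIV_imp_deriv DERIV_add a.has_deriv b.has_deriv) auto
  have "is_interval ?D"
    unfolding is_interval_1 using a.less_eta b.less_eta by auto
  then have conv: "convex ?D" by (simp add: is_interval_convex_1)
  show "desingularizing (min \<eta>1 \<eta>2) (\<lambda>t. \<phi>1 t + \<phi>2 t)"
  proof
    show "continuous_on ?D (\<lambda>t. \<phi>1 t + \<phi>2 t)"
      by (intro continuous_on_add continuous_on_subset[OF a.cont] continuous_on_subset[OF b.cont]) auto
    have "convex_on ?D (\<lambda>t. - \<phi>1 t)" "convex_on ?D (\<lambda>t. - \<phi>2 t)"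
      using a.concave b.concave conv unfolding concave_on_def by (auto intro: convex_on_subset)
    then have "convex_on ?D (\<lambda>t. - \<phi>1 t + - \<phi>2 t)" by (rule convex_on_add)
    then show "concave_on ?D (\<lambda>t. \<phi>1 t + \<phi>2 t)" by (simp add: concave_on_def)
    have "continuous_on ?D' (\<lambda>t. deriv \<phi>1 t + deriv \<phi>2 t)"
      by (intro continuous_on_add continuous_on_subset[OF a.cont_deriv] continuous_on_subset[OF b.cont_deriv]) auto
    then show "continuous_on ?D' (deriv (\<lambda>t. \<phi>1 t + \<phi>2 t))"
      using d by (subst continuous_on_cong[OF refl]) auto
    show "(\<lambda>t. \<phi>1 t + \<phi>2 t) differentiable at t" if "0 < t" "ereal t < min \<eta>1 \<eta>2" for t
      using that by (intro differentiable_add a.diff b.diff) auto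
    show "0 < deriv (\<lambda>t. \<phi>1 t + \<phi>2 t) t" if "0 < t" "ereal t < min \<eta>1 \<eta>2" for t
      using that a.deriv_pos[of t] b.deriv_pos[of t] d[OF that] by simp
  qed (use a.eta_pos b.eta_pos a.nonneg b.nonneg a.zero b.zero in auto)
qed

text \<open>A finite subcover of KL neighbourhoods, with the desingularizing functions of their
  centres added up. The common value \<open>h\<close> matters: it gives all these functions the same
  argument \<open>H x - h\<close>.\<close>

lemma uniform_KL:
  fixes H :: "'a::euclidean_space \<Rightarrow> real"
  assumes "compact C" and h: "\<And>x. x \<in> C \<Longrightarrow> H x = h"
    and KL: "\<And>x. x \<in> C \<Longrightarrow> KL_desingularization H x (\<eta> x) (\<phi> x)"
  obtains U \<eta>' \<phi>' where "open U" "C \<subseteq> U" "desingularizing \<eta>' \<phi>'"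
    "\<And>x. x \<in> U \<Longrightarrow> 0 < H x - h \<Longrightarrow> ereal (H x - h) < \<eta>' \<Longrightarrow>
       1 \<le> deriv \<phi>' (H x - h) * norm (grad H x)"
proof -
  have "\<forall>c\<in>C. \<exists>\<delta>>0. \<forall>x. norm (x - c) < \<delta> \<longrightarrow> 0 < H x - h \<longrightarrow> ereal (H x - h) < \<eta> c \<longrightarrow>
          1 \<le> deriv (\<phi> c) (H x - h) * norm (grad H x)"
    using KL_desingularizationD(2)[OF KL] h by force
  then obtain \<delta> where \<delta>: "\<And>c. c \<in> C \<Longrightarrow> 0 < \<delta> c"
    "\<And>c x. c \<in> C \<Longrightarrow> norm (x - c) < \<delta> c \<Longrightarrow> 0 < H x - h \<Longrightarrow> ereal (H x - h) < \<eta> c \<Longrightarrow>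
          1 \<le> deriv (\<phi> c) (H x - h) * norm (grad H x)"
    unfolding bchoice_iff by blast
  have "C \<subseteq> (\<Union>c\<in>C. ball c (\<delta> c))" using \<delta>(1) by auto
  then obtain D where D: "finite D" "D \<subseteq> C" "C \<subseteq> (\<Union>c\<in>D. ball c (\<delta> c))"
    using compactE_image[OF \<open>compact C\<close>, of C "\<lambda>c. ball c (\<delta> c)"] open_ball by metis
  have "\<exists>\<eta>' \<phi>'. desingularizing \<eta>' \<phi>' \<and> (\<forall>x\<in>(\<Union>c\<in>D. ball c (\<delta> c)). 0 < H x - h \<longrightarrow>
       ereal (H x - h) < \<eta>' \<longrightarrow> 1 \<le> deriv \<phi>' (H x - h) * norm (grad H x))"
    using D(1,2)
  proof (induction D)
    case empty
    then show ?case using desingularizing_ident by auto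
  next
    case (insert c D)
    then have "D \<subseteq> C" "c \<in> C" by auto
    with insert.IH obtain \<eta>' \<phi>' where IH: "desingularizing \<eta>' \<phi>'"
      "\<forall>x\<in>(\<Union>c\<in>D. ball c (\<delta> c)). 0 < H x - h \<longrightarrow> ereal (H x - h) < \<eta>' \<longrightarrow>
         1 \<le> deriv \<phi>' (H x - h) * norm (grad H x)"
      by meson
    have c: "desingularizing (\<eta> c) (\<phi> c)" using KL_desingularizationD(1) KL insert by blast
    interpret a: desingularizing "\<eta> c" "\<phi> c" by fact
    interpret b: desingularizing \<eta>' \<phi>' by fact
    show ?case
    proof (intro exI conjI ballI impI)
      show "desingularizing (min (\<eta> c) \<eta>') (\<lambda>t. \<phi> c t + \<phi>' t)"
        by (rule desingularizing_add(1)[OF c IH(1)])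
      fix x assume x: "x \<in> (\<Union>c\<in>insert c D. ball c (\<delta> c))"
        and p: "0 < H x - h" "ereal (H x - h) < min (\<eta> c) \<eta>'"
      have "1 \<le> deriv (\<phi> c) (H x - h) * norm (grad H x) \<or> 1 \<le> deriv \<phi>' (H x - h) * norm (grad H x)"
      proof (cases "x \<in> ball c (\<delta> c)")
        case True
        then show ?thesis using \<delta>(2)[of c x] insert p by (auto simp: dist_norm norm_minus_commute)
      next
        case False
        then show ?thesis using IH(2) x p by auto
      qed
      moreover have "0 \<le> deriv (\<phi> c) (H x - h) * norm (grad H x)" "0 \<le> deriv \<phi>' (H x - h) * norm (grad H x)"
        using a.deriv_pos[of "H x - h"] b.deriv_pos[of "H x - h"] p by auto
      ultimately show "1 \<le> deriv (\<lambda>t. \<phi> c t + \<phi>' t) (H x - h) * norm (grad H x)"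
        unfolding desingularizing_add(2)[OF c IH(1) p] by (auto simp: distrib_right)
    qed
  qed
  then obtain \<eta>' \<phi>' where *: "desingularizing \<eta>' \<phi>'"
    "\<forall>x\<in>(\<Union>c\<in>D. ball c (\<delta> c)). 0 < H x - h \<longrightarrow>
       ereal (H x - h) < \<eta>' \<longrightarrow> 1 \<le> deriv \<phi>' (H x - h) * norm (grad H x)"
    by meson
  show thesis by (rule that[OF _ D(3) *(1)]) (use *(2) in blast)+
qed

text \<open>What is known about one sample path in \<open>E0\<close>; nothing inside this locale is
  random.\<close>

locale descent_trajectory =
  fixes H :: "'a::euclidean_space \<Rightarrow> real" and x :: "nat \<Rightarrow> 'a" and z \<alpha> :: "nat \<Rightarrow> real"
    and c1 c2 \<alpha>bar :: real and \<phi> :: "'a \<Rightarrow> real \<Rightarrow> real" and \<eta> :: "'a \<Rightarrow> ereal" and t0 :: "'a \<Rightarrow> real"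
  assumes C1: "C1 H" and coercive: "coercive H" and loc_lip: "locally_lipschitz (grad H)"
    and c_pos: "0 < c1" "0 < c2"
    and alpha: "\<And>k. 0 < \<alpha> k" "\<And>k. \<alpha> k \<le> \<alpha>bar"
    and alpha_div: "filterlim (\<lambda>n. \<Sum>k<n. \<alpha> k) at_top sequentially"
    and z_nonneg: "\<And>k. 0 \<le> z k"
    and avg: "liminf (\<lambda>k. ereal ((\<Sum>i=1..k. \<alpha> i * z i) / (\<Sum>i=1..k. \<alpha> i))) \<ge> ereal c2"
    and grad_descent: "\<And>k. c1 * (\<alpha> k * z k * (norm (grad H (x k)))\<^sup>2) \<le> H (x k) - H (x (Suc k))"
    and step_descent: "\<And>k. c1 * (norm (x (Suc k) - x k))\<^sup>2 \<le> \<alpha> k * (H (x k) - H (x (Suc k)))"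
    and grad_0: "(\<lambda>k. (norm (grad H (x k)))\<^sup>2) \<longlonglongrightarrow> 0"
    and KL: "\<And>xb. critical_point H xb \<Longrightarrow> KL_desingularization H xb (\<eta> xb) (\<phi> xb)"
    and t0: "\<And>xb. critical_point H xb \<Longrightarrow> 0 < t0 xb \<and> ereal (t0 xb) < \<eta> xb"
begin

lemma H_decseq: "decseq (\<lambda>k. H (x k))"
proof (rule decseq_SucI)
  fix k
  have "0 \<le> c1 * (\<alpha> k * z k * (norm (grad H (x k)))\<^sup>2)"
    using c_pos alpha(1)[of k] z_nonneg[of k] by simp
  with grad_descent[of k] show "H (x (Suc k)) \<le> H (x k)" by simp
qed

lemma sublevel: "H (x k) \<le> H (x 0)"
  using H_decseq by (simp add: decseq_def)

definition h where "h = lim (\<lambda>k. H (x k))"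

lemma H_tendsto: "(\<lambda>k. H (x k)) \<longlonglongrightarrow> h" and h_le: "h \<le> H (x k)"
proof -
  have "compact (H ` {y. H y \<le> H (x 0)})"
    by (intro compact_continuous_image C1_continuous_on C1 coercive_compact_sublevel coercive)
  then have "bounded (H ` {y. H y \<le> H (x 0)})" by (rule compact_imp_bounded)
  then obtain B where "\<And>y. H y \<le> H (x 0) \<Longrightarrow> norm (H y) \<le> B"
    unfolding bounded_iff by auto
  then have "- B \<le> H (x k)" for k using sublevel[of k] by (fastforce simp: abs_le_iff)
  then have "convergent (\<lambda>k. H (x k))" using decseq_convergent[OF H_decseq] by (metis convergentI)
  then show "(\<lambda>k. H (x k)) \<longlonglongrightarrow> h" by (simp add: h_def convergent_LIMSEQ_iff)
  then show "h \<le> H (x k)" by (rule decseq_ge[OF H_decseq])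
qed

lemma r_tendsto: "(\<lambda>k. H (x k) - h) \<longlonglongrightarrow> 0"
  using tendsto_diff[OF H_tendsto tendsto_const[of h]] by simp

lemma limit_critical:
  assumes "strict_mono s" "(x \<circ> s) \<longlonglongrightarrow> l"
  shows "grad H l = 0" "H l = h"
proof -
  have "isCont (grad H) l" "isCont H l"
    using C1 C1_continuous_on[OF C1, of UNIV] by (auto simp: C1_def continuous_on_eq_continuous_at)
  then have lims: "(\<lambda>k. grad H (x (s k))) \<longlonglongrightarrow> grad H l" "(\<lambda>k. H (x (s k))) \<longlonglongrightarrow> H l"
    using isCont_tendsto_compose[OF _ assms(2)] by (auto simp: o_def)
  have "(\<lambda>k. H (x (s k))) \<longlonglongrightarrow> h"
    using LIMSEQ_subseq_LIMSEQ[OF H_tendsto assms(1)] by (simp add: o_def)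
  with lims(2) show "H l = h" by (rule LIMSEQ_unique)
  have "(\<lambda>k. (norm (grad H (x (s k))))\<^sup>2) \<longlonglongrightarrow> 0"
    using LIMSEQ_subseq_LIMSEQ[OF grad_0 assms(1)] by (simp add: o_def)
  moreover have "(\<lambda>k. (norm (grad H (x (s k))))\<^sup>2) \<longlonglongrightarrow> (norm (grad H l))\<^sup>2"
    by (intro tendsto_intros lims)
  ultimately have "0 = (norm (grad H l))\<^sup>2" by (rule LIMSEQ_unique)
  then show "grad H l = 0" by simp
qed

lemma KL_descentI:
  assumes "desingularizing \<eta>' \<phi>'" "0 < t" "ereal t < \<eta>'"
    and "\<And>k. K \<le> k \<Longrightarrow> 0 < H (x k) - h \<Longrightarrow>
      ereal (H (x k) - h) < \<eta>' \<and> 1 \<le> deriv \<phi>' (H (x k) - h) * norm (grad H (x k))"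
  shows "KL_descent (\<lambda>k. H (x k) - h) z \<alpha> (\<lambda>k. norm (x (Suc k) - x k)) (\<lambda>k. norm (grad H (x k)))
           c1 c2 \<alpha>bar \<eta>' \<phi>' K t"
proof -
  interpret desingularizing \<eta>' \<phi>' by fact
  show ?thesis
    using c_pos alpha alpha_div z_nonneg avg h_le grad_descent step_descent assms
    by unfold_locales auto
qed

text \<open>Every limit point is critical and lies on the level \<open>h\<close>; the critical points on this level form
  a compact set, so one desingularizing function serves all of them.\<close>

lemma convergent_x: "convergent x"
proof -
  let ?S = "{y. H y \<le> H (x 0)}"
  define C where "C = ?S \<inter> {y. grad H y = 0 \<and> H y = h}"
  have S: "compact ?S" by (intro coercive_compact_sublevel coercive C1)
  have "closed {y. grad H y = 0 \<and> H y = h}"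
    using C1 by (intro closed_Collect_conj closed_Collect_eq continuous_intros C1_continuous_on)
      (auto simp: C1_def)
  then have "compact C" unfolding C_def using S by (rule compact_Int_closed[rotated])
  then obtain U \<eta>' \<phi>' where U: "open U" "C \<subseteq> U" and ds: "desingularizing \<eta>' \<phi>'"
    and KL': "\<And>y. y \<in> U \<Longrightarrow> 0 < H y - h \<Longrightarrow> ereal (H y - h) < \<eta>' \<Longrightarrow>
       1 \<le> deriv \<phi>' (H y - h) * norm (grad H y)"
    using uniform_KL[of C H h \<eta> \<phi>] KL unfolding C_def critical_point_def by blast
  interpret desingularizing \<eta>' \<phi>' by fact
  obtain t where t: "0 < t" "ereal t < \<eta>'" using below_eta .
  have "\<forall>\<^sub>F k in sequentially. x k \<in> U"
  proof (rule ccontr)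
    assume "\<not> (\<forall>\<^sub>F k in sequentially. x k \<in> U)"
    then have "infinite {k. x k \<notin> U}"
      by (simp add: frequently_cofinite[symmetric] cofinite_eq_sequentially frequently_def)
    then have "\<exists>s::nat \<Rightarrow> nat. strict_mono s \<and> (\<forall>k. s k \<in> {k. x k \<notin> U})" by (rule infinite_enumerate)
    then obtain s :: "nat \<Rightarrow> nat" where s: "strict_mono s" "\<And>k. x (s k) \<notin> U" by blast
    \<comment> \<open>Iterates outside \<open>U\<close> would accumulate in this compact set, while
      every limit point lies in \<open>C\<close> and so in \<open>U\<close>.\<close>
    have "compact (?S - U)" using S U(1) by (rule compact_diff)
    moreover have "\<forall>k. x (s k) \<in> ?S - U" using s(2) sublevel by auto
    ultimately obtain l u where lu: "l \<in> ?S - U" "strict_mono u" "((\<lambda>k. x (s k)) \<circ> u) \<longlonglongrightarrow> l"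
      by (metis compact_imp_seq_compact seq_compactE)
    then have "(x \<circ> (s \<circ> u)) \<longlonglongrightarrow> l" by (simp add: o_def)
    then have "l \<in> C"
      using limit_critical[OF strict_mono_o[OF s(1) lu(2)], of l] lu(1) by (auto simp: C_def)
    then show False using U lu(1) by auto
  qed
  moreover have "\<forall>\<^sub>F k in sequentially. H (x k) - h < t"
    using r_tendsto t by (intro order_tendstoD)
  ultimately have "\<forall>\<^sub>F k in sequentially. x k \<in> U \<and> H (x k) - h < t" by eventually_elim auto
  then obtain K where K: "\<And>k. K \<le> k \<Longrightarrow> x k \<in> U \<and> H (x k) - h < t"
    unfolding eventually_sequentially by blast
  interpret KL_descent "\<lambda>k. H (x k) - h" z \<alpha> "\<lambda>k. norm (x (Suc k) - x k)" "\<lambda>k. norm (grad H (x k))"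
           c1 c2 \<alpha>bar \<eta>' \<phi>' K t
    using K KL' less_eta[OF less_imp_le t(2)] by (intro KL_descentI[OF ds t]) simp_all
  have "summable (\<lambda>k. x (Suc k) - x k)" by (rule summable_norm_cancel[OF summable_steps])
  then have "convergent (\<lambda>n. \<Sum>k<n. x (Suc k) - x k)" by (simp add: summable_iff_convergent)
  then obtain L where "(\<lambda>n. x n - x 0) \<longlonglongrightarrow> L"
    by (auto simp: convergent_def sum_lessThan_telescope)
  then have "(\<lambda>n. x n - x 0 + x 0) \<longlonglongrightarrow> L + x 0" by (intro tendsto_intros)
  then show "convergent x" by (simp add: convergentI)
qed

definition xs where "xs = lim x"

lemma x_tendsto: "x \<longlonglongrightarrow> xs"
  using convergent_x by (simp add: xs_def convergent_LIMSEQ_iff)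

lemma critical_xs: "critical_point H xs" and H_xs: "H xs = h"
  using limit_critical[of id xs] x_tendsto by (simp_all add: critical_point_def strict_mono_id o_def)

text \<open>With the limit known, the prescribed function at \<open>xs\<close> replaces the common
  one; the rates are stated in terms of it.\<close>

lemma KL_descent_xs:
  obtains K where "KL_descent (\<lambda>k. H (x k) - h) z \<alpha> (\<lambda>k. norm (x (Suc k) - x k))
    (\<lambda>k. norm (grad H (x k))) c1 c2 \<alpha>bar (\<eta> xs) (\<phi> xs) K (t0 xs)"
proof -
  have ds: "desingularizing (\<eta> xs) (\<phi> xs)"
    using KL_desingularizationD(1) KL critical_xs by blast
  interpret desingularizing "\<eta> xs" "\<phi> xs" by fact
  obtain \<delta> where \<delta>: "\<delta> > 0" "\<And>y. norm (y - xs) < \<delta> \<Longrightarrow> 0 < H y - h \<Longrightarrow>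
     ereal (H y - h) < \<eta> xs \<Longrightarrow> 1 \<le> deriv (\<phi> xs) (H y - h) * norm (grad H y)"
    using KL_desingularizationD(2)[OF KL[OF critical_xs]] H_xs by auto
  have t: "0 < t0 xs" "ereal (t0 xs) < \<eta> xs" using t0 critical_xs by auto
  have "\<forall>\<^sub>F k in sequentially. H (x k) - h < t0 xs"
    using r_tendsto t by (intro order_tendstoD)
  moreover have "\<forall>\<^sub>F k in sequentially. dist (x k) xs < \<delta>"
    using x_tendsto \<delta>(1) by (rule tendstoD)
  ultimately have "\<forall>\<^sub>F k in sequentially. H (x k) - h < t0 xs \<and> norm (x k - xs) < \<delta>"
    by eventually_elim (auto simp: dist_norm)
  then obtain K where K: "\<And>k. K \<le> k \<Longrightarrow> H (x k) - h < t0 xs \<and> norm (x k - xs) < \<delta>"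
    unfolding eventually_sequentially by blast
  show thesis
    using K \<delta>(2) less_eta[OF less_imp_le t(2)] by (intro that[of K] KL_descentI[OF ds t]) simp_all
qed

lemma constant_if_stops:
  assumes "H (x k) = h" "k \<le> n"
  shows "x n = xs"
proof -
  have step: "x (Suc i) = x i" if "k \<le> i" for i
  proof -
    have "H (x i) = h" using assms(1) decseqD[OF H_decseq that] h_le[of i] by simp
    then have "c1 * (norm (x (Suc i) - x i))\<^sup>2 \<le> 0"
      using step_descent[of i] h_le[of "Suc i"] alpha(1)[of i]
      by (smt (verit) mult_nonneg_nonpos)
    then show ?thesis using c_pos by (simp add: mult_le_0_iff)
  qed
  have const: "x i = x k" if "k \<le> i" for i
    using that by (induction i rule: dec_induct) (auto simp: step)
  have "(\<lambda>i. x (i + k)) \<longlonglongrightarrow> xs" using x_tendsto by (rule LIMSEQ_ignore_initial_segment)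
  moreover have "(\<lambda>i. x (i + k)) = (\<lambda>_. x k)" by (intro ext const) simp
  ultimately have "x k = xs" by (simp add: LIMSEQ_const_iff)
  then show ?thesis using const[OF assms(2)] by (rule trans[rotated])
qed

lemma finite_termination:
  assumes "integrable_near_0 (\<lambda>t. 1 / KL_phi (\<phi> xs) t)"
  shows "eventually_constant x"
proof -
  obtain K where "KL_descent (\<lambda>k. H (x k) - h) z \<alpha> (\<lambda>k. norm (x (Suc k) - x k))
    (\<lambda>k. norm (grad H (x k))) c1 c2 \<alpha>bar (\<eta> xs) (\<phi> xs) K (t0 xs)" by (rule KL_descent_xs)
  then obtain k where "H (x k) - h = 0" using KL_descent.finite_termination assms by blast
  then have "x n = xs" if "k \<le> n" for n using constant_if_stops[of k n] that by simp
  then show ?thesis unfolding eventually_constant_def by (intro exI[of _ k]) simp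
qed

lemma rates:
  assumes "\<not> integrable_near_0 (\<lambda>t. 1 / KL_phi (\<phi> xs) t)"
  shows "KL_rates H (\<phi> xs) (\<eta> xs) (t0 xs) c1 c2 (\<lambda>k. \<Sum>i<k. \<alpha> i) x xs"
proof -
  obtain K where "KL_descent (\<lambda>k. H (x k) - h) z \<alpha> (\<lambda>k. norm (x (Suc k) - x k))
    (\<lambda>k. norm (grad H (x k))) c1 c2 \<alpha>bar (\<eta> xs) (\<phi> xs) K (t0 xs)" by (rule KL_descent_xs)
  then interpret KL_descent "\<lambda>k. H (x k) - h" z \<alpha> "\<lambda>k. norm (x (Suc k) - x k)"
    "\<lambda>k. norm (grad H (x k))" c1 c2 \<alpha>bar "\<eta> xs" "\<phi> xs" K "t0 xs" .
  let ?c = "\<lambda>k. c1 * c2 / 2 * (\<Sum>i<k. \<alpha> i)"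
  obtain K' where K': "1 \<le> K'"
    "\<And>k. K' \<le> k \<Longrightarrow> ?c k \<in> KL_psi (\<phi> xs) (t0 xs) ` {t. 0 < t \<and> ereal t < \<eta> xs}"
    "\<And>k. K' \<le> k \<Longrightarrow> H (x k) - h \<le> KL_psi_inv (\<phi> xs) (\<eta> xs) (t0 xs) (?c k)"
    "\<And>k n. K' \<le> k \<Longrightarrow> k \<le> n \<Longrightarrow> (\<Sum>i=k..<n. norm (x (Suc i) - x i)) \<le>
       sqrt 2 / (c1 * sqrt c2) * \<phi> xs (KL_psi_inv (\<phi> xs) (\<eta> xs) (t0 xs) (?c k))"
    using rates[OF assms] by blast
  have "norm (x k - xs) \<le> sqrt 2 / (c1 * sqrt c2) * \<phi> xs (KL_psi_inv (\<phi> xs) (\<eta> xs) (t0 xs) (?c k))"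
    if k: "K' \<le> k" for k
  proof (rule LIMSEQ_le_const2)
    show "(\<lambda>n. norm (x k - x n)) \<longlonglongrightarrow> norm (x k - xs)" by (intro tendsto_intros x_tendsto)
    have "norm (x k - x n) \<le> (\<Sum>i=k..<n. norm (x (Suc i) - x i))" if "k \<le> n" for n
      using norm_sum[of "\<lambda>i. x (Suc i) - x i" "{k..<n}"] sum_Suc_diff'[OF that, of x]
      by (simp add: norm_minus_commute)
    then show "\<exists>N. \<forall>n\<ge>N. norm (x k - x n) \<le>
        sqrt 2 / (c1 * sqrt c2) * \<phi> xs (KL_psi_inv (\<phi> xs) (\<eta> xs) (t0 xs) (?c k))"
      using K'(4)[OF k] order_trans by blast
  qed
  then show ?thesis
    unfolding KL_rates_def h_def[symmetric] using K'(1-3) by blast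
qed

text \<open>Descent keeps the values at or above \<open>h\<close>; near a local maximizer on level
  \<open>h\<close> they cannot exceed it. So \<open>h\<close> is reached, and
  \<open>step_descent\<close> forbids further movement.\<close>

lemma dichotomy:
  "local_maximizer H xs \<and> (\<exists>K. \<forall>k\<ge>K. x k = xs) \<or>
   \<not> local_maximizer H xs \<and> KL_rates H (\<phi> xs) (\<eta> xs) (t0 xs) c1 c2 (\<lambda>k. \<Sum>i<k. \<alpha> i) x xs"
proof (cases "local_maximizer H xs")
  case True
  then have "\<forall>\<^sub>F k in sequentially. H (x k) \<le> h"
    using x_tendsto unfolding local_maximizer_def H_xs filterlim_iff by blast
  then obtain K where "H (x K) \<le> h" unfolding eventually_sequentially by blast
  then have "H (x K) = h" using h_le by (rule antisym)
  then show ?thesis using constant_if_stops True by blast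
next
  case False
  have "\<not> integrable_near_0 (\<lambda>t. 1 / KL_phi (\<phi> xs) t)"
    using C1 loc_lip critical_xs False KL by (intro not_integrable_if_not_local_maximizer) (auto simp: C1_def)
  then show ?thesis using False rates by blast
qed

end

subsection \<open>Blocks of coordinates\<close>

lemma block_space_subspace: "subspace (block_space blk i)"
  by (auto simp: subspace_def block_space_def)

lemma closed_block_space: "closed (block_space blk i)"
  by (simp add: closed_subspace block_space_subspace)

lemma block_part_in_space: "block_part blk i x \<in> block_space blk i"
  by (simp add: block_part_def block_space_def)

lemma block_part_add: "block_part blk i (x + y) = block_part blk i x + block_part blk i y"
  and block_part_scaleR: "block_part blk i (c *\<^sub>R x) = c *\<^sub>R block_part blk i x"
  by (auto simp: block_part_def vec_eq_iff)

lemma inner_block_part: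
  assumes "u \<in> block_space blk i"
  shows "block_part blk i x \<bullet> u = x \<bullet> u"
  using assms unfolding inner_vec_def by (intro sum.cong) (auto simp: block_part_def block_space_def)

lemma norm_block_part_le: "norm (block_part blk i x) \<le> norm x"
  by (intro norm_le_componentwise_cart) (auto simp: block_part_def)

text \<open>Pythagoras for the partition into blocks; it converts bounds on sampled block gradients
  into one on the full gradient.\<close>

lemma sum_norm_block_part:
  fixes x :: "real ^ 'n::finite"
  assumes "range blk \<subseteq> J" "finite J"
  shows "(\<Sum>i\<in>J. (norm (block_part blk i x))\<^sup>2) = (norm x)\<^sup>2"
proof -
  have "(\<Sum>i\<in>J. (norm (block_part blk i x))\<^sup>2) = (\<Sum>i\<in>J. \<Sum>j\<in>UNIV. if i = blk j then (x $ j)\<^sup>2 else 0)"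
    unfolding power2_norm_eq_inner inner_vec_def
    by (intro sum.cong refl) (auto simp: block_part_def power2_eq_square)
  also have "\<dots> = (\<Sum>j\<in>UNIV. \<Sum>i\<in>J. if i = blk j then (x $ j)\<^sup>2 else 0)" by (rule sum.swap)
  also have "\<dots> = (\<Sum>j\<in>UNIV. (x $ j)\<^sup>2)"
    using assms by (intro sum.cong refl) (simp add: sum.delta subset_iff)
  also have "\<dots> = (norm x)\<^sup>2"
    unfolding power2_norm_eq_inner inner_vec_def by (simp add: power2_eq_square)
  finally show ?thesis .
qed

lemma block_replace_eq:
  assumes "u \<in> block_space blk i"
  shows "block_replace blk i x u = x + (u - block_part blk i x)"
  using assms by (auto simp: block_replace_def block_part_def block_space_def vec_eq_iff)

subsection \<open>The proximal step\<close>

locale prox_setting =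
  fixes m :: nat and blk :: "'n::finite \<Rightarrow> nat" and F R :: "real ^ 'n \<Rightarrow> real" and x0 :: "real ^ 'n"
    and LF LR \<mu> Lhat :: "nat \<Rightarrow> real"
  assumes smooth: "C1 F" "C1 R"
    and regular: "blockwise_regular m blk F R x0 LF LR \<mu>"
    and Lhat: "Lhat = (\<lambda>i. LF i + \<mu> i)"
begin

lemma constants:
  assumes "i \<in> {1..m}"
  shows "0 < LF i" "0 < LR i" "0 \<le> \<mu> i" "0 < Lhat i"
proof -
  show "0 < LF i" "0 < LR i" "0 \<le> \<mu> i"
    using regular assms unfolding blockwise_regular_def by blast+
  then show "0 < Lhat i" by (simp add: Lhat)
qed

text \<open>First-order form of blockwise weak convexity. The hypothesis adds a quadratic centred at
  0 rather than at \<open>x\<close>, but its second-order remainder is the same at every base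
  point.\<close>

lemma weakly_convex:
  assumes i: "i \<in> {1..m}" and w: "w \<in> block_space blk i"
  shows "R x + grad R x \<bullet> w - \<mu> i / 2 * (norm w)\<^sup>2 \<le> R (x + w)"
proof -
  let ?S = "block_space blk i"
  let ?f = "\<lambda>u. R (block_replace blk i x u) + \<mu> i / 2 * (norm u)\<^sup>2"
  define b where "b = block_part blk i x"
  have conv: "convex_on ?S ?f" using regular i unfolding blockwise_regular_def by blast
  have mem: "b + t *\<^sub>R w \<in> ?S" for t
    unfolding b_def using w
    by (intro subspace_add subspace_scale block_space_subspace block_part_in_space)
  \<comment> \<open>The squared norm of \<open>b + t *\<^sub>R w\<close> is expanded as a polynomial
    in \<open>t\<close>, so that the derivative at 0 can be read off.\<close>
  define g where "g t = R (x + t *\<^sub>R w) + \<mu> i / 2 * ((b \<bullet> b) + 2 * t * (b \<bullet> w) + t\<^sup>2 * (w \<bullet> w))" for t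
  have g: "g t = ?f (b + t *\<^sub>R w)" for t
  proof -
    have "block_replace blk i x (b + t *\<^sub>R w) = x + t *\<^sub>R w"
      using block_replace_eq[OF mem] by (simp add: b_def)
    moreover have "(norm (b + t *\<^sub>R w))\<^sup>2 = (b \<bullet> b) + 2 * t * (b \<bullet> w) + t\<^sup>2 * (w \<bullet> w)"
      unfolding power2_norm_eq_inner
      by (simp add: inner_add_left inner_add_right inner_commute[of w b] power2_eq_square algebra_simps)
    ultimately show ?thesis by (simp add: g_def)
  qed
  have "convex_on UNIV g"
  proof (rule convex_onI)
    fix t a c :: real assume t: "0 < t" "t < 1"
    have "?f ((1 - t) *\<^sub>R (b + a *\<^sub>R w) + t *\<^sub>R (b + c *\<^sub>R w)) \<le>
        (1 - t) * ?f (b + a *\<^sub>R w) + t * ?f (b + c *\<^sub>R w)"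
      using t by (intro convex_onD[OF conv] mem) auto
    moreover have "(1 - t) *\<^sub>R (b + a *\<^sub>R w) + t *\<^sub>R (b + c *\<^sub>R w) = b + ((1 - t) * a + t * c) *\<^sub>R w"
      by (simp add: algebra_simps)
    ultimately show "g ((1 - t) *\<^sub>R a + t *\<^sub>R c) \<le> (1 - t) * g a + t * g c"
      by (simp add: g)
  qed auto
  moreover have "R differentiable (at (x + 0 *\<^sub>R w))" using smooth by (simp add: C1_def)
  from GDERIV_line[OF this]
  have "(g has_real_derivative grad R x \<bullet> w + \<mu> i * (b \<bullet> w)) (at 0)"
    unfolding g_def by (auto intro!: derivative_eq_intros)
  ultimately have "g 1 - g 0 \<ge> (grad R x \<bullet> w + \<mu> i * (b \<bullet> w)) * (1 - 0)"
    by (intro convex_on_imp_above_tangent[of UNIV g]) auto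
  then show ?thesis
    by (simp add: g_def power2_norm_eq_inner algebra_simps)
qed

text \<open>\<open>ARG_MIN\<close> carries no information until a minimizer exists. The bound on
  \<open>a\<close> makes the quadratic term dominate the concavity of \<open>R\<close>, so the
  objective grows quadratically and compactness applies; differentiation along lines then gives the
  optimality condition.\<close>

lemma prox_step_optimal:
  assumes i: "i \<in> {1..m}" and a: "0 < a" "a * \<mu> i < Lhat i"
  obtains d where "d \<in> block_space blk i" "prox_step blk F R Lhat i x a = x + d"
    "\<And>v. v \<in> block_space blk i \<Longrightarrow> (grad R (x + d) + grad F x + (Lhat i / a) *\<^sub>R d) \<bullet> v = 0"
proof -
  let ?S = "block_space blk i"
  define b where "b = block_part blk i x"
  have b: "b \<in> ?S" by (simp add: b_def block_part_in_space)
  define Q where "Q u = R (x + (u - b)) + block_grad blk i F x \<bullet> (u - b)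
                  + Lhat i / (2 * a) * (norm (u - b))\<^sup>2" for u
  define G where "G = grad R x + grad F x"
  define \<kappa> where "\<kappa> = (Lhat i / a - \<mu> i) / 2"
  have \<kappa>: "0 < \<kappa>" using a by (simp add: \<kappa>_def field_simps)
  have diff: "u - b \<in> ?S" if "u \<in> ?S" for u
    using that b by (intro subspace_diff block_space_subspace)
  have growth: "Q b + G \<bullet> (u - b) + \<kappa> * (norm (u - b))\<^sup>2 \<le> Q u" if "u \<in> ?S" for u
    using weakly_convex[OF i diff[OF that], of x] inner_block_part[OF diff[OF that], of "grad F x"]
    by (simp add: Q_def G_def \<kappa>_def block_grad_def inner_add_left algebra_simps diff_divide_distrib)
  have contQ: "continuous_on A Q" for A
    unfolding Q_def by (intro continuous_intros continuous_on_compose2[OF C1_continuous_on[OF smooth(2), of UNIV]]) auto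
  \<comment> \<open>Beyond the radius \<open>norm G / \<kappa>\<close> the growth
    \<open>\<kappa> * (norm (u - b))\<^sup>2\<close> outweighs the linear term, so no smaller value
    than \<open>Q b\<close> occurs there.\<close>
  have "compact (cball b (norm G / \<kappa>) \<inter> ?S)" by (intro compact_Int_closed compact_cball closed_block_space)
  moreover have b': "b \<in> cball b (norm G / \<kappa>) \<inter> ?S" using b \<kappa> by simp
  ultimately obtain u0 where u0: "u0 \<in> cball b (norm G / \<kappa>) \<inter> ?S"
    "\<And>u. u \<in> cball b (norm G / \<kappa>) \<inter> ?S \<Longrightarrow> Q u0 \<le> Q u"
    using continuous_attains_inf[OF _ _ contQ] by (metis empty_iff)
  have "Q u0 \<le> Q u" if u: "u \<in> ?S" for u
  proof (cases "u \<in> cball b (norm G / \<kappa>)")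
    case True
    then show ?thesis using u u0(2) by blast
  next
    case False
    then have "norm G \<le> \<kappa> * norm (u - b)"
      using \<kappa> by (simp add: dist_norm norm_minus_commute field_simps)
    then have "norm G * norm (u - b) \<le> \<kappa> * norm (u - b) * norm (u - b)" by (rule mult_right_mono) simp
    moreover have "- (norm G * norm (u - b)) \<le> G \<bullet> (u - b)"
      using Cauchy_Schwarz_ineq2[of G "u - b"] by linarith
    ultimately have "Q b \<le> Q u" using growth[OF u] by (simp add: power2_eq_square mult.assoc)
    with u0(2)[OF b'] show ?thesis by simp
  qed
  then have "is_arg_min Q (\<lambda>u. u \<in> ?S) u0" using u0(1) by (auto simp: is_arg_min_def not_less)
  then have min: "is_arg_min Q (\<lambda>u. u \<in> ?S) (arg_min Q (\<lambda>u. u \<in> ?S))"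
    unfolding arg_min_def by (rule someI)
  define p where "p = prox_block blk F R Lhat i x a"
  have "p = arg_min Q (\<lambda>u. u \<in> ?S)" unfolding p_def prox_block_def Q_def b_def ..
  with min have p: "p \<in> ?S" and p_min: "\<And>u. u \<in> ?S \<Longrightarrow> Q p \<le> Q u"
    by (auto simp: is_arg_min_def not_less)
  define d where "d = p - b"
  show thesis
  proof (rule that[of d])
    show "d \<in> ?S" unfolding d_def by (rule diff[OF p])
    show "prox_step blk F R Lhat i x a = x + d"
      unfolding prox_step_def p_def[symmetric] d_def b_def by (rule block_replace_eq[OF p])
    fix v assume v: "v \<in> ?S"
    define q where "q t = R (x + d + t *\<^sub>R v) + block_grad blk i F x \<bullet> d + t * (block_grad blk i F x \<bullet> v)
        + Lhat i / (2 * a) * ((d \<bullet> d) + 2 * t * (d \<bullet> v) + t\<^sup>2 * (v \<bullet> v))" for t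
    have q: "q t = Q (p + t *\<^sub>R v)" for t
    proof -
      have eq: "p + t *\<^sub>R v - b = d + t *\<^sub>R v" by (simp add: d_def)
      have "(norm (d + t *\<^sub>R v))\<^sup>2 = (d \<bullet> d) + 2 * t * (d \<bullet> v) + t\<^sup>2 * (v \<bullet> v)"
        unfolding power2_norm_eq_inner
        by (simp add: inner_add_left inner_add_right inner_commute[of v d] power2_eq_square algebra_simps)
      then show ?thesis unfolding q_def Q_def eq by (simp add: inner_add_right add.assoc)
    qed
    have "R differentiable (at (x + d + 0 *\<^sub>R v))" using smooth by (simp add: C1_def)
    from GDERIV_line[OF this]
    have "(q has_real_derivative grad R (x + d) \<bullet> v + block_grad blk i F x \<bullet> v + Lhat i / (2 * a) * (2 * (d \<bullet> v))) (at 0)"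
      using a(1) unfolding q_def by (auto intro!: derivative_eq_intros)
    moreover have "q 0 \<le> q t" for t
      unfolding q using p v p_min
      by (simp add: subspace_add[OF block_space_subspace] subspace_scale[OF block_space_subspace])
    ultimately have "grad R (x + d) \<bullet> v + block_grad blk i F x \<bullet> v + Lhat i / (2 * a) * (2 * (d \<bullet> v)) = 0"
      by (intro DERIV_local_min[of q _ 0 1]) auto
    then show "(grad R (x + d) + grad F x + (Lhat i / a) *\<^sub>R d) \<bullet> v = 0"
      using inner_block_part[OF v, of "grad F x"] by (simp add: inner_add_left block_grad_def)
  qed
qed

text \<open>Descent combines optimality tested with the step, smoothness of \<open>F\<close>, and
  weak convexity of \<open>R\<close> based at the new point. The upper bound uses weak convexity at
  both end points, the lower bound the optimality condition in the block together with the Lipschitz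
  bound on the sublevel set.\<close>

lemma
  fixes x :: "real ^ 'n"
  assumes i: "i \<in> {1..m}" and a: "0 < a" "a * \<mu> i < Lhat i"
  defines "y \<equiv> prox_step blk F R Lhat i x a"
  shows prox_step_descent:
      "Lhat i / a * (1 - a / 2) * (norm (y - x))\<^sup>2 \<le> (F x + R x) - (F y + R y)"
    and prox_step_upper:
      "(Lhat i / a - \<mu> i) * norm (y - x) \<le> norm (block_part blk i (grad F x + grad R x))"
    and prox_step_lower:
      "F x + R x \<le> F x0 + R x0 \<Longrightarrow> F y + R y \<le> F x0 + R x0 \<Longrightarrow>
        norm (block_part blk i (grad F x + grad R x)) \<le> (Lhat i / a + LR i) * norm (y - x)"
proof -
  let ?S = "block_space blk i"
  obtain d where d: "d \<in> ?S" and y: "y = x + d"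
    and opt: "\<And>v. v \<in> ?S \<Longrightarrow> (grad R (x + d) + grad F x + (Lhat i / a) *\<^sub>R d) \<bullet> v = 0"
    unfolding y_def using prox_step_optimal[OF i a] by blast
  have md: "- d \<in> ?S" using d by (rule subspace_neg[OF block_space_subspace])
  have bpd: "block_part blk i d = d"
    using d by (auto simp: block_part_def block_space_def vec_eq_iff)
  have opt_d: "grad R (x + d) \<bullet> d + grad F x \<bullet> d + Lhat i / a * (norm d)\<^sup>2 = 0"
    using opt[OF d] by (simp add: inner_add_left power2_norm_eq_inner)
  have wc1: "R x + grad R x \<bullet> d - \<mu> i / 2 * (norm d)\<^sup>2 \<le> R (x + d)"
    by (rule weakly_convex[OF i d])
  have wc2: "R (x + d) - grad R (x + d) \<bullet> d - \<mu> i / 2 * (norm d)\<^sup>2 \<le> R x"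
    using weakly_convex[OF i md, of "x + d"] by simp
  have "F (x + d) \<le> F x + block_grad blk i F x \<bullet> d + LF i / 2 * (norm d)\<^sup>2"
    using regular i d unfolding blockwise_regular_def by blast
  then have F: "F (x + d) \<le> F x + grad F x \<bullet> d + LF i / 2 * (norm d)\<^sup>2"
    using inner_block_part[OF d] by (simp add: block_grad_def)
  have "Lhat i / a * (1 - a / 2) * (norm d)\<^sup>2 = Lhat i / a * (norm d)\<^sup>2 - LF i / 2 * (norm d)\<^sup>2 - \<mu> i / 2 * (norm d)\<^sup>2"
    using a(1) by (simp add: Lhat field_simps)
  with F wc2 opt_d show "Lhat i / a * (1 - a / 2) * (norm (y - x))\<^sup>2 \<le> (F x + R x) - (F y + R y)"
    by (simp add: y)
  let ?g = "block_part blk i (grad F x + grad R x)"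
  have "(Lhat i / a - \<mu> i) * (norm d)\<^sup>2 \<le> - (?g \<bullet> d)"
    using wc1 wc2 opt_d inner_block_part[OF d, of "grad F x + grad R x"]
    by (simp add: inner_add_left algebra_simps)
  also have "\<dots> \<le> norm ?g * norm d" using Cauchy_Schwarz_ineq2[of ?g d] by linarith
  finally have "(Lhat i / a - \<mu> i) * norm d * norm d \<le> norm ?g * norm d"
    by (simp add: power2_eq_square mult.assoc)
  then show "(Lhat i / a - \<mu> i) * norm (y - x) \<le> norm ?g"
    by (cases "d = 0") (auto simp: y)
  assume le: "F x + R x \<le> F x0 + R x0" "F y + R y \<le> F x0 + R x0"
  \<comment> \<open>The optimality residual is orthogonal to the block space, hence to its own block
    part, which therefore vanishes.\<close>
  define e where "e = block_part blk i (grad R (x + d) + grad F x + (Lhat i / a) *\<^sub>R d)"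
  have "e \<bullet> e = 0"
    using opt[of e] inner_block_part[of e blk i] unfolding e_def by (simp add: block_part_in_space)
  then have "e = 0" by simp
  then have "block_grad blk i R (x + d) + block_part blk i (grad F x) + (Lhat i / a) *\<^sub>R d = 0"
    by (simp only: e_def block_grad_def block_part_add block_part_scaleR bpd)
  then have "?g = - (Lhat i / a) *\<^sub>R d - (block_grad blk i R (x + d) - block_grad blk i R x)"
    by (simp add: block_grad_def block_part_add eq_neg_iff_add_eq_0 algebra_simps)
  then have "norm ?g \<le> norm ((Lhat i / a) *\<^sub>R d) + norm (block_grad blk i R (x + d) - block_grad blk i R x)"
    using norm_triangle_ineq4[of "- (Lhat i / a) *\<^sub>R d"] by simp
  also have "norm (block_grad blk i R (x + d) - block_grad blk i R x) \<le> LR i * norm d"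
    using regular i d le unfolding blockwise_regular_def y by blast
  also have "norm ((Lhat i / a) *\<^sub>R d) = Lhat i / a * norm d"
    using a(1) constants(4)[OF i] by simp
  finally show "norm ?g \<le> (Lhat i / a + LR i) * norm (y - x)" by (simp add: y algebra_simps)
qed

end

subsection \<open>Almost sure behaviour of weighted averages\<close>

lemma AE_summable_if_integral_sum_le:
  fixes f :: "nat \<Rightarrow> 'w \<Rightarrow> real"
  assumes int: "\<And>k. integrable M (f k)"
    and nonneg: "\<And>k \<omega>. \<omega> \<in> space M \<Longrightarrow> 0 \<le> f k \<omega>"
    and le: "\<And>n. (\<Sum>k<n. \<integral>\<omega>. f k \<omega> \<partial>M) \<le> C"
  shows "AE \<omega> in M. summable (\<lambda>k. f k \<omega>)"
proof -
  have meas [measurable]: "f k \<in> borel_measurable M" for k using int by auto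
  have "(\<integral>\<^sup>+\<omega>. (\<Sum>k. ennreal (f k \<omega>)) \<partial>M) = (\<Sum>k. \<integral>\<^sup>+\<omega>. ennreal (f k \<omega>) \<partial>M)"
    by (intro nn_integral_suminf) simp
  also have "\<dots> = (\<Sum>k. ennreal (\<integral>\<omega>. f k \<omega> \<partial>M))"
    by (intro suminf_cong nn_integral_eq_integral int AE_I2 nonneg)
  also have "\<dots> \<le> ennreal C"
  proof (rule suminf_le_const)
    fix n
    have "(\<Sum>k<n. ennreal (\<integral>\<omega>. f k \<omega> \<partial>M)) = ennreal (\<Sum>k<n. \<integral>\<omega>. f k \<omega> \<partial>M)"
      by (intro sum_ennreal integral_nonneg_AE AE_I2 nonneg)
    then show "(\<Sum>k<n. ennreal (\<integral>\<omega>. f k \<omega> \<partial>M)) \<le> ennreal C"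
      using le[of n] by (simp add: ennreal_leI)
  qed simp
  finally have "(\<integral>\<^sup>+\<omega>. (\<Sum>k. ennreal (f k \<omega>)) \<partial>M) \<noteq> \<infinity>"
    using ennreal_less_top[of C] by (auto simp: top_unique)
  then have "AE \<omega> in M. (\<Sum>k. ennreal (f k \<omega>)) \<noteq> \<infinity>"
    by (intro nn_integral_noteq_infinite) simp_all
  then show ?thesis
  proof (rule AE_mp, intro AE_I2 impI)
    fix \<omega> assume "\<omega> \<in> space M" "(\<Sum>k. ennreal (f k \<omega>)) \<noteq> \<infinity>"
    then show "summable (\<lambda>k. f k \<omega>)"
      by (intro summable_suminf_not_top nonneg) auto
  qed
qed

text \<open>Given \<open>F\<close>, the factors \<open>g i\<close> are known and only the events
  \<open>A i\<close> are random, so each \<open>g i\<close> is pulled out of its conditional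
  expectation. The term \<open>b\<close> will carry the default value of \<open>z k\<close> where
  the gradient vanishes.\<close>

lemma (in finite_measure_subalgebra) real_cond_exp_ge_sum:
  fixes g :: "'i \<Rightarrow> 'a \<Rightarrow> real"
  assumes "finite J" and g: "\<And>i. g i \<in> borel_measurable F" "\<And>i \<omega>. \<omega> \<in> space M \<Longrightarrow> 0 \<le> g i \<omega>"
      "\<And>i \<omega>. \<omega> \<in> space M \<Longrightarrow> g i \<omega> \<le> B i"
    and A: "\<And>i. A i \<in> sets M"
      "\<And>i. i \<in> J \<Longrightarrow> AE \<omega> in M. real_cond_exp M F (indicator (A i)) \<omega> \<ge> p"
    and b: "b \<in> borel_measurable F" "integrable M b"
    and z: "integrable M z" "\<And>\<omega>. \<omega> \<in> space M \<Longrightarrow> b \<omega> + (\<Sum>i\<in>J. g i \<omega> * indicator (A i) \<omega>) \<le> z \<omega>"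
  shows "AE \<omega> in M. b \<omega> + p * (\<Sum>i\<in>J. g i \<omega>) \<le> real_cond_exp M F z \<omega>"
proof -
  have gM [measurable]: "g i \<in> borel_measurable M" for i
    using g(1) measurable_from_subalg[OF subalg] by blast
  note A(1) [measurable]
  have int: "integrable M (\<lambda>\<omega>. g i \<omega> * indicator (A i) \<omega>)" for i
    using g(2,3)[of _ i]
    by (intro integrable_const_bound[of _ "\<bar>B i\<bar>"] AE_I2)
       (auto split: split_indicator intro: order_trans[OF _ abs_ge_self])
  have int_sum: "integrable M (\<lambda>\<omega>. \<Sum>i\<in>J. g i \<omega> * indicator (A i) \<omega>)"
    by (intro Bochner_Integration.integrable_sum int)
  have "AE \<omega> in M. real_cond_exp M F (\<lambda>\<omega>. b \<omega> + (\<Sum>i\<in>J. g i \<omega> * indicator (A i) \<omega>)) \<omega> \<le> real_cond_exp M F z \<omega>"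
    using z by (intro real_cond_exp_mono AE_I2 Bochner_Integration.integrable_add b int_sum) auto
  moreover have "AE \<omega> in M. real_cond_exp M F (\<lambda>\<omega>. b \<omega> + (\<Sum>i\<in>J. g i \<omega> * indicator (A i) \<omega>)) \<omega> =
      real_cond_exp M F b \<omega> + real_cond_exp M F (\<lambda>\<omega>. \<Sum>i\<in>J. g i \<omega> * indicator (A i) \<omega>) \<omega>"
    by (intro real_cond_exp_add b int_sum)
  moreover have "AE \<omega> in M. real_cond_exp M F b \<omega> = b \<omega>"
    by (intro real_cond_exp_F_meas b)
  moreover have "AE \<omega> in M. real_cond_exp M F (\<lambda>\<omega>. \<Sum>i\<in>J. g i \<omega> * indicator (A i) \<omega>) \<omega> =
      (\<Sum>i\<in>J. real_cond_exp M F (\<lambda>\<omega>. g i \<omega> * indicator (A i) \<omega>) \<omega>)"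
    by (intro real_cond_exp_sum int)
  moreover have "AE \<omega> in M. \<forall>i\<in>J. p * g i \<omega> \<le> real_cond_exp M F (\<lambda>\<omega>. g i \<omega> * indicator (A i) \<omega>) \<omega>"
  proof (rule AE_finite_allI[OF \<open>finite J\<close>])
    fix i assume "i \<in> J"
    have "AE \<omega> in M. real_cond_exp M F (\<lambda>\<omega>. g i \<omega> * indicator (A i) \<omega>) \<omega> =
        g i \<omega> * real_cond_exp M F (indicator (A i)) \<omega>"
      by (intro real_cond_exp_mult g int) simp
    with A(2)[OF \<open>i \<in> J\<close>] AE_space show "AE \<omega> in M. p * g i \<omega> \<le> real_cond_exp M F (\<lambda>\<omega>. g i \<omega> * indicator (A i) \<omega>) \<omega>"
    proof eventually_elim
      case (elim \<omega>)
      then show ?case using g(2)[of \<omega> i] by (simp add: mult.commute[of p] mult_left_mono)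
    qed
  qed
  ultimately show ?thesis
  proof eventually_elim
    case (elim \<omega>)
    have "p * (\<Sum>i\<in>J. g i \<omega>) \<le> (\<Sum>i\<in>J. real_cond_exp M F (\<lambda>\<omega>. g i \<omega> * indicator (A i) \<omega>) \<omega>)"
      unfolding sum_distrib_left using elim by (intro sum_mono) auto
    with elim show ?case by simp
  qed
qed

text \<open>It is enough to control the averages along the times \<open>\<nu> j\<close> at which the total weight first
  reaches \<open>j\<^sup>2\<close>: the weighted sum is monotone and \<open>(j / (j + 1))\<^sup>2 \<longlonglongrightarrow> 1\<close>.\<close>

lemma liminf_weighted_average_ge:
  fixes \<alpha> z e :: "nat \<Rightarrow> real" and c :: real
  defines "A \<equiv> \<lambda>n. \<Sum>i=1..n. \<alpha> i"
  defines "\<nu> \<equiv> \<lambda>j::nat. LEAST n. (real j)\<^sup>2 \<le> A n"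
  assumes c: "0 < c" and alpha: "\<And>k. 0 < \<alpha> k" and div: "filterlim A at_top sequentially"
    and z: "\<And>k. 0 \<le> z k" and e: "\<And>k. c \<le> e k"
    and lim: "(\<lambda>j. (\<Sum>i=1..\<nu> (Suc j). \<alpha> i * (z i - e i)) / A (\<nu> (Suc j))) \<longlonglongrightarrow> 0"
  shows "ereal c \<le> liminf (\<lambda>n. ereal ((\<Sum>i=1..n. \<alpha> i * z i) / A n))"
  unfolding le_Liminf_iff
proof (intro allI impI)
  fix y assume y: "y < ereal c"
  have A_mono: "A m \<le> A n" if "m \<le> n" for m n
    unfolding A_def using that alpha by (intro sum_mono2) (auto simp: less_imp_le)
  have A_nonneg: "0 \<le> A n" for n unfolding A_def using alpha by (intro sum_nonneg) (auto simp: less_imp_le)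
  define q where "q j = (\<Sum>i=1..\<nu> j. \<alpha> i * (z i - e i)) / A (\<nu> j)" for j
  have q: "q \<longlonglongrightarrow> 0" using lim unfolding q_def[symmetric] by (rule LIMSEQ_imp_Suc)
  have "(\<lambda>j. (real j / (real j + 1))\<^sup>2) \<longlonglongrightarrow> 1"
    using tendsto_power[OF LIMSEQ_n_over_Suc_n[where ?'a=real], of 2] by (simp add: add.commute)
  then have L: "(\<lambda>j. (c + q j) * (real j / (real j + 1))\<^sup>2) \<longlonglongrightarrow> (c + 0) * 1"
    by (intro tendsto_intros q)
  have "\<forall>\<^sub>F j in sequentially. y < ereal ((c + q j) * (real j / (real j + 1))\<^sup>2)"
    using y L by (intro order_tendstoD(1)[of _ "ereal c"]) auto
  moreover have "\<forall>\<^sub>F j in sequentially. 0 < c + q j"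
    using tendsto_add[OF tendsto_const q, of c] c by (intro order_tendstoD(1)[of _ c]) auto
  ultimately have "\<forall>\<^sub>F j in sequentially. y < ereal ((c + q j) * (real j / (real j + 1))\<^sup>2) \<and> 0 < c + q j"
    by eventually_elim auto
  then obtain J0 where J0: "\<And>j. J0 \<le> j \<Longrightarrow> y < ereal ((c + q j) * (real j / (real j + 1))\<^sup>2) \<and> 0 < c + q j"
    unfolding eventually_sequentially by blast
  \<comment> \<open>The successor keeps \<open>j\<close> below at least 1, hence the total weight at
    \<open>\<nu> j\<close> positive.\<close>
  define J where "J = Suc J0"
  have "\<forall>\<^sub>F n in sequentially. (real J)\<^sup>2 \<le> A n" using div unfolding filterlim_at_top by blast
  then show "\<forall>\<^sub>F n in sequentially. y < ereal ((\<Sum>i=1..n. \<alpha> i * z i) / A n)"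
  proof eventually_elim
    case (elim n)
    \<comment> \<open>\<open>A n\<close> lies between the squares of \<open>j\<close> and
      \<open>j + 1\<close>, so \<open>\<nu> j \<le> n\<close> and the total weight at
      \<open>\<nu> j\<close> is at least the fraction \<open>(j / (j + 1))\<^sup>2\<close> of
      \<open>A n\<close>.\<close>
    define j where "j = nat \<lfloor>sqrt (A n)\<rfloor>"
    have j: "real j \<le> sqrt (A n)" "sqrt (A n) < real j + 1"
      using A_nonneg[of n] by (auto simp: j_def)
    have "real J \<le> sqrt (A n)" using elim by (intro real_le_rsqrt)
    then have "J \<le> j" unfolding j_def by (simp add: le_nat_floor)
    have An: "(real j)\<^sup>2 \<le> A n" "A n < (real j + 1)\<^sup>2"
      using j A_nonneg[of n] power_mono[OF j(1), of 2] power_strict_mono[OF j(2), of 2] by auto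
    have \<nu>: "\<nu> j \<le> n" "(real j)\<^sup>2 \<le> A (\<nu> j)"
      unfolding \<nu>_def using An(1) by (auto intro: Least_le LeastI)
    have jpos: "0 < real j" using \<open>J \<le> j\<close> by (simp add: J_def)
    then have pos: "0 < A (\<nu> j)" "0 < A n" using \<nu> An by (auto intro: less_le_trans[of 0 "(real j)\<^sup>2"])
    have "(c + q j) * A (\<nu> j) \<le> (\<Sum>i=1..\<nu> j. \<alpha> i * z i)"
    proof -
      have "c * A (\<nu> j) \<le> (\<Sum>i=1..\<nu> j. \<alpha> i * e i)"
        unfolding A_def sum_distrib_left using alpha e
        by (intro sum_mono) (simp add: mult.commute[of c] mult_left_mono less_imp_le)
      moreover have "q j * A (\<nu> j) = (\<Sum>i=1..\<nu> j. \<alpha> i * z i) - (\<Sum>i=1..\<nu> j. \<alpha> i * e i)"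
        using pos by (simp add: q_def sum_subtractf right_diff_distrib)
      ultimately show ?thesis by (simp add: distrib_right)
    qed
    also have "\<dots> \<le> (\<Sum>i=1..n. \<alpha> i * z i)"
      using \<nu>(1) alpha z by (intro sum_mono2) (auto simp: less_imp_le)
    finally have S: "(c + q j) * A (\<nu> j) \<le> (\<Sum>i=1..n. \<alpha> i * z i)" .
    have cq: "0 < c + q j" and yq: "y < ereal ((c + q j) * (real j / (real j + 1))\<^sup>2)"
      using J0[of j] \<open>J \<le> j\<close> by (auto simp: J_def)
    have "(real j / (real j + 1))\<^sup>2 \<le> A (\<nu> j) / A n"
      unfolding power_divide using \<nu> An pos by (intro frac_le) auto
    then have "(c + q j) * (real j / (real j + 1))\<^sup>2 \<le> (c + q j) * (A (\<nu> j) / A n)"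
      using cq by (intro mult_left_mono) auto
    also have "\<dots> \<le> (\<Sum>i=1..n. \<alpha> i * z i) / A n"
      using divide_right_mono[OF S, of "A n"] pos by simp
    finally show ?case using yq by (meson ereal_less_eq(3) less_le_trans)
  qed
qed

text \<open>\<open>z k\<close> is observed only at time \<open>Suc k\<close>, and its conditional
  mean given \<open>Fil k\<close> is at least \<open>c\<close>; the weighted averages are thus
  almost surely at least \<open>c\<close> plus a martingale average.\<close>

locale conditionally_bounded_weights = prob_space M
  for M :: "'w measure" +
  fixes Fil :: "nat \<Rightarrow> 'w measure" and z :: "nat \<Rightarrow> 'w \<Rightarrow> real" and \<alpha> :: "nat \<Rightarrow> real"
    and C c \<alpha>bar :: real
  assumes filtration: "filtration (space M) Fil" and subalg: "\<And>k. subalgebra M (Fil k)"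
    and z_meas: "\<And>k. z k \<in> borel_measurable (Fil (Suc k))"
    and z_bounds: "\<And>k \<omega>. \<omega> \<in> space M \<Longrightarrow> 0 \<le> z k \<omega>" "\<And>k \<omega>. \<omega> \<in> space M \<Longrightarrow> z k \<omega> \<le> C"
    and z_cond: "\<And>k. AE \<omega> in M. c \<le> real_cond_exp M (Fil k) (z k) \<omega>"
    and c: "0 < c"
    and alpha: "\<And>k. 0 < \<alpha> k" "\<And>k. \<alpha> k \<le> \<alpha>bar"
    and alpha_div: "filterlim (\<lambda>n. \<Sum>k<n. \<alpha> k) at_top sequentially"
begin

lemma cond_subalgebra: "finite_measure_subalgebra M (Fil k)"
  by unfold_locales (rule subalg)

lemma Fil_measurable_mono:
  "i \<le> j \<Longrightarrow> f \<in> borel_measurable (Fil i) \<Longrightarrow> f \<in> borel_measurable (Fil j)"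
  using filtration.sets_F_mono[OF filtration, of i j] filtration.space_F[OF filtration]
  by (intro measurable_from_subalg[of "Fil j" "Fil i"]) (auto simp: subalgebra_def)

lemma Fil_measurable_M: "f \<in> borel_measurable (Fil i) \<Longrightarrow> f \<in> borel_measurable M"
  using measurable_from_subalg[OF subalg] .

abbreviation e where "e k \<equiv> real_cond_exp M (Fil k) (z k)"

lemma z_M [measurable]: "z k \<in> borel_measurable M"
  using Fil_measurable_M[OF z_meas] .

lemma integrable_bounded:
  assumes "f \<in> borel_measurable M" "AE \<omega> in M. \<bar>f \<omega>\<bar> \<le> B"
  shows "integrable M (f :: _ \<Rightarrow> real)"
  using assms by (intro integrable_const_bound[of _ B]) auto

lemma integrable_z: "integrable M (z k)"
  using z_bounds by (intro integrable_bounded[of _ C]) auto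

lemma e_bounds: "AE \<omega> in M. 0 \<le> e k \<omega> \<and> e k \<omega> \<le> C"
proof -
  interpret finite_measure_subalgebra M "Fil k" by (rule cond_subalgebra)
  have "AE \<omega> in M. e k \<omega> \<ge> 0" "AE \<omega> in M. e k \<omega> \<le> C"
    using z_bounds by (auto intro!: real_cond_exp_ge_c real_cond_exp_le_c integrable_z)
  then show ?thesis by eventually_elim auto
qed

text \<open>Used twice: with \<open>N n\<close> as factor it makes the martingale increments
  orthogonal to the past, and with \<open>a k\<close> it lets the conditional mean replace
  \<open>z k\<close> under the integral.\<close>

lemma integral_mult_cond_exp:
  assumes "f \<in> borel_measurable (Fil k)" "AE \<omega> in M. \<bar>f \<omega>\<bar> \<le> B"
  shows "integrable M (\<lambda>\<omega>. f \<omega> * z k \<omega>)" "integrable M (\<lambda>\<omega>. f \<omega> * e k \<omega>)"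
    "(\<integral>\<omega>. f \<omega> * e k \<omega> \<partial>M) = (\<integral>\<omega>. f \<omega> * z k \<omega> \<partial>M)"
proof -
  interpret finite_measure_subalgebra M "Fil k" by (rule cond_subalgebra)
  have [measurable]: "f \<in> borel_measurable M" using assms(1) by (rule Fil_measurable_M)
  show int: "integrable M (\<lambda>\<omega>. f \<omega> * z k \<omega>)"
  proof (rule integrable_bounded[of _ "B * C"])
    show "AE \<omega> in M. \<bar>f \<omega> * z k \<omega>\<bar> \<le> B * C"
      using assms(2) AE_space
    proof eventually_elim
      case (elim \<omega>)
      then show ?case unfolding abs_mult using z_bounds[of \<omega> k] by (intro mult_mono) auto
    qed
  qed simp
  show "integrable M (\<lambda>\<omega>. f \<omega> * e k \<omega>)"
    "(\<integral>\<omega>. f \<omega> * e k \<omega> \<partial>M) = (\<integral>\<omega>. f \<omega> * z k \<omega> \<partial>M)"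
    using real_cond_exp_intg[OF int assms(1)] by auto
qed

text \<open>The martingale part of the weighted sum; like the averages in \<open>E0\<close> it
  starts with index 1.\<close>

definition N where "N n \<omega> = (\<Sum>i=1..n. \<alpha> i * (z i \<omega> - e i \<omega>))"

definition A where "A n = (\<Sum>i=1..n. \<alpha> i)"

lemma N_meas: "N n \<in> borel_measurable (Fil (Suc n))"
  unfolding N_def
proof (intro borel_measurable_sum)
  fix i assume "i \<in> {1..n}"
  then have [measurable]: "z i \<in> borel_measurable (Fil (Suc n))" "e i \<in> borel_measurable (Fil (Suc n))"
    using Fil_measurable_mono[OF _ z_meas, of i "Suc n"]
      Fil_measurable_mono[OF _ borel_measurable_cond_exp, of i "Suc n"] by auto
  show "(\<lambda>\<omega>. \<alpha> i * (z i \<omega> - e i \<omega>)) \<in> borel_measurable (Fil (Suc n))" by measurable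
qed

lemma N_M [measurable]: "N n \<in> borel_measurable M"
  using Fil_measurable_M[OF N_meas] .

lemma N_bound: "AE \<omega> in M. \<bar>N n \<omega>\<bar> \<le> C * A n"
proof -
  have "AE \<omega> in M. \<forall>i\<in>{1..n}. 0 \<le> e i \<omega> \<and> e i \<omega> \<le> C"
    by (intro AE_finite_allI e_bounds) simp
  then show ?thesis using AE_space
  proof eventually_elim
    case (elim \<omega>)
    have "\<bar>N n \<omega>\<bar> \<le> (\<Sum>i=1..n. \<bar>\<alpha> i * (z i \<omega> - e i \<omega>)\<bar>)" unfolding N_def by (rule sum_abs)
    also have "\<dots> \<le> (\<Sum>i=1..n. \<alpha> i * C)"
    proof (rule sum_mono)
      fix i assume "i \<in> {1..n}"
      then have "\<bar>z i \<omega> - e i \<omega>\<bar> \<le> C" using elim z_bounds[of \<omega> i] by fastforce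
      then show "\<bar>\<alpha> i * (z i \<omega> - e i \<omega>)\<bar> \<le> \<alpha> i * C"
        using alpha(1)[of i] by (simp add: abs_mult)
    qed
    finally show ?case by (simp add: A_def sum_distrib_left mult.commute)
  qed
qed

lemma integrable_N2: "integrable M (\<lambda>\<omega>. (N n \<omega>)\<^sup>2)"
proof (rule integrable_bounded[of _ "(C * A n)\<^sup>2"])
  show "AE \<omega> in M. \<bar>(N n \<omega>)\<^sup>2\<bar> \<le> (C * A n)\<^sup>2"
    using N_bound[of n] by eventually_elim (metis abs_ge_zero abs_power2 power2_abs power_mono)
qed simp

text \<open>Cross terms vanish and each centred square is at most \<open>C\<^sup>2\<close>;
  \<open>\<alpha> k \<le> \<alpha>bar\<close> turns the sum of squared weights into a multiple of
  the total weight.\<close>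

lemma second_moment: "(\<integral>\<omega>. (N n \<omega>)\<^sup>2 \<partial>M) \<le> C\<^sup>2 * \<alpha>bar * A n"
proof (induction n)
  case 0
  then show ?case by (simp add: N_def A_def)
next
  case (Suc n)
  let ?Y = "\<lambda>\<omega>. z (Suc n) \<omega> - e (Suc n) \<omega>"
  let ?a = "\<alpha> (Suc n)"
  \<comment> \<open>\<open>N n\<close> is known at time \<open>Suc n\<close>, the time on which
    \<open>z (Suc n)\<close> is conditioned.\<close>
  note orth = integral_mult_cond_exp[OF N_meas N_bound, of n]
  have [measurable]: "e (Suc n) \<in> borel_measurable M" by measurable
  have "AE \<omega> in M. \<bar>(?Y \<omega>)\<^sup>2\<bar> \<le> C\<^sup>2"
    using e_bounds[of "Suc n"] AE_space
  proof eventually_elim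
    case (elim \<omega>)
    then have "\<bar>?Y \<omega>\<bar> \<le> C" using z_bounds[of \<omega> "Suc n"] by fastforce
    then have "\<bar>?Y \<omega>\<bar>\<^sup>2 \<le> C\<^sup>2" by (intro power_mono) auto
    then show ?case by simp
  qed
  then have Y2: "integrable M (\<lambda>\<omega>. (?Y \<omega>)\<^sup>2)" "(\<integral>\<omega>. (?Y \<omega>)\<^sup>2 \<partial>M) \<le> C\<^sup>2"
    by (auto intro!: integrable_bounded integral_le_const)
  have "(N (Suc n) \<omega>)\<^sup>2 = (N n \<omega>)\<^sup>2 + 2 * ?a * (N n \<omega> * z (Suc n) \<omega> - N n \<omega> * e (Suc n) \<omega>) + ?a\<^sup>2 * (?Y \<omega>)\<^sup>2" for \<omega>
  proof -
    have eq: "N (Suc n) \<omega> = N n \<omega> + ?a * ?Y \<omega>" by (simp add: N_def)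
    show ?thesis unfolding eq by (simp add: power2_eq_square algebra_simps)
  qed
  then have "(\<integral>\<omega>. (N (Suc n) \<omega>)\<^sup>2 \<partial>M) = (\<integral>\<omega>. (N n \<omega>)\<^sup>2 \<partial>M) + ?a\<^sup>2 * (\<integral>\<omega>. (?Y \<omega>)\<^sup>2 \<partial>M)"
    using integrable_N2[of n] orth Y2(1) by simp
  also have "\<dots> \<le> C\<^sup>2 * \<alpha>bar * A n + (?a * \<alpha>bar) * C\<^sup>2"
    using Suc Y2(2) alpha[of "Suc n"]
    by (intro add_mono mult_mono) (auto simp: power2_eq_square intro: integral_nonneg_AE)
  also have "\<dots> = C\<^sup>2 * \<alpha>bar * A (Suc n)" by (simp add: A_def algebra_simps)
  finally show ?case .
qed

lemma A_at_top: "filterlim A at_top sequentially"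
proof -
  have "filterlim (\<lambda>n. \<Sum>k<Suc n. \<alpha> k) at_top sequentially"
    using alpha_div by (rule filterlim_compose) (rule filterlim_Suc)
  then have "filterlim (\<lambda>n. - \<alpha> 0 + (\<Sum>k<Suc n. \<alpha> k)) at_top sequentially"
    by (rule filterlim_tendsto_add_at_top[OF tendsto_const])
  moreover have "- \<alpha> 0 + (\<Sum>k<Suc n. \<alpha> k) = A n" for n
    by (simp add: A_def lessThan_Suc_atMost atMost_atLeast0 sum.atLeast_Suc_atMost del: sum.lessThan_Suc)
  ultimately show ?thesis by simp
qed

text \<open>At the times \<open>\<nu> j\<close> the second moment of \<open>N / A\<close> is of
  order \<open>1 / A\<close>, hence of order \<open>1 / j\<^sup>2\<close>, which is summable. So the
  squares are almost surely summable and the martingale average tends to 0 along these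
  times.\<close>

lemma AE_liminf_average:
  "AE \<omega> in M. ereal c \<le> liminf (\<lambda>n. ereal ((\<Sum>i=1..n. \<alpha> i * z i \<omega>) / (\<Sum>i=1..n. \<alpha> i)))"
proof -
  define \<nu> where "\<nu> j = (LEAST n. (real j)\<^sup>2 \<le> A n)" for j :: nat
  have \<nu>: "(real j)\<^sup>2 \<le> A (\<nu> j)" for j
  proof -
    have "\<forall>\<^sub>F n in sequentially. (real j)\<^sup>2 \<le> A n" using A_at_top unfolding filterlim_at_top by blast
    then obtain n where "(real j)\<^sup>2 \<le> A n" unfolding eventually_sequentially by blast
    then show ?thesis unfolding \<nu>_def by (rule LeastI)
  qed
  \<comment> \<open>Starting from \<open>Suc j\<close> avoids the level 0, which is reached at time
    0 with total weight 0.\<close>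
  have A_pos: "0 < A (\<nu> (Suc j))" for j
    using \<nu>[of "Suc j"] by (rule less_le_trans[rotated]) simp
  let ?f = "\<lambda>j \<omega>. (N (\<nu> (Suc j)) \<omega> / A (\<nu> (Suc j)))\<^sup>2"
  have summ: "summable (\<lambda>j. inverse ((real (Suc j))\<^sup>2))"
    using inverse_power_summable[of 2, where ?'a=real] by (subst summable_Suc_iff) simp
  have alphabar: "0 < \<alpha>bar" using alpha(1)[of 0] alpha(2)[of 0] by simp
  have "AE \<omega> in M. summable (\<lambda>j. ?f j \<omega>)"
  proof (rule AE_summable_if_integral_sum_le)
    show "integrable M (?f j)" for j
      unfolding power_divide by (intro integrable_divide_zero impI integrable_N2)
    fix n
    have "(\<integral>\<omega>. ?f j \<omega> \<partial>M) \<le> C\<^sup>2 * \<alpha>bar * inverse ((real (Suc j))\<^sup>2)" for j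
    proof -
      have "(\<integral>\<omega>. ?f j \<omega> \<partial>M) = (\<integral>\<omega>. (N (\<nu> (Suc j)) \<omega>)\<^sup>2 \<partial>M) / (A (\<nu> (Suc j)))\<^sup>2"
        by (simp add: power_divide)
      also have "\<dots> \<le> C\<^sup>2 * \<alpha>bar * A (\<nu> (Suc j)) / (A (\<nu> (Suc j)))\<^sup>2"
        by (intro divide_right_mono second_moment) simp
      also have "\<dots> = C\<^sup>2 * \<alpha>bar / A (\<nu> (Suc j))" using A_pos[of j] by (simp add: power2_eq_square)
      also have "\<dots> \<le> C\<^sup>2 * \<alpha>bar / (real (Suc j))\<^sup>2"
        using \<nu>[of "Suc j"] alphabar by (intro divide_left_mono mult_pos_pos A_pos) auto
      finally show ?thesis by (simp add: divide_inverse)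
    qed
    then have "(\<Sum>j<n. \<integral>\<omega>. ?f j \<omega> \<partial>M) \<le> (\<Sum>j<n. C\<^sup>2 * \<alpha>bar * inverse ((real (Suc j))\<^sup>2))"
      by (intro sum_mono)
    also have "\<dots> \<le> (\<Sum>j. C\<^sup>2 * \<alpha>bar * inverse ((real (Suc j))\<^sup>2))"
      using alphabar by (intro sum_le_suminf summable_mult summ) auto
    finally show "(\<Sum>j<n. \<integral>\<omega>. ?f j \<omega> \<partial>M) \<le> (\<Sum>j. C\<^sup>2 * \<alpha>bar * inverse ((real (Suc j))\<^sup>2))" .
  qed simp
  moreover have "AE \<omega> in M. \<forall>k. c \<le> e k \<omega>" using z_cond by (simp add: AE_all_countable)
  ultimately show ?thesis using AE_space
  proof eventually_elim
    case (elim \<omega>)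
    have "(\<lambda>j. ?f j \<omega>) \<longlonglongrightarrow> 0" using elim(1) by (rule summable_LIMSEQ_zero)
    then have "(\<lambda>j. sqrt (?f j \<omega>)) \<longlonglongrightarrow> sqrt 0" by (rule tendsto_real_sqrt)
    then have "(\<lambda>j. N (\<nu> (Suc j)) \<omega> / A (\<nu> (Suc j))) \<longlonglongrightarrow> 0"
      by (simp only: real_sqrt_abs real_sqrt_zero tendsto_rabs_zero_iff)
    then show ?case
      using liminf_weighted_average_ge[of c \<alpha> "\<lambda>i. z i \<omega>" "\<lambda>i. e i \<omega>"]
        c alpha(1) A_at_top z_bounds(1)[OF elim(3)] elim(2)
      unfolding N_def A_def[abs_def] \<nu>_def by blast
  qed
qed

text \<open>Since \<open>a k\<close> is known at time \<open>k\<close>, replacing \<open>z k\<close>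
  by its conditional mean costs only the factor \<open>c\<close> in expectation. It is used with the
  squared gradient norm for \<open>a k\<close>, where the pathwise bound \<open>D\<close> comes from
  the total decrease of \<open>H\<close>.\<close>

lemma AE_summable:
  assumes a: "\<And>k. a k \<in> borel_measurable (Fil k)" "\<And>k \<omega>. \<omega> \<in> space M \<Longrightarrow> 0 \<le> a k \<omega>"
      "\<And>k \<omega>. \<omega> \<in> space M \<Longrightarrow> a k \<omega> \<le> B"
    and le: "\<And>n \<omega>. \<omega> \<in> space M \<Longrightarrow> (\<Sum>k<n. \<alpha> k * (a k \<omega> * z k \<omega>)) \<le> D"
  shows "AE \<omega> in M. summable (\<lambda>k. \<alpha> k * a k \<omega>)"
proof (rule AE_summable_if_integral_sum_le)
  have aM [measurable]: "a k \<in> borel_measurable M" for k using a(1) by (rule Fil_measurable_M)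
  have bd: "AE \<omega> in M. \<bar>a k \<omega>\<bar> \<le> B" for k using a(2,3) by auto
  have int_a: "integrable M (a k)" for k by (rule integrable_bounded[OF aM bd])
  then show "integrable M (\<lambda>\<omega>. \<alpha> k * a k \<omega>)" for k by simp
  show "0 \<le> \<alpha> k * a k \<omega>" if "\<omega> \<in> space M" for k \<omega>
    using a(2)[OF that] alpha(1)[of k] by simp
  fix n
  note ce = integral_mult_cond_exp[OF a(1) bd]
  have "c * (\<integral>\<omega>. \<alpha> k * a k \<omega> \<partial>M) \<le> (\<integral>\<omega>. \<alpha> k * (a k \<omega> * z k \<omega>) \<partial>M)" for k
  proof -
    have "(\<integral>\<omega>. c * a k \<omega> \<partial>M) \<le> (\<integral>\<omega>. a k \<omega> * e k \<omega> \<partial>M)"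
    proof (rule integral_mono_AE)
      show "AE \<omega> in M. c * a k \<omega> \<le> a k \<omega> * e k \<omega>"
        using z_cond[of k] AE_space
      proof eventually_elim
        case (elim \<omega>)
        then show ?case using a(2)[of \<omega> k] by (simp add: mult.commute[of c] mult_left_mono)
      qed
    qed (use int_a ce in auto)
    then have "\<alpha> k * (c * (\<integral>\<omega>. a k \<omega> \<partial>M)) \<le> \<alpha> k * (\<integral>\<omega>. a k \<omega> * z k \<omega> \<partial>M)"
      using alpha(1)[of k] ce(3) by (intro mult_left_mono) auto
    then show ?thesis by (simp add: mult_ac)
  qed
  then have "c * (\<Sum>k<n. \<integral>\<omega>. \<alpha> k * a k \<omega> \<partial>M) \<le> (\<Sum>k<n. \<integral>\<omega>. \<alpha> k * (a k \<omega> * z k \<omega>) \<partial>M)"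
    unfolding sum_distrib_left by (intro sum_mono)
  also have "\<dots> = (\<integral>\<omega>. (\<Sum>k<n. \<alpha> k * (a k \<omega> * z k \<omega>)) \<partial>M)"
    using ce(1) by (subst Bochner_Integration.integral_sum) auto
  also have "\<dots> \<le> D"
    using ce(1) le by (intro integral_le_const AE_I2 Bochner_Integration.integrable_sum integrable_mult_right) auto
  finally show "(\<Sum>k<n. \<integral>\<omega>. \<alpha> k * a k \<omega> \<partial>M) \<le> D / c"
    using c by (simp add: pos_le_divide_eq mult.commute)
qed

end

text \<open>The increments are summable, so the sequence converges; a positive limit would make the
  weights summable.\<close>

lemma tendsto_0_if_weighted_summable:
  fixes a \<alpha> :: "nat \<Rightarrow> real"
  assumes alpha: "\<And>k. 0 < \<alpha> k" and div: "filterlim (\<lambda>n. \<Sum>k<n. \<alpha> k) at_top sequentially"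
    and a: "\<And>k. 0 \<le> a k" and summ: "summable (\<lambda>k. \<alpha> k * a k)"
    and diff: "\<And>k. \<bar>a (Suc k) - a k\<bar> \<le> C * (\<alpha> k * a k)"
  shows "a \<longlonglongrightarrow> 0"
proof -
  have "summable (\<lambda>k. a (Suc k) - a k)"
    by (rule summable_rabs_cancel, rule summable_comparison_test'[OF summable_mult[OF summ]])
       (use diff in auto)
  then have "convergent (\<lambda>n. \<Sum>k<n. a (Suc k) - a k)" by (simp add: summable_iff_convergent)
  then obtain L where "(\<lambda>n. a n - a 0) \<longlonglongrightarrow> L"
    by (auto simp: convergent_def sum_lessThan_telescope)
  then have "(\<lambda>n. a n - a 0 + a 0) \<longlonglongrightarrow> L + a 0" by (intro tendsto_intros)
  then have lim: "a \<longlonglongrightarrow> L + a 0" by simp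
  define l where "l = L + a 0"
  have "0 \<le> l" unfolding l_def using lim a by (intro LIMSEQ_le_const) auto
  moreover have "\<not> 0 < l"
  proof
    assume l: "0 < l"
    have "\<forall>\<^sub>F k in sequentially. l / 2 < a k"
      using lim l by (intro order_tendstoD) (auto simp: l_def)
    then have "\<forall>\<^sub>F k in sequentially. norm (\<alpha> k) \<le> 2 / l * (\<alpha> k * a k)"
    proof eventually_elim
      case (elim k)
      have "\<alpha> k * (l / 2) \<le> \<alpha> k * a k" using elim alpha[of k] by (intro mult_left_mono) auto
      then show ?case using alpha[of k] l by (simp add: field_simps)
    qed
    then have "summable \<alpha>" by (rule summable_comparison_test_ev) (intro summable_mult summ)
    then have "(\<lambda>n. \<Sum>k<n. \<alpha> k) \<longlonglongrightarrow> suminf \<alpha>" by (rule summable_LIMSEQ)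
    then show False using not_tendsto_and_filterlim_at_infinity[OF _ _ filterlim_at_top_imp_at_infinity[OF div]] by simp
  qed
  ultimately have "l = 0" by simp
  then show ?thesis using lim by (simp add: l_def)
qed

subsection \<open>The randomized block iteration\<close>

text \<open>The three estimates multiplied by the step size \<open>a\<close>, with constants
  depending only on the bound \<open>b\<close>, as in \<open>c1\<close>, \<open>c2\<close> and
  \<open>c3\<close>.\<close>

lemma (in prox_setting)
  fixes x :: "real ^ 'n"
  assumes i: "i \<in> {1..m}" and a: "0 < a" "a \<le> b" and b: "b < 2" "b * \<mu> i < Lhat i"
  defines "y \<equiv> prox_step blk F R Lhat i x a"
  shows step_decrease: "Lhat i * (1 - b / 2) * (norm (y - x))\<^sup>2 \<le> a * ((F x + R x) - (F y + R y))"
    and step_le: "(Lhat i - b * \<mu> i) * norm (y - x) \<le> a * norm (block_part blk i (grad F x + grad R x))"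
    and step_ge: "F x + R x \<le> F x0 + R x0 \<Longrightarrow>
      a * norm (block_part blk i (grad F x + grad R x)) \<le> (Lhat i + b * LR i) * norm (y - x)"
proof -
  note pos = constants[OF i]
  have ab: "a * \<mu> i \<le> b * \<mu> i" using a pos by (intro mult_right_mono) auto
  then have a': "a * \<mu> i < Lhat i" using b by simp
  note est = prox_step_descent[OF i a(1) a', of x, folded y_def]
    prox_step_upper[OF i a(1) a', of x, folded y_def]
    prox_step_lower[OF i a(1) a', of x, folded y_def]
  have "Lhat i * (1 - b / 2) * (norm (y - x))\<^sup>2 \<le> Lhat i * (1 - a / 2) * (norm (y - x))\<^sup>2"
    using a pos by (intro mult_right_mono mult_left_mono) auto
  also have "\<dots> = a * (Lhat i / a * (1 - a / 2) * (norm (y - x))\<^sup>2)" using a by simp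
  also have "\<dots> \<le> a * ((F x + R x) - (F y + R y))" using a est(1) by (intro mult_left_mono) auto
  finally show decrease: "Lhat i * (1 - b / 2) * (norm (y - x))\<^sup>2 \<le> a * ((F x + R x) - (F y + R y))" .
  have "(Lhat i - b * \<mu> i) * norm (y - x) \<le> (Lhat i - a * \<mu> i) * norm (y - x)"
    using ab by (intro mult_right_mono) auto
  also have "\<dots> = a * ((Lhat i / a - \<mu> i) * norm (y - x))" using a by (simp add: field_simps)
  also have "\<dots> \<le> a * norm (block_part blk i (grad F x + grad R x))"
    using a est(2) by (intro mult_left_mono) auto
  finally show "(Lhat i - b * \<mu> i) * norm (y - x) \<le> a * norm (block_part blk i (grad F x + grad R x))" .
  assume x: "F x + R x \<le> F x0 + R x0"
  have "0 \<le> Lhat i * (1 - b / 2) * (norm (y - x))\<^sup>2" using pos b by simp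
  with decrease have "0 \<le> a * ((F x + R x) - (F y + R y))" by linarith
  then have "F y + R y \<le> F x0 + R x0" using a x by (simp add: zero_le_mult_iff)
  then have "a * norm (block_part blk i (grad F x + grad R x)) \<le> a * ((Lhat i / a + LR i) * norm (y - x))"
    using a est(3) x by (intro mult_left_mono) auto
  also have "\<dots> = (Lhat i + a * LR i) * norm (y - x)" using a by (simp add: field_simps)
  also have "\<dots> \<le> (Lhat i + b * LR i) * norm (y - x)"
    using a pos by (intro mult_right_mono add_left_mono) auto
  finally show "a * norm (block_part blk i (grad F x + grad R x)) \<le> (Lhat i + b * LR i) * norm (y - x)" .
qed

theorem theorem12:
  fixes M :: "'w measure" and Fil :: "nat \<Rightarrow> 'w measure"
    and m :: nat and blk :: "'n::finite \<Rightarrow> nat"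
    and F R H :: "real ^ 'n \<Rightarrow> real"
    and S :: "nat \<Rightarrow> real list set set"
    and LF LR \<mu> Lhat :: "nat \<Rightarrow> real"
    and \<alpha> A :: "nat \<Rightarrow> real" and \<alpha>bar \<rho> c1 c2 c3 :: real
    and I :: "nat \<Rightarrow> 'w \<Rightarrow> nat"
    and x0 :: "real ^ 'n" and X :: "nat \<Rightarrow> 'w \<Rightarrow> real ^ 'n"
    and z :: "nat \<Rightarrow> 'w \<Rightarrow> real" and E0 :: "'w set"
    and \<phi> :: "real ^ 'n \<Rightarrow> real \<Rightarrow> real" and \<eta> :: "real ^ 'n \<Rightarrow> ereal" and t0 :: "real ^ 'n \<Rightarrow> real"
  assumes prob: "prob_space M"
    and filtration: "filtration (space M) Fil" "\<And>k. subalgebra M (Fil k)"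
    and blocks: "range blk = {1..m}"
    and smooth: "C1 F" "C1 R"
    and H: "H = (\<lambda>x. F x + R x)"
    and coercive: "coercive H"
    and definable: "o_minimal_structure S" "definable S H"
    and loc_lip: "locally_lipschitz (grad H)"
    and regular: "blockwise_regular m blk F R x0 LF LR \<mu>"
    and Lhat: "Lhat = (\<lambda>i. LF i + \<mu> i)"
    and step: "\<And>k. 0 < \<alpha> k" "\<And>k. \<alpha> k \<le> \<alpha>bar"
    and step_bound: "ereal \<alpha>bar <
          min 2 (Min ((\<lambda>i. if \<mu> i = 0 then \<infinity> else ereal (Lhat i / \<mu> i)) ` {1..m}))"
    and step_div: "filterlim (\<lambda>n. \<Sum>k<n. \<alpha> k) at_top sequentially"
    and sampling: "\<And>k. I k \<in> measurable M (count_space {1..m})"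
    and \<rho>: "\<rho> > 0"
    and sampling_lower: "\<And>i k. i \<in> {1..m} \<Longrightarrow>
          AE \<omega> in M. real_cond_exp M (Fil k) (indicator {\<omega>' \<in> space M. I k \<omega>' = i}) \<omega> \<ge> \<rho>"
    and adapted: "\<And>k. X k \<in> borel_measurable (Fil k)"
    and init: "\<And>\<omega>. \<omega> \<in> space M \<Longrightarrow> X 0 \<omega> = x0"
    and iter: "\<And>k \<omega>. \<omega> \<in> space M \<Longrightarrow>
          X (Suc k) \<omega> = prox_step blk F R Lhat (I k \<omega>) (X k \<omega>) (\<alpha> k)"
    and KL: "\<And>xb. critical_point H xb \<Longrightarrow> KL_desingularization H xb (\<eta> xb) (\<phi> xb)"
    and t0: "\<And>xb. critical_point H xb \<Longrightarrow> 0 < t0 xb \<and> ereal (t0 xb) < \<eta> xb"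
    and c1: "c1 = (1 - \<alpha>bar / 2) * Min (Lhat ` {1..m})"
    and c2: "c2 = \<rho> * Min ((\<lambda>i. 1 / (Lhat i + \<alpha>bar * LR i)\<^sup>2) ` {1..m})"
    and c3: "c3 = Max ((\<lambda>i. 1 / (Lhat i - \<alpha>bar * \<mu> i)\<^sup>2) ` {1..m})"
    and A: "A = (\<lambda>k. \<Sum>i<k. \<alpha> i)"
    and z: "z = (\<lambda>k \<omega>. if grad H (X k \<omega>) \<noteq> 0
                    then (norm (X (Suc k) \<omega> - X k \<omega>))\<^sup>2 / ((\<alpha> k)\<^sup>2 * (norm (grad H (X k \<omega>)))\<^sup>2)
                    else c2)"
    and E0: "E0 = {\<omega> \<in> space M.
                (\<lambda>k. (norm (grad H (X k \<omega>)))\<^sup>2) \<longlonglongrightarrow> 0 \<and>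
                liminf (\<lambda>k. ereal ((\<Sum>i=1..k. \<alpha> i * z i \<omega>) / (\<Sum>i=1..k. \<alpha> i))) \<ge> ereal c2}"
  shows "(\<forall>xb. critical_point H xb \<longrightarrow> integrable_near_0 (\<lambda>t. 1 / sqrt (KL_phi (\<phi> xb) t))) \<and>
    (\<forall>xb. critical_point H xb \<and> \<not> local_maximizer H xb \<longrightarrow>
       \<not> integrable_near_0 (\<lambda>t. 1 / KL_phi (\<phi> xb) t)) \<and>
    (\<exists>xs \<in> borel_measurable M.
       (AE \<omega> in M. critical_point H (xs \<omega>) \<and> H (xs \<omega>) \<le> H x0 \<and> (\<lambda>k. X k \<omega>) \<longlonglongrightarrow> xs \<omega>) \<and>
       E0 \<in> sets M \<and> measure M E0 = 1 \<and>
       (\<forall>\<omega>\<in>E0.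
          critical_point H (xs \<omega>) \<and> (\<lambda>k. X k \<omega>) \<longlonglongrightarrow> xs \<omega> \<and>
          (integrable_near_0 (\<lambda>t. 1 / KL_phi (\<phi> (xs \<omega>)) t) \<longrightarrow>
             eventually_constant (\<lambda>k. X k \<omega>)) \<and>
          (\<not> integrable_near_0 (\<lambda>t. 1 / KL_phi (\<phi> (xs \<omega>)) t) \<longrightarrow>
             KL_rates H (\<phi> (xs \<omega>)) (\<eta> (xs \<omega>)) (t0 (xs \<omega>)) c1 c2 A (\<lambda>k. X k \<omega>) (xs \<omega>)) \<and>
          (local_maximizer H (xs \<omega>) \<and> (\<exists>K. \<forall>k\<ge>K. X k \<omega> = xs \<omega>) \<or>
           \<not> local_maximizer H (xs \<omega>) \<and>
             KL_rates H (\<phi> (xs \<omega>)) (\<eta> (xs \<omega>)) (t0 (xs \<omega>)) c1 c2 A (\<lambda>k. X k \<omega>) (xs \<omega>))))"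
proof -
  interpret prob_space M by (fact prob)
  interpret prox_setting m blk F R x0 LF LR \<mu> Lhat
    using smooth regular Lhat by unfold_locales
  have C1H: "C1 H" unfolding H by (rule C1_add(1)[OF smooth])
  have gradH: "grad H x = grad F x + grad R x" for x unfolding H by (rule C1_add(2)[OF smooth])
  have diffH: "H differentiable (at x)" for x using C1H by (simp add: C1_def)
  have ne: "{1..m} \<noteq> {}" using blocks by (metis UNIV_not_empty image_is_empty)

  \<comment> \<open>Positivity of the constants\<close>
  have bar_pos: "0 < \<alpha>bar" using step(1)[of 0] step(2)[of 0] by simp
  have "ereal \<alpha>bar < 2" using step_bound by simp
  then have bar2: "\<alpha>bar < 2" by (simp add: numeral_eq_ereal)
  have bar_mu: "\<alpha>bar * \<mu> i < Lhat i" if i: "i \<in> {1..m}" for i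
  proof (cases "\<mu> i = 0")
    case False
    have "ereal \<alpha>bar < Min ((\<lambda>i. if \<mu> i = 0 then \<infinity> else ereal (Lhat i / \<mu> i)) ` {1..m})"
      using step_bound by simp
    also have "\<dots> \<le> (if \<mu> i = 0 then \<infinity> else ereal (Lhat i / \<mu> i))"
      using i by (intro Min_le finite_imageI imageI) simp
    finally have "\<alpha>bar < Lhat i / \<mu> i" using False by simp
    then show ?thesis using False constants(3)[OF i] by (simp add: pos_less_divide_eq)
  qed (use constants(4)[OF i] in simp)
  have c1_pos: "0 < c1" unfolding c1 using bar2 ne constants(4) by (auto simp: Min_gr_iff)
  have c1_le: "c1 \<le> Lhat i * (1 - \<alpha>bar / 2)" if "i \<in> {1..m}" for i
    unfolding c1 using bar2 that by (subst mult.commute, intro mult_right_mono Min_le) auto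
  define q where "q i = 1 / (Lhat i + \<alpha>bar * LR i)\<^sup>2" for i
  define qmin where "qmin = Min (q ` {1..m})"
  have den_pos: "0 < Lhat i + \<alpha>bar * LR i" if "i \<in> {1..m}" for i
    using constants[OF that] bar_pos by (intro add_pos_pos mult_pos_pos) auto
  have "0 < q i" if "i \<in> {1..m}" for i unfolding q_def using den_pos[OF that] by simp
  then have qmin_pos: "0 < qmin" unfolding qmin_def using ne by (subst Min_gr_iff) auto
  have qmin_le: "qmin \<le> q i" if "i \<in> {1..m}" for i unfolding qmin_def using that by (intro Min_le) auto
  have c2': "c2 = \<rho> * qmin" unfolding c2 qmin_def q_def ..
  have c2_pos: "0 < c2" using c2' \<rho> qmin_pos by simp
  have c3_ge: "1 / (Lhat i - \<alpha>bar * \<mu> i)\<^sup>2 \<le> c3" if "i \<in> {1..m}" for i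
    unfolding c3 using that by (intro Max_ge) auto
  have c3_nonneg: "0 \<le> c3"
  proof -
    obtain i where "i \<in> {1..m}" using ne by blast
    then have "1 / (Lhat i - \<alpha>bar * \<mu> i)\<^sup>2 \<le> c3" by (rule c3_ge)
    moreover have "0 \<le> 1 / (Lhat i - \<alpha>bar * \<mu> i)\<^sup>2" by simp
    ultimately show ?thesis by linarith
  qed

  \<comment> \<open>Pathwise estimates for one iteration\<close>
  let ?g = "\<lambda>k \<omega>. grad H (X k \<omega>)"
  let ?d = "\<lambda>k \<omega>. X (Suc k) \<omega> - X k \<omega>"
  have I: "I k \<omega> \<in> {1..m}" if "\<omega> \<in> space M" for k \<omega>
    using measurable_space[OF sampling that] by simp
  have step_descent: "c1 * (norm (?d k \<omega>))\<^sup>2 \<le> \<alpha> k * (H (X k \<omega>) - H (X (Suc k) \<omega>))"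
    if \<omega>: "\<omega> \<in> space M" for k \<omega>
  proof -
    have "c1 * (norm (?d k \<omega>))\<^sup>2 \<le> Lhat (I k \<omega>) * (1 - \<alpha>bar / 2) * (norm (?d k \<omega>))\<^sup>2"
      using c1_le[OF I[OF \<omega>]] by (intro mult_right_mono) auto
    also have "\<dots> \<le> \<alpha> k * (H (X k \<omega>) - H (X (Suc k) \<omega>))"
      using step_decrease[OF I[OF \<omega>] step bar2 bar_mu[OF I[OF \<omega>]]] unfolding iter[OF \<omega>] H by simp
    finally show ?thesis .
  qed
  have H_Suc: "H (X (Suc k) \<omega>) \<le> H (X k \<omega>)" if "\<omega> \<in> space M" for k \<omega>
  proof -
    have "0 \<le> c1 * (norm (?d k \<omega>))\<^sup>2" using c1_pos by simp
    with step_descent[OF that, of k] have "0 \<le> \<alpha> k * (H (X k \<omega>) - H (X (Suc k) \<omega>))" by linarith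
    then show ?thesis using step(1)[of k] by (simp add: zero_le_mult_iff)
  qed
  have sublevel: "H (X k \<omega>) \<le> H x0" if "\<omega> \<in> space M" for k \<omega>
    by (induction k) (use init[OF that] H_Suc[OF that] order_trans in auto)
  have d_le: "(norm (?d k \<omega>))\<^sup>2 \<le> c3 * ((\<alpha> k)\<^sup>2 * (norm (?g k \<omega>))\<^sup>2)" if \<omega>: "\<omega> \<in> space M" for k \<omega>
  proof -
    let ?i = "I k \<omega>"
    define D where "D = Lhat ?i - \<alpha>bar * \<mu> ?i"
    have D: "0 < D" using bar_mu[OF I[OF \<omega>]] by (simp add: D_def)
    have "D * norm (?d k \<omega>) \<le> \<alpha> k * norm (block_part blk ?i (?g k \<omega>))"
      using step_le[OF I[OF \<omega>] step bar2 bar_mu[OF I[OF \<omega>]]] unfolding iter[OF \<omega>] gradH D_def .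
    also have "\<dots> \<le> \<alpha> k * norm (?g k \<omega>)"
      using step(1)[of k] norm_block_part_le by (intro mult_left_mono) auto
    finally have "(D * norm (?d k \<omega>))\<^sup>2 \<le> (\<alpha> k * norm (?g k \<omega>))\<^sup>2"
      using D by (intro power_mono) auto
    then have "(norm (?d k \<omega>))\<^sup>2 \<le> 1 / D\<^sup>2 * (\<alpha> k * norm (?g k \<omega>))\<^sup>2"
      using D by (simp add: power_mult_distrib field_simps)
    also have "\<dots> \<le> c3 * (\<alpha> k * norm (?g k \<omega>))\<^sup>2"
      using c3_ge[OF I[OF \<omega>], of k] unfolding D_def by (intro mult_right_mono) auto
    finally show ?thesis by (simp add: power_mult_distrib)
  qed
  have d_ge: "q (I k \<omega>) * ((\<alpha> k)\<^sup>2 * (norm (block_part blk (I k \<omega>) (?g k \<omega>)))\<^sup>2) \<le> (norm (?d k \<omega>))\<^sup>2"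
    if \<omega>: "\<omega> \<in> space M" for k \<omega>
  proof -
    let ?i = "I k \<omega>"
    define D where "D = Lhat ?i + \<alpha>bar * LR ?i"
    have D: "0 < D" using den_pos[OF I[OF \<omega>]] by (simp add: D_def)
    have "\<alpha> k * norm (block_part blk ?i (?g k \<omega>)) \<le> D * norm (?d k \<omega>)"
      using step_ge[OF I[OF \<omega>] step bar2 bar_mu[OF I[OF \<omega>]]] sublevel[OF \<omega>, of k]
      unfolding iter[OF \<omega>] gradH D_def unfolding H by blast
    then have "(\<alpha> k * norm (block_part blk ?i (?g k \<omega>)))\<^sup>2 \<le> (D * norm (?d k \<omega>))\<^sup>2"
      using step(1)[of k] by (intro power_mono) auto
    then show ?thesis using D unfolding q_def D_def[symmetric] by (simp add: power_mult_distrib field_simps)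
  qed

  \<comment> \<open>The ratios \<open>z k\<close> and their conditional means\<close>
  have z_nonneg: "0 \<le> z k \<omega>" for k \<omega> unfolding z using c2_pos by simp
  \<comment> \<open>The maximum also covers the default value \<open>c2\<close>.\<close>
  have z_le: "z k \<omega> \<le> max c2 c3" if "\<omega> \<in> space M" for k \<omega>
  proof (cases "?g k \<omega> = 0")
    case False
    then have "z k \<omega> \<le> c3"
      using d_le[OF that, of k] step(1)[of k] by (simp add: z divide_le_eq)
    then show ?thesis by simp
  qed (simp add: z)
  \<comment> \<open>The normalization of \<open>z k\<close> cancels the gradient and one step size,
    leaving the squared step over \<open>\<alpha> k\<close>. Where the gradient vanishes the left
    side is 0, whatever the default value.\<close>
  have grad_descent: "c1 * (\<alpha> k * z k \<omega> * (norm (?g k \<omega>))\<^sup>2) \<le> H (X k \<omega>) - H (X (Suc k) \<omega>)"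
    if \<omega>: "\<omega> \<in> space M" for k \<omega>
  proof (cases "?g k \<omega> = 0")
    case False
    then have "c1 * (\<alpha> k * z k \<omega> * (norm (?g k \<omega>))\<^sup>2) = c1 * (norm (?d k \<omega>))\<^sup>2 / \<alpha> k"
      using step(1)[of k] by (simp add: z power2_eq_square)
    also have "\<dots> \<le> H (X k \<omega>) - H (X (Suc k) \<omega>)"
      using step_descent[OF \<omega>, of k] step(1)[of k] by (simp add: pos_divide_le_eq mult.commute)
    finally show ?thesis .
  qed (use H_Suc[OF \<omega>] in simp)

  have contG: "continuous_on UNIV (grad H)" using C1H by (simp add: C1_def)
  then have gradH_borel [measurable]: "grad H \<in> borel_measurable borel"
    by (rule borel_measurable_continuous_onI)
  have part_borel [measurable]: "block_part blk i \<in> borel_measurable borel" for i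
  proof -
    have "linear (block_part blk i)" by (intro linearI block_part_add block_part_scaleR)
    then show ?thesis
      by (intro borel_measurable_continuous_onI linear_continuous_on) (simp add: linear_conv_bounded_linear)
  qed
  have Fil_Suc: "f \<in> borel_measurable (Fil (Suc k))" if "f \<in> borel_measurable (Fil k)" for f :: "'w \<Rightarrow> real ^ 'n" and k
    using filtration.sets_F_mono[OF filtration(1), of k "Suc k"] filtration.space_F[OF filtration(1)] that
    by (intro measurable_from_subalg[of "Fil (Suc k)" "Fil k"]) (auto simp: subalgebra_def)
  have z_meas: "z k \<in> borel_measurable (Fil (Suc k))" for k
  proof -
    note [measurable] = adapted[of "Suc k"] Fil_Suc[OF adapted[of k]]
    show ?thesis unfolding z by measurable
  qed
  have z_cond: "AE \<omega> in M. c2 \<le> real_cond_exp M (Fil k) (z k) \<omega>" for k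
  proof -
    interpret finite_measure_subalgebra M "Fil k" by unfold_locales (rule filtration)
    note [measurable] = adapted[of k]
    \<comment> \<open>\<open>r i\<close> bounds \<open>z k\<close> from below if block
      \<open>i\<close> is sampled and the gradient is nonzero; it depends on \<open>X k\<close> only
      and so is known at time \<open>k\<close>.\<close>
    define r where "r i \<omega> = q i * ((norm (block_part blk i (?g k \<omega>)))\<^sup>2 / (norm (?g k \<omega>))\<^sup>2)" for i \<omega>
    define b where "b \<omega> = (if ?g k \<omega> = 0 then c2 else 0)" for \<omega>
    have q_nonneg: "0 \<le> q i" for i by (simp add: q_def)
    have r_meas: "r i \<in> borel_measurable (Fil k)" for i unfolding r_def by measurable
    have r_le: "r i \<omega> \<le> q i" for i \<omega>
    proof -
      have "(norm (block_part blk i (?g k \<omega>)))\<^sup>2 \<le> (norm (?g k \<omega>))\<^sup>2"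
        by (intro power_mono norm_block_part_le) simp
      then have "(norm (block_part blk i (?g k \<omega>)))\<^sup>2 / (norm (?g k \<omega>))\<^sup>2 \<le> 1" by (simp add: divide_le_eq)
      then show ?thesis unfolding r_def by (rule mult_left_le[OF _ q_nonneg])
    qed
    have b_meas: "b \<in> borel_measurable (Fil k)" unfolding b_def by measurable
    have b_int: "integrable M b"
      by (rule integrable_const_bound[of _ c2])
         (use c2_pos measurable_from_subalg[OF subalg b_meas] in \<open>auto simp: b_def\<close>)
    have z_int: "integrable M (z k)"
      using z_nonneg z_le measurable_from_subalg[OF filtration(2) z_meas]
      by (intro integrable_const_bound[of _ "max c2 c3"]) auto
    have Isets: "{\<omega>' \<in> space M. I k \<omega>' = i} \<in> sets M" for i
    proof -
      have "{\<omega>' \<in> space M. I k \<omega>' = i} = I k -` ({i} \<inter> {1..m}) \<inter> space M" using I by auto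
      then show ?thesis using measurable_sets[OF sampling, of "{i} \<inter> {1..m}" k] by simp
    qed
    have "AE \<omega> in M. b \<omega> + \<rho> * (\<Sum>i\<in>{1..m}. r i \<omega>) \<le> real_cond_exp M (Fil k) (z k) \<omega>"
    proof (rule real_cond_exp_ge_sum[of "{1..m}" r q "\<lambda>i. {\<omega>' \<in> space M. I k \<omega>' = i}"])
      fix \<omega> assume \<omega>: "\<omega> \<in> space M"
      have "(\<Sum>i\<in>{1..m}. r i \<omega> * indicator {\<omega>' \<in> space M. I k \<omega>' = i} \<omega>) = (\<Sum>i\<in>{1..m}. if i = I k \<omega> then r i \<omega> else 0)"
        using \<omega> by (intro sum.cong) (auto simp: indicator_def)
      also have "\<dots> = r (I k \<omega>) \<omega>" using I[OF \<omega>, of k] by (subst sum.delta) auto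
      finally show "b \<omega> + (\<Sum>i\<in>{1..m}. r i \<omega> * indicator {\<omega>' \<in> space M. I k \<omega>' = i} \<omega>) \<le> z k \<omega>"
        using d_ge[OF \<omega>, of k] step(1)[of k]
        by (cases "?g k \<omega> = 0") (simp_all add: b_def r_def z field_simps)
    qed (use r_meas r_le q_nonneg Isets sampling_lower b_meas b_int z_int in \<open>auto simp: r_def\<close>)
    \<comment> \<open>For a nonzero gradient, Pythagoras makes the block ratios add up to 1, which
      leaves \<open>\<rho> * qmin\<close>. For a zero gradient the default value of
      \<open>z k\<close> is exactly \<open>c2\<close>.\<close>
    moreover have "c2 \<le> b \<omega> + \<rho> * (\<Sum>i\<in>{1..m}. r i \<omega>)" for \<omega>
    proof (cases "?g k \<omega> = 0")
      case False
      have "qmin = qmin * ((\<Sum>i\<in>{1..m}. (norm (block_part blk i (?g k \<omega>)))\<^sup>2) / (norm (?g k \<omega>))\<^sup>2)"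
        using False sum_norm_block_part[of blk "{1..m}" "?g k \<omega>"] blocks by simp
      also have "\<dots> = (\<Sum>i\<in>{1..m}. qmin * ((norm (block_part blk i (?g k \<omega>)))\<^sup>2 / (norm (?g k \<omega>))\<^sup>2))"
        by (simp add: sum_distrib_left sum_divide_distrib)
      also have "\<dots> \<le> (\<Sum>i\<in>{1..m}. r i \<omega>)"
        unfolding r_def using qmin_le by (intro sum_mono mult_right_mono) auto
      finally show ?thesis unfolding c2' using \<rho> False by (simp add: b_def)
    qed (simp add: b_def r_def)
    ultimately show ?thesis by (auto elim!: eventually_mono intro: order_trans)
  qed

  \<comment> \<open>Almost sure decay of the gradient\<close>
  interpret W: conditionally_bounded_weights M Fil z \<alpha> "max c2 c3" c2 \<alpha>bar
    by unfold_locales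
      (rule filtration.space_F[OF filtration(1)] filtration(2) z_meas z_nonneg z_cond c2_pos step step_div
        | erule z_le filtration.sets_F_mono[OF filtration(1)])+

  have compact: "compact {y. H y \<le> H x0}" by (rule coercive_compact_sublevel[OF coercive C1H])
  obtain B where B: "\<And>y. H y \<le> H x0 \<Longrightarrow> \<bar>H y\<bar> \<le> B"
  proof -
    have "bounded (H ` {y. H y \<le> H x0})"
      by (intro compact_imp_bounded compact_continuous_image C1_continuous_on C1H compact)
    then show thesis using that unfolding bounded_iff by auto
  qed
  obtain G where G: "\<And>y. H y \<le> H x0 \<Longrightarrow> norm (grad H y) \<le> G"
  proof -
    have "bounded (grad H ` {y. H y \<le> H x0})"
      by (intro compact_imp_bounded compact_continuous_image continuous_on_subset[OF contG] compact) simp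
    then show thesis using that unfolding bounded_iff by auto
  qed
  obtain L where L: "L-lipschitz_on {y. H y \<le> H x0} (grad H)"
    by (rule locally_lipschitz_lipschitz_on_compact[OF loc_lip compact])
  have "AE \<omega> in M. summable (\<lambda>k. \<alpha> k * (norm (?g k \<omega>))\<^sup>2)"
  proof (rule W.AE_summable)
    show "(\<lambda>\<omega>. (norm (?g k \<omega>))\<^sup>2) \<in> borel_measurable (Fil k)" for k
    proof -
      note [measurable] = adapted[of k]
      show ?thesis by measurable
    qed
    show "(norm (?g k \<omega>))\<^sup>2 \<le> G\<^sup>2" if "\<omega> \<in> space M" for k \<omega>
      using G[OF sublevel[OF that]] by (intro power_mono) auto
    show "(\<Sum>k<n. \<alpha> k * ((norm (?g k \<omega>))\<^sup>2 * z k \<omega>)) \<le> (H x0 + B) / c1" if \<omega>: "\<omega> \<in> space M" for n \<omega>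
    proof -
      have "c1 * (\<Sum>k<n. \<alpha> k * ((norm (?g k \<omega>))\<^sup>2 * z k \<omega>)) \<le> (\<Sum>k<n. H (X k \<omega>) - H (X (Suc k) \<omega>))"
        unfolding sum_distrib_left using grad_descent[OF \<omega>] by (intro sum_mono) (simp add: mult_ac)
      also have "\<dots> = H x0 - H (X n \<omega>)"
        using sum_lessThan_telescope'[of "\<lambda>k. H (X k \<omega>)" n] init[OF \<omega>] by simp
      also have "\<dots> \<le> H x0 + B" using B[OF sublevel[OF \<omega>, of n]] by simp
      finally show ?thesis using c1_pos by (simp add: pos_le_divide_eq mult.commute)
    qed
  qed simp
  then have AE_grad: "AE \<omega> in M. (\<lambda>k. (norm (?g k \<omega>))\<^sup>2) \<longlonglongrightarrow> 0"
    using AE_space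
  proof eventually_elim
    case (elim \<omega>)
    \<comment> \<open>Relative change of the gradient norm per unit step size:
      \<open>sqrt c3\<close> bounds the step by the gradient, and \<open>L\<close> the change of the
      gradient by the step.\<close>
    define K where "K = L * sqrt c3"
    have L0: "0 \<le> L" using L by (rule lipschitz_on_nonneg)
    then have K0: "0 \<le> K" using c3_nonneg by (simp add: K_def)
    show ?case
    proof (rule tendsto_0_if_weighted_summable[OF step(1) step_div _ elim(1)])
      fix k
      let ?a = "norm (?g k \<omega>)" and ?b = "norm (?g (Suc k) \<omega>)"
      have "(norm (?d k \<omega>))\<^sup>2 \<le> (sqrt c3 * (\<alpha> k * ?a))\<^sup>2"
        using d_le[OF elim(2), of k] c3_nonneg by (simp add: power_mult_distrib)
      then have d: "norm (?d k \<omega>) \<le> sqrt c3 * (\<alpha> k * ?a)"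
        by (rule power2_le_imp_le) (use step(1)[of k] c3_nonneg in simp)
      have "\<bar>?b - ?a\<bar> \<le> norm (?g (Suc k) \<omega> - ?g k \<omega>)" by (rule norm_triangle_ineq3)
      also have "\<dots> \<le> L * norm (?d k \<omega>)"
        using lipschitz_onD[OF L, of "X (Suc k) \<omega>" "X k \<omega>"] sublevel[OF elim(2)] by (simp add: dist_norm)
      also have "\<dots> \<le> K * (\<alpha> k * ?a)"
        using mult_left_mono[OF d L0] by (simp add: K_def mult.assoc)
      finally have ba: "\<bar>?b - ?a\<bar> \<le> K * (\<alpha> k * ?a)" .
      also have "\<dots> \<le> K * (\<alpha>bar * ?a)"
        using K0 step by (intro mult_left_mono mult_right_mono) auto
      finally have "?b + ?a \<le> (2 + K * \<alpha>bar) * ?a" by (simp add: algebra_simps)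
      then have "\<bar>?b - ?a\<bar> * (?b + ?a) \<le> K * (\<alpha> k * ?a) * ((2 + K * \<alpha>bar) * ?a)"
        using ba K0 step(1)[of k] by (intro mult_mono) auto
      moreover have "\<bar>?b\<^sup>2 - ?a\<^sup>2\<bar> = \<bar>?b - ?a\<bar> * (?b + ?a)"
        by (simp add: power2_eq_square square_diff_square_factored abs_mult mult.commute)
      ultimately show "\<bar>?b\<^sup>2 - ?a\<^sup>2\<bar> \<le> K * (2 + K * \<alpha>bar) * (\<alpha> k * ?a\<^sup>2)"
        by (simp add: power2_eq_square mult_ac)
    qed simp
  qed

  \<comment> \<open>The event \<open>E0\<close> and its sample paths\<close>
  have X_M [measurable]: "X k \<in> borel_measurable M" for k
    using measurable_from_subalg[OF filtration(2) adapted] .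
  have E0_sets: "E0 \<in> sets M" unfolding E0 by measurable
  have AE_E0: "AE \<omega> in M. \<omega> \<in> E0"
    using AE_grad W.AE_liminf_average AE_space unfolding E0 by eventually_elim auto
  then have E0_prob: "measure M E0 = 1" using E0_sets by (simp add: prob_eq_1)
  \<comment> \<open>On divergent paths \<open>lim\<close> is one fixed unspecified point, so
    \<open>xs\<close> is measurable on the whole space.\<close>
  define xs where "xs \<omega> = lim (\<lambda>k. X k \<omega>)" for \<omega>
  have xs_meas: "xs \<in> borel_measurable M" unfolding xs_def[abs_def] by measurable

  have E0_conv:
    "critical_point H (xs \<omega>) \<and> H (xs \<omega>) \<le> H x0 \<and> (\<lambda>k. X k \<omega>) \<longlonglongrightarrow> xs \<omega> \<and>
     (integrable_near_0 (\<lambda>t. 1 / KL_phi (\<phi> (xs \<omega>)) t) \<longrightarrow> eventually_constant (\<lambda>k. X k \<omega>)) \<and>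
     (\<not> integrable_near_0 (\<lambda>t. 1 / KL_phi (\<phi> (xs \<omega>)) t) \<longrightarrow>
        KL_rates H (\<phi> (xs \<omega>)) (\<eta> (xs \<omega>)) (t0 (xs \<omega>)) c1 c2 A (\<lambda>k. X k \<omega>) (xs \<omega>)) \<and>
     (local_maximizer H (xs \<omega>) \<and> (\<exists>K. \<forall>k\<ge>K. X k \<omega> = xs \<omega>) \<or>
      \<not> local_maximizer H (xs \<omega>) \<and>
        KL_rates H (\<phi> (xs \<omega>)) (\<eta> (xs \<omega>)) (t0 (xs \<omega>)) c1 c2 A (\<lambda>k. X k \<omega>) (xs \<omega>))"
    if "\<omega> \<in> E0" for \<omega>
  proof -
    have \<omega>: "\<omega> \<in> space M" and lims: "(\<lambda>k. (norm (?g k \<omega>))\<^sup>2) \<longlonglongrightarrow> 0"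
      "liminf (\<lambda>k. ereal ((\<Sum>i=1..k. \<alpha> i * z i \<omega>) / (\<Sum>i=1..k. \<alpha> i))) \<ge> ereal c2"
      using that unfolding E0 by auto
    interpret T: descent_trajectory H "\<lambda>k. X k \<omega>" "\<lambda>k. z k \<omega>" \<alpha> c1 c2 \<alpha>bar \<phi> \<eta> t0
      by unfold_locales
        (rule C1H coercive loc_lip c1_pos c2_pos step step_div z_nonneg lims
          grad_descent[OF \<omega>] step_descent[OF \<omega>] | erule KL t0)+
    have "T.xs = xs \<omega>" unfolding T.xs_def xs_def ..
    moreover have "H T.xs \<le> H x0" using T.H_xs T.h_le[of 0] init[OF \<omega>] by simp
    ultimately show ?thesis
      using T.critical_xs T.x_tendsto T.finite_termination T.rates T.dichotomy unfolding A by metis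
  qed

  have "integrable_near_0 (\<lambda>t. 1 / sqrt (KL_phi (\<phi> xb) t))" if "critical_point H xb" for xb
    using desingularizing.integrable_inverse_sqrt_KL_phi KL_desingularizationD(1)[OF KL[OF that]] .
  moreover have "\<not> integrable_near_0 (\<lambda>t. 1 / KL_phi (\<phi> xb) t)"
    if "critical_point H xb" "\<not> local_maximizer H xb" for xb
    using not_integrable_if_not_local_maximizer[OF diffH loc_lip that KL[OF that(1)]] .
  moreover have "AE \<omega> in M. critical_point H (xs \<omega>) \<and> H (xs \<omega>) \<le> H x0 \<and> (\<lambda>k. X k \<omega>) \<longlonglongrightarrow> xs \<omega>"
    using AE_E0 by eventually_elim (use E0_conv in blast)
  ultimately show ?thesis
    using xs_meas E0_sets E0_prob E0_conv by blast
qed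

end
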